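(* Consider the sequence (indexed by $n$) of directed network models and the penalized likelihood estimator $\hat\theta=(\hat\vartheta^T,\hat\mu,\hat\gamma^T)^T$ with penalty $\lambda$ and rescaled penalty $\bar\lambda=\sqrt n\,\lambda$ described in the context. Suppose the standing assumptions (A1) and (A2) of the context hold and that $\sqrt n\,s_0\,\rho_n^{-1}\bar\lambda\to0$ as $n\to\infty$. Fix a confidence level $t>0$ and let $$a_n=\sqrt{\frac{2\log(2(2n+p+1))}{N}}\,(1\vee c).$$ Choose $\bar\lambda=\sqrt n\lambda$ such that $$\bar\lambda\ \ge\ 8\left(8a_n+2\sqrt{\frac tN\Big(11(1\vee(c^2p))+16(1\vee c)\sqrt n\,a_n\Big)}+\frac{4t(1\vee c)\sqrt n}{3N}\right).$$ Then, with probability at least $1-\exp(-t)$, $$\mathcal E(\hat\theta)+\bar\lambda\left(\frac1{\sqrt n}\|\hat\vartheta-\vartheta_0\|_1+|\hat\mu-\mu_0|+\|\hat\gamma-\gamma_0\|_1\right)\le C\,\frac{s_{0,+}\bar\lambda^2}{\rho_n},$$ where $C>0$ is a constant not depending on $n$.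
   Context: Notation: $N=n(n-1)$, $[m]=\{1,\dots,m\}$, $\mathbb{R}_+=[0,\infty)$, $a\vee b=\max\{a,b\}$. Vectors in $\mathbb{R}^N$ are indexed by ordered pairs $(i,j)$, $i\ne j$, $i,j\in[n]$. Model: for each $n$, $A\in\{0,1\}^{n\times n}$ is the adjacency matrix of a simple directed graph on $[n]$ ($A_{ii}=0$), and $Z_{ij}\in\mathbb{R}^p$, $i\neq j$, are random covariates ($p$ fixed). Parameters are $\theta=(\alpha^T,\beta^T,\mu,\gamma^T)^T\in\Theta=\mathbb{R}_+^n\times\mathbb{R}_+^n\times\mathbb{R}\times\mathbb{R}^p$, with $\vartheta=(\alpha^T,\beta^T)^T\in\mathbb{R}^{2n}$. Put $$p_{ij}(\theta)=\frac{\exp(\alpha_i+\beta_j+\mu+\gamma^TZ_{ij})}{1+\exp(\alpha_i+\beta_j+\mu+\gamma^TZ_{ij})}.$$ The true parameter is $\theta_0=(\alpha_0^T,\beta_0^T,\mu_0,\gamma_0^T)^T\in\Theta$ (it may depend on $n$), with $\min_i\alpha_{0,i}=\min_j\beta_{0,j}=0$ and $\vartheta_0=(\alpha_0^T,\beta_0^T)^T$. Given the covariates, the $A_{ij}$ are independent with $P(A_{ij}=1\mid Z_{ij})=p_{ij}:=p_{ij}(\theta_0)$. Sparsity: $S_0=\{i\in[2n]:\vartheta_{0,i}\ne0\}$, $s_0=|S_0|$, $s_{0,+}=s_0+p+1$. Network sparsity: there is a non-random sequence $\rho_n\in(0,1/2]$ (possibly $\rho_n\to0$) with $\rho_n\le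 p_{ij}\le1-\rho_n$ for all $i\ne j$; put $r_n=-\log(\rho_n/(1-\rho_n))\ge0$. Design matrix: $D\in\mathbb{R}^{N\times(2n+1+p)}$ has rows $D_{ij}^T=(e_i^T,e_j^T,1,Z_{ij}^T)$, with $e_i$ the standard basis vectors of $\mathbb{R}^n$. $\Theta_{\mathrm{loc}}=\{\theta\in\Theta:\|D\theta\|_\infty\le r_n\}$. Estimator: with $$\mathcal L(\theta)=\sum_{i\ne j}\big\{-A_{ij}D_{ij}^T\theta+\log(1+\exp(D_{ij}^T\theta))\big\},$$ $\hat\theta=(\hat\alpha^T,\hat\beta^T,\hat\mu,\hat\gamma^T)^T$, $\hat\vartheta=(\hat\alpha^T,\hat\beta^T)^T$, is a minimizer over $\Theta_{\mathrm{loc}}$ of $\frac1N\mathcal L(\theta)+\lambda(\|\alpha\|_1+\|\beta\|_1)$. Excess risk: $\mathcal E(\theta)=\frac1N E[\mathcal L(\theta)-\mathcal L(\theta_0)]$ for fixed $\theta$ (expectation over $(A,Z)$); $\mathcal E(\hat\theta)$ is this function evaluated at $\hat\theta$. (A1) The $Z_{ij}$ are independent with $E[Z_{ij}]=0$ and uniformly bounded; $c>0$ is a constant with $|Z_{ij,k}|\le c$ for all $i\ne j$, $k\in[p]$ and all $n$; $\gamma_0$ lies in a compact convex set $\Gamma\subset\mathbb{R}^p$; with $Z\in\mathbb{R}^{N\times p}$ the matrix with rows $Z_{ij}^T$, there are constants $C'>c_{\min}>0$ independent of $n$ with all eigenvalues of $\frac1N E[Z^TZ]$ in $[c_{\min},C']$,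 and $c_{\min}<1/2$. (A2) $\theta_0\in\Theta_{\mathrm{loc}}$ (the same $\rho_n$, $r_n$ are used for bounding the true link probabilities and for defining $\Theta_{\mathrm{loc}}$). *)

theory Defs
  imports "HOL-Probability.Probability"
begin

definition edge_pairs :: "nat \<Rightarrow> (nat \<times> nat) set" where
  "edge_pairs n = {(i, j). i \<in> {1..n} \<and> j \<in> {1..n} \<and> i \<noteq> j}"

definition num_pairs :: "nat \<Rightarrow> nat" where
  "num_pairs n = n * (n - 1)"

(* The node parameters are functions on nat, of which a model with n nodes only uses
   the values on {1..n}; the covariate dimension p is CARD('p). *)
record ('p :: finite) params =
  alpha :: "nat \<Rightarrow> real"
  beta  :: "nat \<Rightarrow> real"
  mu    :: real
  gamma :: "real ^ 'p"

(* The concatenation of alpha and beta, a vector indexed by {1..2n}. *)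
definition vartheta :: "nat \<Rightarrow> ('p :: finite) params \<Rightarrow> nat \<Rightarrow> real" where
  "vartheta n \<theta> k = (if k \<le> n then alpha \<theta> k else beta \<theta> (k - n))"

definition support :: "nat \<Rightarrow> ('p :: finite) params \<Rightarrow> nat set" where
  "support n \<theta> = {k \<in> {1..2 * n}. vartheta n \<theta> k \<noteq> 0}"

definition param_space :: "nat \<Rightarrow> ('p :: finite) params set" where
  "param_space n = {\<theta>. \<forall>i\<in>{1..n}. 0 \<le> alpha \<theta> i \<and> 0 \<le> beta \<theta> i}"

(* The entry (i,j) of D \<theta>, where the row (i,j) of D is (e_i, e_j, 1, z_ij). *)
definition lin_pred :: "(nat \<Rightarrow> nat \<Rightarrow> real ^ 'p) \<Rightarrow> ('p :: finite) params \<Rightarrow> nat \<Rightarrow> nat \<Rightarrow> real" where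
  "lin_pred z \<theta> i j = alpha \<theta> i + beta \<theta> j + mu \<theta> + gamma \<theta> \<bullet> z i j"

definition link_prob :: "(nat \<Rightarrow> nat \<Rightarrow> real ^ 'p) \<Rightarrow> ('p :: finite) params \<Rightarrow> nat \<Rightarrow> nat \<Rightarrow> real" where
  "link_prob z \<theta> i j = exp (lin_pred z \<theta> i j) / (1 + exp (lin_pred z \<theta> i j))"

(* The set depends on the realised covariates z. The maximum is the sup norm of D \<theta>. *)
definition local_space :: "nat \<Rightarrow> real \<Rightarrow> (nat \<Rightarrow> nat \<Rightarrow> real ^ 'p) \<Rightarrow> ('p :: finite) params set" where
  "local_space n r z =
     {\<theta> \<in> param_space n. (MAX (i, j)\<in>edge_pairs n. \<bar>lin_pred z \<theta> i j\<bar>) \<le> r}"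

definition neg_log_lik ::
  "nat \<Rightarrow> (nat \<Rightarrow> nat \<Rightarrow> real) \<Rightarrow> (nat \<Rightarrow> nat \<Rightarrow> real ^ 'p) \<Rightarrow> ('p :: finite) params \<Rightarrow> real" where
  "neg_log_lik n a z \<theta> =
     (\<Sum>(i, j)\<in>edge_pairs n. - a i j * lin_pred z \<theta> i j + ln (1 + exp (lin_pred z \<theta> i j)))"

definition penalized_loss ::
  "nat \<Rightarrow> real \<Rightarrow> (nat \<Rightarrow> nat \<Rightarrow> real) \<Rightarrow> (nat \<Rightarrow> nat \<Rightarrow> real ^ 'p) \<Rightarrow> ('p :: finite) params \<Rightarrow> real" where
  "penalized_loss n lam a z \<theta> =
     neg_log_lik n a z \<theta> / real (num_pairs n)
       + lam * ((\<Sum>i=1..n. \<bar>alpha \<theta> i\<bar>) + (\<Sum>j=1..n. \<bar>beta \<theta> j\<bar>))"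

(* The excess risk of a fixed \<theta>; at an estimator it is evaluated pointwise, that is,
   the expectation does not act on the estimator. *)
definition excess_risk ::
  "nat \<Rightarrow> 'a measure \<Rightarrow> (nat \<Rightarrow> nat \<Rightarrow> 'a \<Rightarrow> real) \<Rightarrow> (nat \<Rightarrow> nat \<Rightarrow> 'a \<Rightarrow> real ^ 'p)
    \<Rightarrow> ('p :: finite) params \<Rightarrow> 'p params \<Rightarrow> real" where
  "excess_risk n M A Z \<theta>0 \<theta> =
     (\<integral>\<omega>. neg_log_lik n (\<lambda>i j. A i j \<omega>) (\<lambda>i j. Z i j \<omega>) \<theta>
         - neg_log_lik n (\<lambda>i j. A i j \<omega>) (\<lambda>i j. Z i j \<omega>) \<theta>0 \<partial>M) / real (num_pairs n)"

definition covariate_algebra ::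
  "nat \<Rightarrow> 'a measure \<Rightarrow> (nat \<Rightarrow> nat \<Rightarrow> 'a \<Rightarrow> real ^ ('p :: finite)) \<Rightarrow> 'a measure" where
  "covariate_algebra n M Z =
     vimage_algebra (space M) (\<lambda>\<omega>. \<lambda>(i, j)\<in>edge_pairs n. Z i j \<omega>) (\<Pi>\<^sub>M e\<in>edge_pairs n. borel)"

(* Conditional independence of the random variables X i, i \<in> I, given the sub-sigma-algebra F. *)
definition cond_indep_vars ::
  "'a measure \<Rightarrow> 'a measure \<Rightarrow> ('i \<Rightarrow> 'b measure) \<Rightarrow> ('i \<Rightarrow> 'a \<Rightarrow> 'b) \<Rightarrow> 'i set \<Rightarrow> bool" where
  "cond_indep_vars M F N X I \<longleftrightarrow>
     (\<forall>i\<in>I. X i \<in> measurable M (N i)) \<and>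
     (\<forall>J\<subseteq>I. J \<noteq> {} \<longrightarrow> finite J \<longrightarrow> (\<forall>B\<in>(\<Pi> j\<in>J. sets (N j)).
        AE \<omega> in M. real_cond_exp M F (indicator (\<Inter>j\<in>J. X j -` B j \<inter> space M)) \<omega>
          = (\<Prod>j\<in>J. real_cond_exp M F (indicator (X j -` B j \<inter> space M)) \<omega>)))"

(* The matrix E[Z^T Z] / N, where the rows of the N x p matrix Z are the covariates. *)
definition gram_matrix ::
  "nat \<Rightarrow> 'a measure \<Rightarrow> (nat \<Rightarrow> nat \<Rightarrow> 'a \<Rightarrow> real ^ 'p) \<Rightarrow> real ^ 'p ^ ('p :: finite)" where
  "gram_matrix n M Z =
     (\<chi> k l. (\<integral>\<omega>. (\<Sum>(i, j)\<in>edge_pairs n. Z i j \<omega> $ k * Z i j \<omega> $ l) \<partial>M) / real (num_pairs n))"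

definition eigenvalues :: "real ^ 'm ^ ('m :: finite) \<Rightarrow> real set" where
  "eigenvalues S = {e. \<exists>v. v \<noteq> 0 \<and> S *v v = e *\<^sub>R v}"

definition a_rate :: "nat \<Rightarrow> real \<Rightarrow> nat \<Rightarrow> real" where
  "a_rate p c n = sqrt (2 * ln (2 * real (2 * n + p + 1)) / real (num_pairs n)) * max 1 c"

end

(* With b(x) = ln (1 + exp x), both the realised and the expected excess loss are averages of Bregman
   divergences of b at the true linear predictors, and they differ from the likelihood only through
   the noise A - E[A | Z], which is linear in the parameter. The pairs (A_ij, Z_ij) are independent,
   so Hoeffding's inequality and a union bound control, at the level 2 a_n <= lambar / 32, all row,
   column and total sums of the noise and of the covariates; the failure probability is O(1 / n),
   hence below exp (-t) for large n. For the finitely many remaining n the error is a finite random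
   variable, and the constant C can be enlarged.

   If sqrt n (s_0 + p + 1) lambar / rho is small, the basic inequality and a compatibility condition
   localise the estimator in a region where all increments of the linear predictor are at most 1.
   There the divergence is comparable to a weighted square, and the weighted sums of squares over the
   realised and over fresh covariates differ by a small multiple of the squared norm of the increment.

   The rate condition is void when s_0 = 0, so lambar / rho may then be large. In that case all
   linear predictors are equal up to a bounded shift: a Chebyshev bound with the correct variance,
   together with the linear growth of the divergence, handles the p + 1 unpenalised coordinates,
   unless the variance is O(1 / N). Then rho is so small that the radius r_n of the local space is
   already dominated by lambar^2 / rho. *)
theory Submission
  imports Defs "HOL-Real_Asymp.Real_Asymp"
begin

section \<open>The logistic Bregman divergence\<close>

text \<open>The obstacle is the gap between realised and expected loss at a random argument. Once
  the linear noise is removed, two averages of divergences remain, over observed and over fresh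
  covariates, whose curvature may be as small as \<rho>. Comparing them in an unweighted square norm
  would cost a second factor 1 / \<rho>. The curvature at the true predictor depends on the
  covariates only through gamma . Z, which is bounded by a constant \<open>K\<close>. Up to a factor
  exp K it is therefore a deterministic weight, the Bernoulli variance at the predictor without
  covariates. Weighted sums of covariates and of their centred products are still sums of
  independent centred variables, and carrying the same weights through both averages loses only
  constants. Passing from the weighted l1 norm to increments of size at most 1 costs sqrt n; this is
  where the sqrt n of the rate condition is spent. Probability enters only through exceptional
  events: outside of them, both regimes are deterministic statements about one realisation of the
  covariates.\<close>

definition softplus :: "real \<Rightarrow> real" where
  "softplus x = ln (1 + exp x)"

definition logistic :: "real \<Rightarrow> real" where
  "logistic x = exp x / (1 + exp x)"

definition logistic_var :: "real \<Rightarrow> real" where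
  "logistic_var x = logistic x * (1 - logistic x)"

text \<open>The divergence is parametrised by the increment d instead of the second point, because
  the true predictor stays fixed while increments are scaled and split.\<close>

definition bregman :: "real \<Rightarrow> real \<Rightarrow> real" where
  "bregman x d = softplus (x + d) - softplus x - logistic x * d"

lemma one_plus_exp_pos: "0 < 1 + exp (x::real)"
  by (simp add: add_pos_pos)

lemma one_plus_exp_neq_0 [simp]: "1 + exp (x::real) \<noteq> 0"
  using one_plus_exp_pos[of x] by simp

lemma logistic_pos: "0 < logistic x"
  by (simp add: logistic_def one_plus_exp_pos)

lemma logistic_less_1: "logistic x < 1"
  by (simp add: logistic_def one_plus_exp_pos)

lemma logistic_var_eq: "logistic_var x = exp x / (1 + exp x)\<^sup>2"
  by (simp add: logistic_var_def logistic_def field_simps power2_eq_square)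

lemma logistic_var_pos: "0 < logistic_var x"
  by (simp add: logistic_var_def logistic_pos logistic_less_1)

lemma logistic_var_le_1: "logistic_var x \<le> 1"
  unfolding logistic_var_def using logistic_pos[of x] logistic_less_1[of x]
  by (intro mult_le_one) auto

lemma has_real_derivative_softplus [derivative_intros]:
  assumes "(f has_real_derivative f') (at x)"
  shows "((\<lambda>x. softplus (f x)) has_real_derivative logistic (f x) * f') (at x)"
  unfolding softplus_def logistic_def
  by (rule derivative_eq_intros assms refl one_plus_exp_pos | simp)+

lemma has_real_derivative_logistic [derivative_intros]:
  assumes "(f has_real_derivative f') (at x)"
  shows "((\<lambda>x. logistic (f x)) has_real_derivative logistic_var (f x) * f') (at x)"
  unfolding logistic_var_eq logistic_def
  by (rule derivative_eq_intros assms refl one_plus_exp_neq_0)+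
    (simp add: field_simps power2_eq_square)

lemma continuous_on_softplus [continuous_intros]:
  "continuous_on S f \<Longrightarrow> continuous_on S (\<lambda>x. softplus (f x))"
  unfolding softplus_def by (intro continuous_intros) auto

lemma continuous_on_logistic [continuous_intros]:
  "continuous_on S f \<Longrightarrow> continuous_on S (\<lambda>x. logistic (f x))"
  unfolding logistic_def by (intro continuous_intros) auto

lemma softplus_measurable [measurable (raw)]:
  "f \<in> borel_measurable M \<Longrightarrow> (\<lambda>x. softplus (f x)) \<in> borel_measurable M"
  by (rule borel_measurable_continuous_on[OF continuous_on_softplus[OF continuous_on_id]])

lemma logistic_measurable [measurable (raw)]:
  "f \<in> borel_measurable M \<Longrightarrow> (\<lambda>x. logistic (f x)) \<in> borel_measurable M"
  by (rule borel_measurable_continuous_on[OF continuous_on_logistic[OF continuous_on_id]])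

lemma bregman_measurable [measurable (raw)]:
  assumes [measurable]: "f \<in> borel_measurable M" "g \<in> borel_measurable M"
  shows "(\<lambda>x. bregman (f x) (g x)) \<in> borel_measurable M"
  unfolding bregman_def by measurable

section \<open>Convexity, symmetry and curvature bounds of the divergence\<close>

lemma convex_on_bregman: "convex_on UNIV (bregman x)"
  by (rule f''_ge0_imp_convex[where f' = "\<lambda>d. logistic (x + d) - logistic x"
        and f'' = "\<lambda>d. logistic_var (x + d)"])
    (auto simp: bregman_def[abs_def] intro!: derivative_eq_intros less_imp_le[OF logistic_var_pos])

lemma bregman_0 [simp]: "bregman x 0 = 0"
  by (simp add: bregman_def)

text \<open>Convexity in the increment and the value 0 at 0. Shrinking an increment by \<tau>
  reduces the risk at least by the factor \<tau>, as linear terms do; this lets the basic inequality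
  survive shrinking.\<close>

lemma bregman_scale:
  assumes "0 \<le> \<tau>" "\<tau> \<le> 1"
  shows "bregman x (\<tau> * d) \<le> \<tau> * bregman x d"
  using convex_onD[OF convex_on_bregman[of x], of \<tau> 0 d] assms by simp

text \<open>Midpoint convexity separates two parts of an increment, so that each can be bounded by a
  different estimate.\<close>

lemma bregman_add:
  "bregman x (d + e) \<le> bregman x (2 * d) / 2 + bregman x (2 * e) / 2"
  using convex_onD[OF convex_on_bregman[of x], of "1/2" "2 * d" "2 * e"] by simp

lemma softplus_minus: "softplus (- x) = softplus x - x"
proof -
  have "1 + exp (- x) = (1 + exp x) * exp (- x)"
    by (simp add: distrib_right exp_minus)
  then show ?thesis
    unfolding softplus_def by (simp add: ln_mult one_plus_exp_pos)
qed

lemma logistic_minus: "logistic (- x) = 1 - logistic x"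
  by (simp add: logistic_def exp_minus field_simps)

lemma logistic_var_minus: "logistic_var (- x) = logistic_var x"
  by (simp add: logistic_var_def logistic_minus)

text \<open>The logistic model is symmetric under exchanging the labels 0 and 1. Estimates of the
  divergence are therefore proved for nonnegative increments and then reflected.\<close>

lemma bregman_minus: "bregman (- x) (- d) = bregman x d"
  using softplus_minus[of "x + d"] softplus_minus[of x]
  by (simp add: bregman_def logistic_minus algebra_simps)

text \<open>Self-concordance: the logarithm of \<open>logistic_var\<close> has derivative 1 - 2
  \<open>logistic\<close>, hence is 1-Lipschitz. For s \<ge> 0 the bound reduces to 1 + exp (x + s)
  \<le> exp s * (1 + exp x); negative shifts follow by reflection.\<close>

lemma logistic_var_shift: "exp (- \<bar>s\<bar>) * logistic_var x \<le> logistic_var (x + s)"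
proof -
  have main: "exp (- s) * logistic_var x \<le> logistic_var (x + s)" if "0 \<le> s" for s x :: real
  proof -
    have "1 + exp (x + s) \<le> exp s * (1 + exp x)"
      using that by (simp add: exp_add algebra_simps)
    then have "(1 + exp (x + s))\<^sup>2 \<le> (exp s * (1 + exp x))\<^sup>2"
      by (intro power_mono) (auto simp: add_nonneg_nonneg)
    then have "exp (x + s) / (exp s * (1 + exp x))\<^sup>2 \<le> exp (x + s) / (1 + exp (x + s))\<^sup>2"
      by (intro divide_left_mono) (auto simp: one_plus_exp_pos)
    moreover have "exp (x + s) / (exp s * (1 + exp x))\<^sup>2 = exp (- s) * logistic_var x"
      by (simp add: logistic_var_eq exp_add exp_minus power_mult_distrib divide_simps)
        (simp add: power2_eq_square)
    ultimately show ?thesis by (simp add: logistic_var_eq)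
  qed
  show ?thesis
  proof (cases "0 \<le> s")
    case True then show ?thesis using main[of s x] by simp
  next
    case False then show ?thesis
      using main[of "- s" "- x"] logistic_var_minus[of "x + s"] logistic_var_minus[of x] by simp
  qed
qed

lemma logistic_var_shift_upper: "logistic_var (x + s) \<le> exp \<bar>s\<bar> * logistic_var x"
proof -
  have "exp (- \<bar>s\<bar>) * logistic_var (x + s) \<le> logistic_var x"
    using logistic_var_shift[of "- s" "x + s"] by simp
  then show ?thesis by (simp add: exp_minus field_simps)
qed

text \<open>Integrating twice from 0 turns a comparison of second derivatives into a comparison of
  functions.\<close>

lemma nonneg_if_second_deriv_nonneg:
  fixes f f' f'' :: "real \<Rightarrow> real"
  assumes "\<And>t. (f has_real_derivative f' t) (at t)" "\<And>t. (f' has_real_derivative f'' t) (at t)"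
    and "f 0 = 0" "f' 0 = 0" "\<And>t. 0 \<le> t \<Longrightarrow> 0 \<le> f'' t" "0 \<le> s"
  shows "0 \<le> f s"
proof -
  have "f' 0 \<le> f' t" if "0 \<le> t" for t
    using that assms(2,5) by (intro DERIV_nonneg_imp_nondecreasing[OF that]) (auto intro!: exI)
  then have "f 0 \<le> f s"
    using assms by (intro DERIV_nonneg_imp_nondecreasing[OF \<open>0 \<le> s\<close>]) (metis)
  then show ?thesis using assms(3) by simp
qed

text \<open>The even function with second derivative exp (- |d|) whose value and slope vanish at 0.
  It behaves like d^2 / 2 near 0 and like |d| at infinity, so that one lower bound serves small and
  large increments.\<close>

definition exp_gap :: "real \<Rightarrow> real" where
  "exp_gap d = \<bar>d\<bar> - 1 + exp (- \<bar>d\<bar>)"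

text \<open>The second derivative of \<open>bregman x\<close> at d is
  \<open>logistic_var (x + d)\<close>, which self-concordance bounds below by exp (- |d|) times the
  variance at x. Two integrations produce \<open>exp_gap\<close>.\<close>

lemma bregman_lower: "logistic_var x * exp_gap d \<le> bregman x d"
proof -
  have main: "logistic_var x * (d - 1 + exp (- d)) \<le> bregman x d" if "0 \<le> d" for d x
  proof -
    have "0 \<le> bregman x d - logistic_var x * (d - 1 + exp (- d))"
    proof (rule nonneg_if_second_deriv_nonneg[OF _ _ _ _ _ that])
      show "((\<lambda>d. bregman x d - logistic_var x * (d - 1 + exp (- d))) has_real_derivative
         (logistic (x + t) - logistic x - logistic_var x * (1 - exp (- t)))) (at t)" for t
        unfolding bregman_def by (auto intro!: derivative_eq_intros)
      show "((\<lambda>t. logistic (x + t) - logistic x - logistic_var x * (1 - exp (- t)))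
         has_real_derivative logistic_var (x + t) - logistic_var x * exp (- t)) (at t)" for t
        by (auto intro!: derivative_eq_intros)
      show "0 \<le> logistic_var (x + t) - logistic_var x * exp (- t)" if "0 \<le> t" for t
        using logistic_var_shift[of t x] that by (simp add: mult.commute)
    qed auto
    then show ?thesis by simp
  qed
  show ?thesis
  proof (cases "0 \<le> d")
    case True then show ?thesis using main[of d x] by (simp add: exp_gap_def)
  next
    case False then show ?thesis
      using main[of "- d" "- x"] by (simp add: exp_gap_def logistic_var_minus bregman_minus)
  qed
qed

lemma bregman_upper: "bregman x d \<le> logistic_var x * (exp \<bar>d\<bar> - 1 - \<bar>d\<bar>)"
proof -
  have main: "bregman x d \<le> logistic_var x * (exp d - 1 - d)" if "0 \<le> d" for d x
  proof -
    have "0 \<le> logistic_var x * (exp d - 1 - d) - bregman x d"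
    proof (rule nonneg_if_second_deriv_nonneg[OF _ _ _ _ _ that])
      show "((\<lambda>d. logistic_var x * (exp d - 1 - d) - bregman x d) has_real_derivative
         (logistic_var x * (exp t - 1) - (logistic (x + t) - logistic x))) (at t)" for t
        unfolding bregman_def by (auto intro!: derivative_eq_intros)
      show "((\<lambda>t. logistic_var x * (exp t - 1) - (logistic (x + t) - logistic x))
         has_real_derivative logistic_var x * exp t - logistic_var (x + t)) (at t)" for t
        by (auto intro!: derivative_eq_intros)
      show "0 \<le> logistic_var x * exp t - logistic_var (x + t)" if "0 \<le> t" for t
        using logistic_var_shift_upper[of x t] that by (simp add: mult.commute)
    qed auto
    then show ?thesis by simp
  qed
  show ?thesis
  proof (cases "0 \<le> d")
    case True then show ?thesis using main[of d x] by simp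
  next
    case False then show ?thesis
      using main[of "- d" "- x"] by (simp add: logistic_var_minus bregman_minus)
  qed
qed

text \<open>\<open>softplus\<close> is increasing and 1-Lipschitz. The bound carries no curvature
  and holds for increments of any size.\<close>

lemma bregman_le_abs: "bregman x d \<le> \<bar>d\<bar>"
proof -
  have main: "bregman x d \<le> d" if "0 \<le> d" for d x
  proof -
    have "softplus (x + d) \<le> softplus x + d"
    proof -
      have "1 + exp (x + d) \<le> (1 + exp x) * exp d"
        using that by (simp add: exp_add algebra_simps)
      then have "ln (1 + exp (x + d)) \<le> ln ((1 + exp x) * exp d)"
        by (subst ln_le_cancel_iff) (auto simp: one_plus_exp_pos)
      then show ?thesis
        unfolding softplus_def by (simp add: ln_mult one_plus_exp_pos)
    qed
    moreover have "0 \<le> logistic x * d" using that logistic_pos[of x] by simp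
    ultimately show ?thesis by (simp add: bregman_def)
  qed
  show ?thesis
  proof (cases "0 \<le> d")
    case True then show ?thesis using main[of d x] by simp
  next
    case False then show ?thesis
      using main[of "- d" "- x"] by (simp add: bregman_minus)
  qed
qed

lemma exp_gap_nonneg: "0 \<le> exp_gap d"
  unfolding exp_gap_def using exp_ge_add_one_self[of "- \<bar>d\<bar>"] by linarith

lemma bregman_nonneg: "0 \<le> bregman x d"
  using bregman_lower[of x d] exp_gap_nonneg[of d] logistic_var_pos[of x]
  by (meson less_imp_le mult_nonneg_nonneg order_trans)

lemma exp_gap_lower: "d\<^sup>2 / (2 + \<bar>d\<bar>) \<le> exp_gap d"
proof -
  define s where "s = \<bar>d\<bar>"
  have "0 \<le> s" by (simp add: s_def)
  \<comment> \<open>With s = |d| the claim rearranges to (2 - s) * exp s \<le> s + 2. Both sides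
    agree at 0, and their difference has derivative 1 - (1 - s) * exp s, nonnegative because 1 - s
    \<le> exp (- s).\<close>
  have "(0::real) + 2 - (2 - 0) * exp 0 \<le> s + 2 - (2 - s) * exp s"
  proof (rule DERIV_nonneg_imp_nondecreasing[OF \<open>0 \<le> s\<close>, where f = "\<lambda>s. s + 2 - (2 - s) * exp s"])
    fix t :: real
    have "((\<lambda>s. s + 2 - (2 - s) * exp s) has_real_derivative (1 - (1 - t) * exp t)) (at t)"
      by (auto intro!: derivative_eq_intros simp: algebra_simps)
    moreover have "(1 - t) * exp t \<le> 1"
    proof -
      have "(1 - t) * exp t \<le> exp (- t) * exp t"
        using exp_ge_add_one_self[of "- t"] by (intro mult_right_mono) auto
      then show ?thesis by (simp flip: exp_add)
    qed
    ultimately show "\<exists>y. ((\<lambda>s. s + 2 - (2 - s) * exp s) has_real_derivative y) (at t) \<and> 0 \<le> y"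
      by (auto intro!: exI)
  qed
  then have "(2 - s) * exp s * exp (- s) \<le> (s + 2) * exp (- s)"
    by (intro mult_right_mono) auto
  then have "2 - s \<le> (s + 2) * exp (- s)" by (simp add: mult.assoc flip: exp_add)
  then have "s\<^sup>2 \<le> (s - 1 + exp (- s)) * (2 + s)"
    by (simp add: algebra_simps power2_eq_square)
  then have "s\<^sup>2 / (2 + s) \<le> s - 1 + exp (- s)"
    using \<open>0 \<le> s\<close> by (simp add: pos_divide_le_eq)
  then show ?thesis by (simp add: exp_gap_def s_def)
qed

lemma exp_gap_upper: "exp_gap d \<le> min 1 \<bar>d\<bar> * \<bar>d\<bar>"
proof (cases "\<bar>d\<bar> \<le> 1")
  case True
  have "exp (- \<bar>d\<bar>) \<le> 1 - \<bar>d\<bar> + \<bar>d\<bar> * \<bar>d\<bar>"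
  proof -
    have "(1 - \<bar>d\<bar> + \<bar>d\<bar> * \<bar>d\<bar>) * (1 + \<bar>d\<bar>) = 1 + \<bar>d\<bar> ^ 3"
      by (simp add: algebra_simps power3_eq_cube)
    then have "1 \<le> (1 - \<bar>d\<bar> + \<bar>d\<bar> * \<bar>d\<bar>) * (1 + \<bar>d\<bar>)"
      by simp
    also have "\<dots> \<le> (1 - \<bar>d\<bar> + \<bar>d\<bar> * \<bar>d\<bar>) * exp \<bar>d\<bar>"
      using exp_ge_add_one_self[of "\<bar>d\<bar>"] True by (intro mult_left_mono) auto
    finally show ?thesis by (simp add: exp_minus field_simps)
  qed
  then show ?thesis using True by (simp add: exp_gap_def)
next
  case False
  then show ?thesis by (simp add: exp_gap_def)
qed

text \<open>The slope of the convex function \<open>exp_gap\<close> at e has absolute value 1 - exp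
  (- |e|) \<le> min 1 |e|. For |y| \<le> |e| the worst shift moves e towards 0; for larger y the
  left-hand side is at most 0 by \<open>exp_gap_upper\<close>.\<close>

lemma exp_gap_add: "exp_gap e - min 1 \<bar>e\<bar> * \<bar>y\<bar> \<le> exp_gap (e + y)"
proof (cases "\<bar>y\<bar> \<le> \<bar>e\<bar>")
  case True
  define s t where "s = \<bar>e\<bar>" and "t = \<bar>y\<bar>"
  have st: "0 \<le> t" "t \<le> s" using True by (auto simp: s_def t_def)
  have mono: "u - 1 + exp (- u) \<le> v - 1 + exp (- v)" if "0 \<le> u" "u \<le> v" for u v :: real
    by (rule DERIV_nonneg_imp_nondecreasing[OF that(2), where f = "\<lambda>u. u - 1 + exp (- u)"])
      (use that in \<open>auto intro!: derivative_eq_intros exI[of _ "1 - exp (- _)"]\<close>)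
  have "s - t - 1 + exp (- (s - t)) \<le> exp_gap (e + y)"
    unfolding exp_gap_def by (rule mono) (use st in \<open>auto simp: s_def t_def\<close>)
  moreover have "exp (- s) * (1 + t) \<le> exp (- s) * exp t"
    by (intro mult_left_mono exp_ge_add_one_self) auto
  then have "exp (- s) * t - t \<le> exp (- (s - t)) - exp (- s) - t"
    by (simp add: algebra_simps exp_diff exp_minus field_simps)
  moreover have "(1 - exp (- s)) * t \<le> min 1 s * t"
    using exp_ge_add_one_self[of "- s"] st by (intro mult_right_mono) auto
  ultimately show ?thesis
    unfolding s_def[symmetric] t_def[symmetric] exp_gap_def[of e]
    by (simp add: algebra_simps)
next
  case False
  have "exp_gap e \<le> min 1 \<bar>e\<bar> * \<bar>e\<bar>" by (rule exp_gap_upper)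
  also have "\<dots> \<le> min 1 \<bar>e\<bar> * \<bar>y\<bar>" using False by (intro mult_left_mono) auto
  finally show ?thesis using exp_gap_nonneg[of "e + y"] by linarith
qed

lemma exp_remainder_le:
  assumes "0 \<le> s" shows "exp s - 1 - s \<le> s\<^sup>2 * exp s / (2::real)"
proof -
  have "0 \<le> s\<^sup>2 * exp s / 2 - (exp s - 1 - s)"
  proof (rule nonneg_if_second_deriv_nonneg[OF _ _ _ _ _ assms])
    show "((\<lambda>s. s\<^sup>2 * exp s / 2 - (exp s - 1 - s)) has_real_derivative
      (t * exp t + t\<^sup>2 * exp t / 2 - (exp t - 1))) (at t)" for t :: real
      by (auto intro!: derivative_eq_intros simp: algebra_simps)
    show "((\<lambda>t. t * exp t + t\<^sup>2 * exp t / 2 - (exp t - 1)) has_real_derivative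
      (2 * t * exp t + t\<^sup>2 * exp t / 2)) (at t)" for t :: real
      by (auto intro!: derivative_eq_intros simp: algebra_simps)
  qed auto
  then show ?thesis by simp
qed

section \<open>Averages over ordered pairs\<close>

definition pair_avg :: "nat \<Rightarrow> (nat \<Rightarrow> nat \<Rightarrow> real) \<Rightarrow> real" where
  "pair_avg n f = (\<Sum>(i, j)\<in>edge_pairs n. f i j) / real (num_pairs n)"

lemma finite_edge_pairs [simp]: "finite (edge_pairs n)"
  by (rule finite_subset[of _ "{1..n} \<times> {1..n}"]) (auto simp: edge_pairs_def)

lemma edge_pairs_Sigma: "edge_pairs n = (SIGMA i:{1..n}. {1..n} - {i})"
  by (auto simp: edge_pairs_def)

lemma sum_edge_pairs_rows:
  "(\<Sum>(i, j)\<in>edge_pairs n. f i j) = (\<Sum>i=1..n. \<Sum>j\<in>{1..n} - {i}. f i j)"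
  unfolding edge_pairs_Sigma by (simp add: sum.Sigma)

lemma sum_edge_pairs_cols:
  "(\<Sum>(i, j)\<in>edge_pairs n. f i j) = (\<Sum>j=1..n. \<Sum>i\<in>{1..n} - {j}. f i j)"
proof -
  have "(\<Sum>(i, j)\<in>edge_pairs n. f i j) = (\<Sum>(j, i)\<in>edge_pairs n. f i j)"
    by (rule sum.reindex_bij_witness[of _ prod.swap prod.swap]) (auto simp: edge_pairs_def)
  then show ?thesis by (simp add: sum_edge_pairs_rows[where f = "\<lambda>j i. f i j"])
qed

lemma card_edge_pairs: "card (edge_pairs n) = num_pairs n"
proof -
  have "real (card (edge_pairs n)) = (\<Sum>(i, j)\<in>edge_pairs n. 1)" by simp
  also have "\<dots> = real (num_pairs n)"
    unfolding sum_edge_pairs_rows by (cases n) (auto simp: num_pairs_def algebra_simps)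
  finally show ?thesis by simp
qed

lemma num_pairs_pos: "2 \<le> n \<Longrightarrow> 0 < num_pairs n"
  by (simp add: num_pairs_def)

lemma real_num_pairs: "1 \<le> n \<Longrightarrow> real (num_pairs n) = real n * (real n - 1)"
  by (simp add: num_pairs_def of_nat_diff)

lemma edge_pairs_nonempty: "2 \<le> n \<Longrightarrow> edge_pairs n \<noteq> {}"
  using card_edge_pairs[of n] num_pairs_pos[of n] by auto

lemma pair_avg_add: "pair_avg n (\<lambda>i j. f i j + g i j) = pair_avg n f + pair_avg n g"
  by (simp add: pair_avg_def sum.distrib add_divide_distrib split_def)

lemma pair_avg_diff: "pair_avg n (\<lambda>i j. f i j - g i j) = pair_avg n f - pair_avg n g"
  by (simp add: pair_avg_def sum_subtractf diff_divide_distrib split_def)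

lemma pair_avg_cmult: "pair_avg n (\<lambda>i j. k * f i j) = k * pair_avg n f"
  by (simp add: pair_avg_def sum_distrib_left split_def)

lemma pair_avg_sum: "pair_avg n (\<lambda>i j. \<Sum>k\<in>K. f k i j) = (\<Sum>k\<in>K. pair_avg n (f k))"
  unfolding pair_avg_def split_def by (subst sum.swap) (simp add: sum_divide_distrib)

lemma pair_avg_const: "2 \<le> n \<Longrightarrow> pair_avg n (\<lambda>i j. k) = k"
  using num_pairs_pos[of n] by (simp add: pair_avg_def card_edge_pairs)

lemma pair_avg_mono:
  "(\<And>i j. (i, j) \<in> edge_pairs n \<Longrightarrow> f i j \<le> g i j) \<Longrightarrow> pair_avg n f \<le> pair_avg n g"
  unfolding pair_avg_def by (intro divide_right_mono sum_mono) auto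

lemma pair_avg_cong:
  "(\<And>i j. (i, j) \<in> edge_pairs n \<Longrightarrow> f i j = g i j) \<Longrightarrow> pair_avg n f = pair_avg n g"
  by (rule antisym; rule pair_avg_mono) auto

lemma pair_avg_nonneg:
  "(\<And>i j. (i, j) \<in> edge_pairs n \<Longrightarrow> 0 \<le> f i j) \<Longrightarrow> 0 \<le> pair_avg n f"
  unfolding pair_avg_def by (intro divide_nonneg_nonneg sum_nonneg) auto

section \<open>The weighted l1 norm of an increment and its dual\<close>

definition node_l1 :: "nat \<Rightarrow> (nat \<Rightarrow> real) \<Rightarrow> (nat \<Rightarrow> real) \<Rightarrow> real" where
  "node_l1 n a b = (\<Sum>i=1..n. \<bar>a i\<bar>) + (\<Sum>j=1..n. \<bar>b j\<bar>)"

definition vec_l1 :: "real ^ 'p \<Rightarrow> real" where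
  "vec_l1 g = (\<Sum>k\<in>UNIV. \<bar>g $ k\<bar>)"

text \<open>The arguments are increments of alpha, beta, mu and gamma. A node parameter enters n - 1
  of the n (n - 1) pairs, the intercept all of them, so their design columns differ in Euclidean
  length by the factor sqrt n; the division evens this out.\<close>

definition increment_norm ::
  "nat \<Rightarrow> (nat \<Rightarrow> real) \<Rightarrow> (nat \<Rightarrow> real) \<Rightarrow> real \<Rightarrow> real ^ 'p \<Rightarrow> real" where
  "increment_norm n a b m g = node_l1 n a b / sqrt (real n) + \<bar>m\<bar> + vec_l1 g"

lemma node_l1_nonneg: "0 \<le> node_l1 n a b"
  by (simp add: node_l1_def sum_nonneg)

lemma vec_l1_nonneg: "0 \<le> vec_l1 g"
  by (simp add: vec_l1_def sum_nonneg)

lemma increment_norm_nonneg: "0 \<le> increment_norm n a b m g"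
  by (simp add: increment_norm_def node_l1_nonneg vec_l1_nonneg)

lemma abs_inner_le_vec_l1:
  assumes "\<And>k. \<bar>z $ k\<bar> \<le> c"
  shows "\<bar>g \<bullet> z\<bar> \<le> c * vec_l1 (g :: real ^ 'p)"
proof -
  have "\<bar>g \<bullet> z\<bar> \<le> (\<Sum>k\<in>UNIV. \<bar>g $ k * z $ k\<bar>)"
    unfolding inner_vec_def by (simp add: sum_abs)
  also have "\<dots> \<le> (\<Sum>k\<in>UNIV. \<bar>g $ k\<bar> * c)"
    using assms by (intro sum_mono) (auto simp: abs_mult intro!: mult_left_mono)
  also have "\<dots> = c * vec_l1 g"
    by (simp add: vec_l1_def sum_distrib_left mult.commute)
  finally show ?thesis .
qed

lemma abs_nodes_le_node_l1:
  assumes "i \<in> {1..n}" "j \<in> {1..n}"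
  shows "\<bar>a i\<bar> + \<bar>b j\<bar> \<le> node_l1 n a b"
  unfolding node_l1_def using assms
  by (intro add_mono member_le_sum[of _ "{1..n}" "\<lambda>i. \<bar>_ i\<bar>"]) auto

lemma vec_l1_square_le: "(vec_l1 (g :: real ^ 'p))\<^sup>2 \<le> real CARD('p) * (norm g)\<^sup>2"
proof -
  have "(vec_l1 g)\<^sup>2 \<le> real CARD('p) * (\<Sum>k\<in>UNIV. (\<bar>g $ k\<bar>)\<^sup>2)"
    unfolding vec_l1_def using sum_squared_le_sum_of_squares[of "\<lambda>k. \<bar>g $ k\<bar>" UNIV]
    by (simp add: mult.commute)
  also have "(\<Sum>k\<in>UNIV. (\<bar>g $ k\<bar>)\<^sup>2) = (norm g)\<^sup>2"
    unfolding norm_vec_def L2_set_def by (simp add: sum_nonneg)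
  finally show ?thesis .
qed

(* The thresholds are the dual norm of increment_norm: an average of X against an increment
   is at most u times its norm. *)
definition balanced :: "nat \<Rightarrow> real \<Rightarrow> (nat \<Rightarrow> nat \<Rightarrow> real) \<Rightarrow> bool" where
  "balanced n u X \<longleftrightarrow>
     (\<forall>i\<in>{1..n}. \<bar>\<Sum>j\<in>{1..n} - {i}. X i j\<bar> \<le> u * real (num_pairs n) / sqrt (real n)) \<and>
     (\<forall>j\<in>{1..n}. \<bar>\<Sum>i\<in>{1..n} - {j}. X i j\<bar> \<le> u * real (num_pairs n) / sqrt (real n)) \<and>
     \<bar>\<Sum>(i, j)\<in>edge_pairs n. X i j\<bar> \<le> u * real (num_pairs n)"

lemma balanced_total: "2 \<le> n \<Longrightarrow> balanced n u X \<Longrightarrow> \<bar>pair_avg n X\<bar> \<le> u"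
  using num_pairs_pos[of n] by (simp add: balanced_def pair_avg_def abs_divide pos_divide_le_eq)

text \<open>Summing by rows for a and by columns for b turns the average into a pairing with the
  row, column and total sums of X; the duality of l1 and sup norm applies to each block.\<close>

lemma balanced_pair_avg:
  assumes n: "2 \<le> n" and bal: "balanced n u X"
  shows "\<bar>pair_avg n (\<lambda>i j. X i j * (a i + b j + m))\<bar>
    \<le> u * (node_l1 n a b / sqrt (real n) + \<bar>m\<bar>)"
proof -
  define T where "T = u * real (num_pairs n) / sqrt (real n)"
  define R where "R i = (\<Sum>j\<in>{1..n} - {i}. X i j)" for i
  define C where "C j = (\<Sum>i\<in>{1..n} - {j}. X i j)" for j
  define S where "S = (\<Sum>(i, j)\<in>edge_pairs n. X i j)"
  note N = num_pairs_pos[OF n]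
  have R: "\<bar>R i\<bar> \<le> T" if "i \<in> {1..n}" for i
    using bal that unfolding balanced_def R_def T_def by blast
  have C: "\<bar>C j\<bar> \<le> T" if "j \<in> {1..n}" for j
    using bal that unfolding balanced_def C_def T_def by blast
  have S: "\<bar>S\<bar> \<le> u * real (num_pairs n)"
    using bal unfolding balanced_def S_def by blast
  have "(\<Sum>(i, j)\<in>edge_pairs n. X i j * (a i + b j + m))
      = (\<Sum>(i, j)\<in>edge_pairs n. a i * X i j) + (\<Sum>(i, j)\<in>edge_pairs n. b j * X i j) + m * S"
    by (simp add: S_def split_def algebra_simps sum.distrib sum_distrib_left)
  also have "(\<Sum>(i, j)\<in>edge_pairs n. a i * X i j) = (\<Sum>i=1..n. a i * R i)"
    by (simp add: sum_edge_pairs_rows R_def sum_distrib_left)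
  also have "(\<Sum>(i, j)\<in>edge_pairs n. b j * X i j) = (\<Sum>j=1..n. b j * C j)"
    by (simp add: sum_edge_pairs_cols C_def sum_distrib_left)
  finally have eq: "(\<Sum>(i, j)\<in>edge_pairs n. X i j * (a i + b j + m))
      = (\<Sum>i=1..n. a i * R i) + (\<Sum>j=1..n. b j * C j) + m * S" .
  have A: "\<bar>\<Sum>i=1..n. a i * R i\<bar> \<le> (\<Sum>i=1..n. \<bar>a i\<bar>) * T"
  proof -
    have "\<bar>\<Sum>i=1..n. a i * R i\<bar> \<le> (\<Sum>i=1..n. \<bar>a i * R i\<bar>)" by (rule sum_abs)
    also have "\<dots> \<le> (\<Sum>i=1..n. \<bar>a i\<bar> * T)"
      using R by (intro sum_mono) (auto simp: abs_mult intro!: mult_left_mono)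
    finally show ?thesis by (simp add: sum_distrib_right)
  qed
  have B: "\<bar>\<Sum>j=1..n. b j * C j\<bar> \<le> (\<Sum>j=1..n. \<bar>b j\<bar>) * T"
  proof -
    have "\<bar>\<Sum>j=1..n. b j * C j\<bar> \<le> (\<Sum>j=1..n. \<bar>b j * C j\<bar>)" by (rule sum_abs)
    also have "\<dots> \<le> (\<Sum>j=1..n. \<bar>b j\<bar> * T)"
      using C by (intro sum_mono) (auto simp: abs_mult intro!: mult_left_mono)
    finally show ?thesis by (simp add: sum_distrib_right)
  qed
  have "\<bar>m * S\<bar> \<le> \<bar>m\<bar> * (u * real (num_pairs n))"
    using S by (auto simp: abs_mult intro!: mult_left_mono)
  then have "\<bar>\<Sum>(i, j)\<in>edge_pairs n. X i j * (a i + b j + m)\<bar>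
      \<le> node_l1 n a b * T + \<bar>m\<bar> * (u * real (num_pairs n))"
    unfolding eq node_l1_def using A B by (simp add: distrib_right)
  also have "\<dots> = real (num_pairs n) * (u * (node_l1 n a b / sqrt (real n) + \<bar>m\<bar>))"
    by (simp add: T_def algebra_simps)
  finally show ?thesis
    using N by (simp add: pair_avg_def abs_divide pos_divide_le_eq mult.commute)
qed

text \<open>Each coordinate of g multiplies all pairs at once, so of the products of X with a
  covariate coordinate only the total sum enters.\<close>

lemma balanced_score:
  assumes n: "2 \<le> n" and bal: "balanced n u X" "\<And>k. balanced n u (\<lambda>i j. X i j * z i j $ k)"
  shows "\<bar>pair_avg n (\<lambda>i j. X i j * (a i + b j + m + g \<bullet> z i j))\<bar> \<le> u * increment_norm n a b m g"
proof -
  have "pair_avg n (\<lambda>i j. X i j * (a i + b j + m + g \<bullet> z i j))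
      = pair_avg n (\<lambda>i j. X i j * (a i + b j + m)) + (\<Sum>k\<in>UNIV. g $ k * pair_avg n (\<lambda>i j. X i j * z i j $ k))"
    by (simp add: distrib_left pair_avg_add inner_vec_def sum_distrib_left pair_avg_sum mult.left_commute
        pair_avg_cmult)
  moreover have "\<bar>\<Sum>k\<in>UNIV. g $ k * pair_avg n (\<lambda>i j. X i j * z i j $ k)\<bar> \<le> (\<Sum>k\<in>UNIV. \<bar>g $ k\<bar> * u)"
    by (rule order_trans[OF sum_abs])
      (use balanced_total[OF n bal(2)] in \<open>auto simp: abs_mult intro!: sum_mono mult_left_mono\<close>)
  moreover have "(\<Sum>k\<in>UNIV. \<bar>g $ k\<bar> * u) = u * vec_l1 g"
    by (simp add: vec_l1_def sum_distrib_left mult.commute)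
  ultimately show ?thesis
    using balanced_pair_avg[OF n bal(1), of a b m]
    by (simp add: increment_norm_def distrib_left)
qed

section \<open>Second moments of the covariates\<close>

definition quad_form :: "('p \<Rightarrow> 'p \<Rightarrow> real) \<Rightarrow> real ^ 'p \<Rightarrow> real" where
  "quad_form S g = (\<Sum>k\<in>UNIV. \<Sum>l\<in>UNIV. g $ k * g $ l * S k l)"

lemma inner_square_quad_form: "(g \<bullet> z)\<^sup>2 = quad_form (\<lambda>k l. z $ k * z $ l) g"
  by (simp add: quad_form_def inner_vec_def power2_eq_square sum_product mult_ac)

lemma pair_avg_quad_form:
  "pair_avg n (\<lambda>i j. w i j * quad_form (S i j) g)
    = quad_form (\<lambda>k l. pair_avg n (\<lambda>i j. w i j * S i j k l)) g"
proof -
  have "pair_avg n (\<lambda>i j. w i j * quad_form (S i j) g)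
    = pair_avg n (\<lambda>i j. \<Sum>k\<in>UNIV. \<Sum>l\<in>UNIV. (g $ k * g $ l) * (w i j * S i j k l))"
    by (simp add: quad_form_def sum_distrib_left mult_ac)
  then show ?thesis by (simp add: pair_avg_sum pair_avg_cmult quad_form_def)
qed

lemma abs_quad_form_le:
  assumes "\<And>k l. \<bar>S k l\<bar> \<le> u"
  shows "\<bar>quad_form S g\<bar> \<le> u * (vec_l1 g)\<^sup>2"
proof -
  have "\<bar>quad_form S g\<bar> \<le> (\<Sum>k\<in>UNIV. \<Sum>l\<in>UNIV. \<bar>g $ k * g $ l * S k l\<bar>)"
    unfolding quad_form_def by (rule order_trans[OF sum_abs]) (intro sum_mono sum_abs)
  also have "\<dots> \<le> (\<Sum>k\<in>UNIV. \<Sum>l\<in>UNIV. \<bar>g $ k\<bar> * \<bar>g $ l\<bar> * u)"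
    using assms by (intro sum_mono) (auto simp: abs_mult intro!: mult_left_mono)
  also have "\<dots> = u * (vec_l1 g)\<^sup>2"
    by (simp add: vec_l1_def power2_eq_square sum_product sum_distrib_left mult_ac)
  finally show ?thesis .
qed

lemma quad_form_diff: "quad_form S g - quad_form T g = quad_form (\<lambda>k l. S k l - T k l) g"
  by (simp add: quad_form_def sum_subtractf algebra_simps)

(* S i j is the matrix of second moments of the covariate of which z i j is a realisation. *)
lemma weighted_gram_deviation:
  fixes g :: "real ^ 'p"
  assumes n: "2 \<le> n" and u: "0 \<le> u" and c: "1 \<le> c"
    and bal1: "\<And>k. balanced n u (\<lambda>i j. w i j * z i j $ k)"
    and bal2: "\<And>k l. balanced n (2 * c * u) (\<lambda>i j. w i j * (z i j $ k * z i j $ l - S i j k l))"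
  shows "\<bar>pair_avg n (\<lambda>i j. w i j * (a i + b j + m + g \<bullet> z i j)\<^sup>2)
      - pair_avg n (\<lambda>i j. w i j * ((a i + b j + m)\<^sup>2 + quad_form (S i j) g))\<bar>
    \<le> 2 * c * u * (increment_norm n a b m g)\<^sup>2"
proof -
  define Y where "Y = node_l1 n a b / sqrt (real n) + \<bar>m\<bar>"
  define G where "G = vec_l1 g"
  have YG: "0 \<le> Y" "0 \<le> G"
    by (simp_all add: Y_def G_def node_l1_nonneg vec_l1_nonneg)
  \<comment> \<open>Expanding the square, the deviation from the mean consists of a cross term
    linear in the covariates, \<open>D1\<close> (up to the factor 2), and of their centred second
    moments, \<open>D2\<close>.\<close>
  define D1 where "D1 = (\<Sum>k\<in>UNIV. g $ k * pair_avg n (\<lambda>i j. (w i j * z i j $ k) * (a i + b j + m)))"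
  define D2 where "D2 = quad_form (\<lambda>k l. pair_avg n (\<lambda>i j. w i j * (z i j $ k * z i j $ l - S i j k l))) g"
  have "pair_avg n (\<lambda>i j. w i j * (a i + b j + m + g \<bullet> z i j)\<^sup>2)
      - pair_avg n (\<lambda>i j. w i j * ((a i + b j + m)\<^sup>2 + quad_form (S i j) g))
      = pair_avg n (\<lambda>i j. 2 * (\<Sum>k\<in>UNIV. g $ k * ((w i j * z i j $ k) * (a i + b j + m)))
           + w i j * ((g \<bullet> z i j)\<^sup>2 - quad_form (S i j) g))"
    unfolding pair_avg_diff[symmetric]
  proof (rule pair_avg_cong)
    fix i j
    have "(\<Sum>k\<in>UNIV. g $ k * ((w i j * z i j $ k) * (a i + b j + m)))
        = w i j * (g \<bullet> z i j) * (a i + b j + m)"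
      by (simp add: inner_vec_def sum_distrib_left sum_distrib_right mult_ac)
    then show "w i j * (a i + b j + m + g \<bullet> z i j)\<^sup>2 - w i j * ((a i + b j + m)\<^sup>2 + quad_form (S i j) g)
      = 2 * (\<Sum>k\<in>UNIV. g $ k * ((w i j * z i j $ k) * (a i + b j + m)))
           + w i j * ((g \<bullet> z i j)\<^sup>2 - quad_form (S i j) g)"
      by (simp only:) (simp add: power2_eq_square algebra_simps)
  qed
  also have "\<dots> = 2 * D1 + D2"
    by (simp only: pair_avg_add pair_avg_cmult pair_avg_sum D1_def D2_def inner_square_quad_form
        quad_form_diff pair_avg_quad_form)
  finally have eq: "pair_avg n (\<lambda>i j. w i j * (a i + b j + m + g \<bullet> z i j)\<^sup>2)
      - pair_avg n (\<lambda>i j. w i j * ((a i + b j + m)\<^sup>2 + quad_form (S i j) g)) = 2 * D1 + D2" .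
  have "\<bar>D1\<bar> \<le> (\<Sum>k\<in>UNIV. \<bar>g $ k\<bar> * (u * Y))"
    unfolding D1_def
    by (rule order_trans[OF sum_abs])
      (use balanced_pair_avg[OF n bal1] in \<open>auto simp: abs_mult Y_def intro!: sum_mono mult_left_mono\<close>)
  also have "\<dots> = u * (G * Y)"
    by (simp add: G_def vec_l1_def sum_distrib_right sum_distrib_left mult_ac)
  finally have D1: "\<bar>D1\<bar> \<le> u * (G * Y)" .
  have D2: "\<bar>D2\<bar> \<le> 2 * c * u * G\<^sup>2"
    unfolding D2_def G_def by (intro abs_quad_form_le balanced_total[OF n bal2])
  have "u * (G * Y) \<le> c * (u * (G * Y))"
    using c u YG by (intro mult_right_mono[of 1 c, simplified]) auto
  then have "2 * (u * (G * Y)) + 2 * c * u * G\<^sup>2 \<le> 2 * c * u * (G * Y + G\<^sup>2)"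
    by (simp add: algebra_simps)
  also have "\<dots> \<le> 2 * c * u * (Y + G)\<^sup>2"
    using c u YG by (intro mult_left_mono) (auto simp: power2_eq_square algebra_simps)
  also have "Y + G = increment_norm n a b m g"
    by (simp add: Y_def G_def increment_norm_def)
  finally show ?thesis unfolding eq using D1 D2 by linarith
qed

lemma pair_avg_abs_nodes:
  assumes n: "2 \<le> n"
  shows "pair_avg n (\<lambda>i j. \<bar>a i + b j\<bar>) \<le> node_l1 n a b / real n"
proof -
  have "pair_avg n (\<lambda>i j. \<bar>a i + b j\<bar>) \<le> pair_avg n (\<lambda>i j. \<bar>a i\<bar> + \<bar>b j\<bar>)"
    by (intro pair_avg_mono) auto
  also have "\<dots> = ((\<Sum>(i, j)\<in>edge_pairs n. \<bar>a i\<bar>) + (\<Sum>(i, j)\<in>edge_pairs n. \<bar>b j\<bar>)) / real (num_pairs n)"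
    by (simp add: pair_avg_def split_def sum.distrib)
  also have "\<dots> = (real n - 1) * node_l1 n a b / real (num_pairs n)"
    using n unfolding sum_edge_pairs_rows[where f = "\<lambda>i j. \<bar>a i\<bar>"] sum_edge_pairs_cols[where f = "\<lambda>i j. \<bar>b j\<bar>"]
    by (simp add: node_l1_def of_nat_diff sum_distrib_left distrib_left)
  also have "\<dots> = node_l1 n a b / real n"
    using n by (simp add: real_num_pairs)
  finally show ?thesis .
qed

text \<open>Node and intercept columns of the design are almost orthogonal: a product of one a-entry
  and one b-entry occurs in at most one pair, and m meets each node in n - 1 pairs. In the rescaled
  norm these cross terms are smaller than the square of the norm by a factor sqrt n.\<close>

lemma pair_avg_square_nodes:
  assumes n: "2 \<le> n"
  shows "((\<Sum>i=1..n. (a i)\<^sup>2) + (\<Sum>j=1..n. (b j)\<^sup>2)) / real n + m\<^sup>2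
      - (node_l1 n a b / sqrt (real n) + \<bar>m\<bar>)\<^sup>2 / sqrt (real n)
    \<le> pair_avg n (\<lambda>i j. (a i + b j + m)\<^sup>2)"
proof -
  define l where "l = node_l1 n a b"
  define N where "N = real (num_pairs n)"
  define x where "x = l / sqrt (real n)"
  define P where "P = (\<Sum>(i, j)\<in>edge_pairs n. a i * b j)"
  have N: "0 < N" "N = real n * (real n - 1)"
    using num_pairs_pos[OF n] real_num_pairs[of n] n by (auto simp: N_def)
  have l: "0 \<le> l" "0 \<le> x" by (simp_all add: l_def x_def node_l1_nonneg)
  have rows: "(\<Sum>(i, j)\<in>edge_pairs n. f i) = (real n - 1) * (\<Sum>i=1..n. f i)" for f :: "nat \<Rightarrow> real"
    using n by (simp add: sum_edge_pairs_rows of_nat_diff sum_distrib_left)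
  have cols: "(\<Sum>(i, j)\<in>edge_pairs n. f j) = (real n - 1) * (\<Sum>i=1..n. f i)" for f :: "nat \<Rightarrow> real"
    using n by (simp add: sum_edge_pairs_cols of_nat_diff sum_distrib_left)
  have "(\<Sum>(i, j)\<in>edge_pairs n. (a i + b j + m)\<^sup>2)
    = (\<Sum>(i, j)\<in>edge_pairs n. (a i)\<^sup>2) + (\<Sum>(i, j)\<in>edge_pairs n. (b j)\<^sup>2) + (\<Sum>(i, j)\<in>edge_pairs n. m\<^sup>2)
     + 2 * P + 2 * m * (\<Sum>(i, j)\<in>edge_pairs n. a i) + 2 * m * (\<Sum>(i, j)\<in>edge_pairs n. b j)"
    by (simp add: P_def split_def power2_eq_square algebra_simps sum.distrib sum_distrib_left
        del: sum_constant)
  also have "\<dots> = (real n - 1) * ((\<Sum>i=1..n. (a i)\<^sup>2) + (\<Sum>j=1..n. (b j)\<^sup>2)) + N * m\<^sup>2 + 2 * P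
      + 2 * m * (real n - 1) * ((\<Sum>i=1..n. a i) + (\<Sum>j=1..n. b j))"
    unfolding rows cols by (simp add: N_def card_edge_pairs[unfolded split_def] split_def)
      (use n in \<open>simp add: real_num_pairs algebra_simps\<close>)
  finally have eq: "pair_avg n (\<lambda>i j. (a i + b j + m)\<^sup>2)
    = ((\<Sum>i=1..n. (a i)\<^sup>2) + (\<Sum>j=1..n. (b j)\<^sup>2)) / real n + m\<^sup>2
      + (2 * P / N + 2 * m * ((\<Sum>i=1..n. a i) + (\<Sum>j=1..n. b j)) / real n)"
    using n unfolding pair_avg_def N_def[symmetric] by (simp add: N(2) add_divide_distrib)
  have "\<bar>P\<bar> \<le> (\<Sum>(i, j)\<in>edge_pairs n. \<bar>a i\<bar> * \<bar>b j\<bar>)"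
    unfolding P_def split_def abs_mult[symmetric] by (rule sum_abs)
  also have "\<dots> \<le> (\<Sum>(i, j)\<in>{1..n} \<times> {1..n}. \<bar>a i\<bar> * \<bar>b j\<bar>)"
    by (intro sum_mono2) (auto simp: edge_pairs_def)
  also have "\<dots> = (\<Sum>i=1..n. \<bar>a i\<bar>) * (\<Sum>j=1..n. \<bar>b j\<bar>)"
    by (simp add: sum_product sum.cartesian_product)
  also have "\<dots> \<le> l\<^sup>2 / 4"
    using sum_squares_ge_zero[of "(\<Sum>i=1..n. \<bar>a i\<bar>) - (\<Sum>j=1..n. \<bar>b j\<bar>)" 0]
    by (simp add: l_def node_l1_def power2_eq_square algebra_simps)
  finally have P: "\<bar>P\<bar> \<le> l\<^sup>2 / 4" .
  have s: "sqrt (real n) \<le> real n" "sqrt (real n) * sqrt (real n) = real n"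
    using n by (auto intro: real_le_lsqrt simp: power2_eq_square)
  have "\<bar>2 * P / N\<bar> = \<bar>2 * P\<bar> / N" using N(1) by (simp add: abs_divide)
  also have "\<dots> \<le> (l\<^sup>2 / 2) / N"
    using P N(1) by (intro divide_right_mono) (auto simp: abs_mult)
  also have "\<dots> = (l\<^sup>2 / real n) / (2 * (real n - 1))"
    using n by (simp add: N(2))
  \<comment> \<open>For n \<ge> 2 one has sqrt n \<le> n \<le> 2 (n - 1).\<close>
  also have "\<dots> \<le> (l\<^sup>2 / real n) / sqrt (real n)"
    using n s by (intro divide_left_mono) auto
  also have "l\<^sup>2 / real n = x\<^sup>2" by (simp add: x_def power_divide)
  finally have p1: "\<bar>2 * P / N\<bar> \<le> x\<^sup>2 / sqrt (real n)" .
  have "\<bar>(\<Sum>i=1..n. a i) + (\<Sum>j=1..n. b j)\<bar> \<le> l"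
    unfolding l_def node_l1_def
    by (rule order_trans[OF abs_triangle_ineq add_mono[OF sum_abs sum_abs]])
  then have "\<bar>2 * m * ((\<Sum>i=1..n. a i) + (\<Sum>j=1..n. b j)) / real n\<bar> \<le> 2 * \<bar>m\<bar> * l / real n"
    by (simp add: abs_divide abs_mult divide_right_mono mult_left_mono)
  also have "\<dots> = 2 * \<bar>m\<bar> * x / sqrt (real n)"
    using s(2) by (simp add: x_def)
  finally have p2: "\<bar>2 * m * ((\<Sum>i=1..n. a i) + (\<Sum>j=1..n. b j)) / real n\<bar> \<le> 2 * \<bar>m\<bar> * x / sqrt (real n)" .
  have combine: "A - v \<le> A + (q1 + q2)" if "s1 + s2 \<le> v" "\<bar>q1\<bar> \<le> s1" "\<bar>q2\<bar> \<le> s2"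
    for A v q1 q2 s1 s2 :: real
    using that by linarith
  have "x\<^sup>2 / sqrt (real n) + 2 * \<bar>m\<bar> * x / sqrt (real n) \<le> (x + \<bar>m\<bar>)\<^sup>2 / sqrt (real n)"
    unfolding add_divide_distrib[symmetric]
    by (intro divide_right_mono) (auto simp: power2_eq_square algebra_simps)
  then show ?thesis unfolding eq x_def[unfolded l_def, symmetric] using p1 p2 by (rule combine)
qed

section \<open>The sparse regime for realised covariates\<close>

text \<open>Cauchy-Schwarz for two blocks: the constants s and t add up. Repeated use assembles the
  supports of alpha and beta, the intercept and the covariate coefficients.\<close>

lemma cauchy_schwarz_add:
  fixes x y s t X Y :: real
  assumes "x\<^sup>2 \<le> s * X" "y\<^sup>2 \<le> t * Y" "0 \<le> s" "0 \<le> t" "0 \<le> X" "0 \<le> Y"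
  shows "(x + y)\<^sup>2 \<le> (s + t) * (X + Y)"
proof -
  have "(2 * (x * y))\<^sup>2 = 4 * (x\<^sup>2 * y\<^sup>2)" by (simp add: power_mult_distrib)
  also have "\<dots> \<le> 4 * ((s * X) * (t * Y))"
    using assms by (intro mult_left_mono mult_mono) auto
  also have "\<dots> = 4 * ((s * Y) * (t * X))" by simp
  also have "\<dots> \<le> (s * Y + t * X)\<^sup>2"
    using zero_le_power2[of "s * Y - t * X"] by (simp add: power2_eq_square algebra_simps)
  finally have "2 * (x * y) \<le> s * Y + t * X"
    by (rule power2_le_imp_le) (use assms in auto)
  then show ?thesis using assms by (simp add: power2_eq_square algebra_simps)
qed

lemma sum_abs_square_le: "(\<Sum>i\<in>A. \<bar>f i\<bar>)\<^sup>2 \<le> real (card A) * (\<Sum>i\<in>A. (f i)\<^sup>2)"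
proof (cases "finite A")
  case True
  then show ?thesis
    using sum_squared_le_sum_of_squares[of "\<lambda>i. \<bar>f i\<bar>" A] by (simp add: mult.commute)
qed simp

lemma vec_l1_scaleR: "vec_l1 (\<tau> *\<^sub>R g) = \<bar>\<tau>\<bar> * vec_l1 g"
  by (simp add: vec_l1_def abs_mult sum_distrib_left)

lemma node_l1_scale: "node_l1 n (\<lambda>i. \<tau> * a i) (\<lambda>j. \<tau> * b j) = \<bar>\<tau>\<bar> * node_l1 n a b"
  by (simp add: node_l1_def abs_mult sum_distrib_left distrib_left)

lemma increment_norm_scale:
  "increment_norm n (\<lambda>i. \<tau> * a i) (\<lambda>j. \<tau> * b j) (\<tau> * m) (\<tau> *\<^sub>R g) = \<bar>\<tau>\<bar> * increment_norm n a b m g"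
  by (simp add: increment_norm_def vec_l1_scaleR node_l1_scale abs_mult distrib_left)

text \<open>A single node may carry the whole node part of the norm, where it is divided by sqrt n;
  hence the factor sqrt n in passing to the sup norm of the predictor.\<close>

lemma abs_predictor_le:
  fixes g :: "real ^ 'p"
  assumes n: "2 \<le> n" and c: "1 \<le> c" and z: "\<And>k. \<bar>z $ k\<bar> \<le> c" and ij: "i \<in> {1..n}" "j \<in> {1..n}"
  shows "\<bar>a i + b j + m + g \<bullet> z\<bar> \<le> c * sqrt (real n) * increment_norm n a b m g"
proof -
  have s: "1 \<le> sqrt (real n)" using n by simp
  have "\<bar>a i + b j + m + g \<bullet> z\<bar> \<le> node_l1 n a b + \<bar>m\<bar> + c * vec_l1 g"
    using abs_nodes_le_node_l1[OF ij, of a b] abs_inner_le_vec_l1[of z c g, OF z] by linarith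
  also have "\<dots> \<le> c * (node_l1 n a b) + (c * sqrt (real n)) * \<bar>m\<bar> + (c * sqrt (real n)) * vec_l1 g"
  proof (intro add_mono)
    have cs: "1 * 1 \<le> c * sqrt (real n)" "c * 1 \<le> c * sqrt (real n)"
      using c s by (intro mult_mono; simp)+
    show "node_l1 n a b \<le> c * node_l1 n a b"
      using c node_l1_nonneg[of n a b] by (simp add: mult_le_cancel_right1)
    show "\<bar>m\<bar> \<le> (c * sqrt (real n)) * \<bar>m\<bar>"
      using cs by (simp add: mult_le_cancel_right1)
    show "c * vec_l1 g \<le> (c * sqrt (real n)) * vec_l1 g"
      using cs vec_l1_nonneg[of g] by (intro mult_right_mono) auto
  qed
  also have "\<dots> = c * sqrt (real n) * increment_norm n a b m g"
    using n by (simp add: increment_norm_def distrib_left)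
  finally show ?thesis .
qed

lemma bregman_ge_square:
  assumes "\<bar>d\<bar> \<le> 1" shows "logistic_var x * d\<^sup>2 / 3 \<le> bregman x d"
proof -
  have "d\<^sup>2 / 3 \<le> d\<^sup>2 / (2 + \<bar>d\<bar>)"
    using assms by (intro divide_left_mono) auto
  also have "\<dots> \<le> exp_gap d" by (rule exp_gap_lower)
  finally have "logistic_var x * (d\<^sup>2 / 3) \<le> logistic_var x * exp_gap d"
    using logistic_var_pos[of x] by (intro mult_left_mono) auto
  then show ?thesis using bregman_lower[of x d] by simp
qed

text \<open>The deterministic half of the argument, for one realisation z with second moments S,
  true predictors x0 and curvature weights w. Concentration appears only as the two balancedness
  assumptions; u is the noise level, lb the rescaled penalty, and exp K the factor by which w and
  the true curvature may differ.\<close>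

locale covariate_realization =
  fixes n :: nat and z :: "nat \<Rightarrow> nat \<Rightarrow> real ^ ('p :: finite)" and S :: "nat \<Rightarrow> nat \<Rightarrow> 'p \<Rightarrow> 'p \<Rightarrow> real"
    and x0 w :: "nat \<Rightarrow> nat \<Rightarrow> real" and c u lb cmin K :: real
  assumes n: "2 \<le> n" and c: "1 \<le> c" and u: "0 \<le> u" "u \<le> lb / 32" and lb: "0 < lb"
    and cmin: "0 < cmin" "cmin \<le> 1"
    and z_bound: "\<And>i j k. (i, j) \<in> edge_pairs n \<Longrightarrow> \<bar>z i j $ k\<bar> \<le> c"
    and balanced_z: "\<And>k. balanced n u (\<lambda>i j. w i j * z i j $ k)"
    and balanced_gram: "\<And>k l. balanced n (2 * c * u) (\<lambda>i j. w i j * (z i j $ k * z i j $ l - S i j k l))"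
    and gram_ge: "\<And>g. cmin * (norm g)\<^sup>2 \<le> pair_avg n (\<lambda>i j. quad_form (S i j) g)"
    and moment_nonneg: "\<And>i j g. (i, j) \<in> edge_pairs n \<Longrightarrow> 0 \<le> quad_form (S i j) g"
begin

definition risk :: "(nat \<Rightarrow> real) \<Rightarrow> (nat \<Rightarrow> real) \<Rightarrow> real \<Rightarrow> real ^ 'p \<Rightarrow> real" where
  "risk a b m g = pair_avg n (\<lambda>i j. bregman (x0 i j) (a i + b j + m + g \<bullet> z i j))"

lemma risk_nonneg: "0 \<le> risk a b m g"
  unfolding risk_def by (intro pair_avg_nonneg bregman_nonneg)

lemma risk_scale:
  assumes "0 \<le> \<tau>" "\<tau> \<le> 1"
  shows "risk (\<lambda>i. \<tau> * a i) (\<lambda>j. \<tau> * b j) (\<tau> * m) (\<tau> *\<^sub>R g) \<le> \<tau> * risk a b m g"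
proof -
  have "bregman (x0 i j) (\<tau> * a i + \<tau> * b j + \<tau> * m + (\<tau> *\<^sub>R g) \<bullet> z i j)
      \<le> \<tau> * bregman (x0 i j) (a i + b j + m + g \<bullet> z i j)" for i j
    using bregman_scale[OF assms, of "x0 i j" "a i + b j + m + g \<bullet> z i j"]
    by (simp add: distrib_left)
  then show ?thesis
    unfolding risk_def pair_avg_cmult[symmetric] by (intro pair_avg_mono)
qed

text \<open>In the local region all increments are at most 1, where a divergence dominates a third
  of curvature times square. The factor exp (- K) trades the actual curvature for the deterministic
  weight.\<close>

lemma weighted_square_le_risk:
  assumes loc: "c * sqrt (real n) * increment_norm n a b m g \<le> 1"
    and w: "\<And>i j. (i, j) \<in> edge_pairs n \<Longrightarrow> exp (- K) * w i j \<le> logistic_var (x0 i j)"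
  shows "exp (- K) * pair_avg n (\<lambda>i j. w i j * (a i + b j + m + g \<bullet> z i j)\<^sup>2) / 3 \<le> risk a b m g"
proof -
  have "exp (- K) / 3 * pair_avg n (\<lambda>i j. w i j * (a i + b j + m + g \<bullet> z i j)\<^sup>2)
      = pair_avg n (\<lambda>i j. exp (- K) / 3 * (w i j * (a i + b j + m + g \<bullet> z i j)\<^sup>2))"
    by (simp only: pair_avg_cmult)
  also have "\<dots> \<le> risk a b m g"
    unfolding risk_def
  proof (rule pair_avg_mono)
    fix i j assume ij: "(i, j) \<in> edge_pairs n"
    define d where "d = a i + b j + m + g \<bullet> z i j"
    have "\<bar>d\<bar> \<le> c * sqrt (real n) * increment_norm n a b m g"
      unfolding d_def using ij z_bound[OF ij]
      by (intro abs_predictor_le n c) (auto simp: edge_pairs_def)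
    then have "\<bar>d\<bar> \<le> 1" using loc by linarith
    then have "logistic_var (x0 i j) * d\<^sup>2 / 3 \<le> bregman (x0 i j) d" by (rule bregman_ge_square)
    moreover have "exp (- K) * w i j * d\<^sup>2 \<le> logistic_var (x0 i j) * d\<^sup>2"
      using w[OF ij] by (intro mult_right_mono) auto
    ultimately show "exp (- K) / 3 * (w i j * (a i + b j + m + g \<bullet> z i j)\<^sup>2)
        \<le> bregman (x0 i j) (a i + b j + m + g \<bullet> z i j)"
      by (simp add: d_def)
  qed
  finally show ?thesis by simp
qed

text \<open>The lasso argument with mu and gamma treated as part of the support, which explains p +
  1 in s. The score is absorbed by u \<le> lb / 32, the remainder lies in a cone, and on the cone
  the weighted square controls the l1 norm restricted to the support.\<close>

lemma sparse_rate_local: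
  fixes s :: real
  assumes sets: "SA \<subseteq> {1..n}" "SB \<subseteq> {1..n}"
    and s: "s = real (card SA) + real (card SB) + real CARD('p) + 1"
    and L: "L = ((\<Sum>i\<in>SA. \<bar>a i\<bar>) + (\<Sum>j\<in>SB. \<bar>b j\<bar>)) / sqrt (real n)"
    and basic: "risk a b m g \<le> u * increment_norm n a b m g
        + lb * (L - (node_l1 n a b / sqrt (real n) - L))"
    and w: "\<And>i j. (i, j) \<in> edge_pairs n \<Longrightarrow> exp (- K) * w i j \<le> logistic_var (x0 i j)"
      "\<And>i j. (i, j) \<in> edge_pairs n \<Longrightarrow> exp (- K) * \<rho> / 2 \<le> w i j"
    and \<rho>: "0 < \<rho>"
    and loc: "c * sqrt (real n) * increment_norm n a b m g \<le> 1"
    and small: "36 * s / sqrt (real n) \<le> cmin / 2" "18 * s * c * u \<le> exp (- K) * \<rho> * cmin / 8"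
    and \<kappa>: "\<kappa> = exp (- 2 * K) * cmin / 24"
  shows "increment_norm n a b m g \<le> 6 * s * lb / (\<kappa> * \<rho>)"
    and "risk a b m g \<le> 4 * s * lb\<^sup>2 / (\<kappa> * \<rho>)"
proof -
  define M where "M = increment_norm n a b m g"
  define Mn where "Mn = node_l1 n a b / sqrt (real n)"
  define M' where "M' = \<bar>m\<bar> + vec_l1 g"
  define Q where "Q = risk a b m g"
  define X where "X = ((\<Sum>i\<in>SA. (a i)\<^sup>2) + (\<Sum>j\<in>SB. (b j)\<^sup>2)) / real n"
  define V where "V = X + m\<^sup>2 + (norm g)\<^sup>2"
  have fin: "finite SA" "finite SB" using sets finite_subset by blast+
  have M_eq: "M = Mn + M'" by (simp add: M_def Mn_def M'_def increment_norm_def)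
  have s1: "1 \<le> s" using s by simp
  have nonneg: "0 \<le> L" "0 \<le> M'" "0 \<le> X" "0 \<le> V" "0 \<le> M" "0 \<le> Mn"
    by (auto simp: L M'_def X_def V_def M_def Mn_def vec_l1_nonneg node_l1_nonneg increment_norm_nonneg
        intro!: add_nonneg_nonneg divide_nonneg_nonneg sum_nonneg)
  have L_le: "L \<le> Mn"
    unfolding L Mn_def node_l1_def using sets
    by (intro divide_right_mono add_mono sum_mono2) auto
  have Q0: "0 \<le> Q" by (simp add: Q_def risk_nonneg)
  have basic': "Q \<le> u * M + lb * L - lb * (Mn - L)"
    using basic by (simp add: Q_def M_def Mn_def algebra_simps)
  have uM: "u * M \<le> lb / 32 * M" using u nonneg by (intro mult_right_mono) auto
  have "lb * (Mn - L) \<le> lb * (M / 32 + L)"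
    using basic' uM Q0 by (simp add: algebra_simps)
  then have "Mn - L \<le> M / 32 + L" using lb by simp
  \<comment> \<open>The off-support mass Mn - L is at most M / 32 + L. Adding L and M' and solving
    for M gives the cone condition.\<close>
  then have "31 * M \<le> 64 * L + 32 * M'" using M_eq by (simp add: field_simps)
  then have cone: "M \<le> 3 * (L + M')" using nonneg(1,2) by simp
  have basic2: "Q \<le> 2 * lb * (L + M')"
  proof -
    have "Q \<le> lb * (M / 32 + L)"
    proof -
      have "0 \<le> lb * (Mn - L)" using lb L_le by simp
      then have "Q \<le> lb / 32 * M + lb * L" using basic' uM by linarith
      then show ?thesis by (simp add: algebra_simps)
    qed
    also have "\<dots> \<le> lb * (2 * (L + M'))"
      using lb cone nonneg by (intro mult_left_mono) auto
    finally show ?thesis by (simp add: mult_ac)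
  qed
  \<comment> \<open>Each support node contributes one coordinate, the intercept one, the covariates
    p; in total s.\<close>
  have cs: "(L + M')\<^sup>2 \<le> s * V"
  proof -
    have "(\<Sum>i\<in>SA. \<bar>a i\<bar>)\<^sup>2 \<le> real (card SA) * (\<Sum>i\<in>SA. (a i)\<^sup>2)"
      "(\<Sum>i\<in>SB. \<bar>b i\<bar>)\<^sup>2 \<le> real (card SB) * (\<Sum>i\<in>SB. (b i)\<^sup>2)"
      by (rule sum_abs_square_le)+
    then have "((\<Sum>i\<in>SA. \<bar>a i\<bar>) + (\<Sum>j\<in>SB. \<bar>b j\<bar>))\<^sup>2
      \<le> (real (card SA) + real (card SB)) * ((\<Sum>i\<in>SA. (a i)\<^sup>2) + (\<Sum>j\<in>SB. (b j)\<^sup>2))"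
      by (rule cauchy_schwarz_add) (auto intro!: sum_nonneg)
    then have "L\<^sup>2 \<le> (real (card SA) + real (card SB)) * X"
      by (simp add: L X_def power_divide divide_right_mono)
    moreover have "\<bar>m\<bar>\<^sup>2 \<le> 1 * m\<^sup>2" by simp
    ultimately have "(L + \<bar>m\<bar>)\<^sup>2 \<le> (real (card SA) + real (card SB) + 1) * (X + m\<^sup>2)"
      by (rule cauchy_schwarz_add) (use nonneg in auto)
    then have "(L + \<bar>m\<bar> + vec_l1 g)\<^sup>2
      \<le> (real (card SA) + real (card SB) + 1 + real CARD('p)) * (X + m\<^sup>2 + (norm g)\<^sup>2)"
      using vec_l1_square_le[of g] by (rule cauchy_schwarz_add) (use nonneg in auto)
    then show ?thesis by (simp add: M'_def V_def s algebra_simps)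
  qed
  have M2: "M\<^sup>2 \<le> 9 * s * V"
  proof -
    have "M\<^sup>2 \<le> (3 * (L + M'))\<^sup>2" using cone nonneg by (intro power_mono) auto
    also have "\<dots> = 9 * (L + M')\<^sup>2" by (simp only: power_mult_distrib) simp
    finally show ?thesis using cs by linarith
  qed
  define R where "R = pair_avg n (\<lambda>i j. w i j * (a i + b j + m + g \<bullet> z i j)\<^sup>2)"
  define P where "P = pair_avg n (\<lambda>i j. w i j * ((a i + b j + m)\<^sup>2 + quad_form (S i j) g))"
  have w0: "0 \<le> w i j" if "(i, j) \<in> edge_pairs n" for i j
    using w(2)[OF that] \<rho> by (meson divide_nonneg_nonneg exp_ge_zero less_imp_le mult_nonneg_nonneg
        order_trans zero_le_numeral)
  have QR: "exp (- K) * R / 3 \<le> Q"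
    unfolding R_def Q_def by (rule weighted_square_le_risk[OF loc w(1)])
  have RP: "P - 2 * c * u * M\<^sup>2 \<le> R"
    using weighted_gram_deviation[OF n u(1) c balanced_z balanced_gram, of a b m g]
    by (simp add: R_def P_def M_def)
  have P: "exp (- K) * \<rho> / 2 * (cmin * V - M\<^sup>2 / sqrt (real n)) \<le> P"
  proof -
    have "exp (- K) * \<rho> / 2 * (pair_avg n (\<lambda>i j. (a i + b j + m)\<^sup>2) + pair_avg n (\<lambda>i j. quad_form (S i j) g))
      = pair_avg n (\<lambda>i j. exp (- K) * \<rho> / 2 * ((a i + b j + m)\<^sup>2 + quad_form (S i j) g))"
      by (simp only: pair_avg_cmult pair_avg_add)
    also have "\<dots> \<le> P"
      unfolding P_def using w(2) moment_nonneg
      by (intro pair_avg_mono mult_right_mono) auto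
    finally have 1: "exp (- K) * \<rho> / 2 * (pair_avg n (\<lambda>i j. (a i + b j + m)\<^sup>2)
        + pair_avg n (\<lambda>i j. quad_form (S i j) g)) \<le> P" .
    have X_le: "X \<le> ((\<Sum>i=1..n. (a i)\<^sup>2) + (\<Sum>j=1..n. (b j)\<^sup>2)) / real n"
      unfolding X_def using sets by (intro divide_right_mono add_mono sum_mono2) auto
    have "(Mn + \<bar>m\<bar>)\<^sup>2 / sqrt (real n) \<le> M\<^sup>2 / sqrt (real n)"
      using nonneg by (intro divide_right_mono power_mono) (auto simp: M_eq M'_def vec_l1_nonneg)
    then have "X + m\<^sup>2 - M\<^sup>2 / sqrt (real n) \<le> pair_avg n (\<lambda>i j. (a i + b j + m)\<^sup>2)"
      using pair_avg_square_nodes[OF n, of a b m] X_le by (simp add: Mn_def)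
    moreover have "cmin * (X + m\<^sup>2) \<le> X + m\<^sup>2"
      using cmin nonneg by (simp add: mult_left_le_one_le)
    ultimately have "cmin * V - M\<^sup>2 / sqrt (real n)
      \<le> pair_avg n (\<lambda>i j. (a i + b j + m)\<^sup>2) + pair_avg n (\<lambda>i j. quad_form (S i j) g)"
      using gram_ge[of g] by (simp add: V_def distrib_left)
    then have "exp (- K) * \<rho> / 2 * (cmin * V - M\<^sup>2 / sqrt (real n))
      \<le> exp (- K) * \<rho> / 2 * (pair_avg n (\<lambda>i j. (a i + b j + m)\<^sup>2) + pair_avg n (\<lambda>i j. quad_form (S i j) g))"
      using \<rho> by (intro mult_left_mono) auto
    then show ?thesis using 1 by linarith
  qed
  have "M\<^sup>2 / sqrt (real n) \<le> 9 * s * V / sqrt (real n)"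
    using M2 by (intro divide_right_mono) auto
  also have "\<dots> = (36 * s / sqrt (real n)) * V / 4" by simp
  also have "\<dots> \<le> (cmin / 2) * V / 4"
    using small(1) nonneg by (intro divide_right_mono mult_right_mono) auto
  finally have "M\<^sup>2 / sqrt (real n) \<le> cmin * V / 8" by simp
  moreover have "0 \<le> cmin * V" using cmin nonneg by simp
  ultimately have "cmin * V / 2 \<le> cmin * V - M\<^sup>2 / sqrt (real n)" by linarith
  then have "exp (- K) * \<rho> / 2 * (cmin * V / 2) \<le> exp (- K) * \<rho> / 2 * (cmin * V - M\<^sup>2 / sqrt (real n))"
    using \<rho> by (intro mult_left_mono) auto
  also note P
  also have "exp (- K) * \<rho> / 2 * (cmin * V / 2) = exp (- K) * \<rho> * cmin * V / 4" by simp
  finally have P2: "exp (- K) * \<rho> * cmin * V / 4 \<le> P" .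
  have "2 * c * u * M\<^sup>2 \<le> 2 * c * u * (9 * s * V)"
    using c u M2 by (intro mult_left_mono) auto
  also have "\<dots> = (18 * s * c * u) * V" by simp
  also have "\<dots> \<le> (exp (- K) * \<rho> * cmin / 8) * V"
    using small(2) nonneg by (intro mult_right_mono) auto
  finally have "2 * c * u * M\<^sup>2 \<le> exp (- K) * \<rho> * cmin * V / 8" by simp
  then have "exp (- K) * \<rho> * cmin * V / 8 \<le> R" using RP P2 by linarith
  then have "exp (- K) * (exp (- K) * \<rho> * cmin * V / 8) / 3 \<le> exp (- K) * R / 3"
    by (intro divide_right_mono mult_left_mono) auto
  \<comment> \<open>Origin of \<kappa>: one exp (- K) comes from the lower bound on w, the other
    from replacing the curvature by w. The 8 collects the half in that bound on w, the half lost to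
    near-orthogonality and the half lost to the Gram deviation; the 3 comes from the
    divergence.\<close>
  moreover have "exp (- K) * (exp (- K) * \<rho> * cmin * V / 8) / 3 = \<kappa> * \<rho> * V"
    by (simp add: \<kappa> field_simps flip: exp_add)
  ultimately have QV: "\<kappa> * \<rho> * V \<le> Q" using QR by linarith
  have \<kappa>0: "0 < \<kappa>" using cmin by (simp add: \<kappa>)
  \<comment> \<open>The risk is at least \<kappa> \<rho> Y^2 / s and at most 2 lb Y; cancelling one
    factor Y yields the rate.\<close>
  define Y where "Y = L + M'"
  have Y: "0 \<le> Y" using nonneg by (simp add: Y_def)
  have "\<kappa> * \<rho> * Y\<^sup>2 \<le> \<kappa> * \<rho> * (s * V)"
    using cs \<kappa>0 \<rho> by (intro mult_left_mono) (auto simp: Y_def)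
  also have "\<dots> = s * (\<kappa> * \<rho> * V)" by simp
  also have "\<dots> \<le> s * (2 * lb * Y)"
    using QV basic2 s1 by (intro mult_left_mono) (auto simp: Y_def)
  finally have "Y * (\<kappa> * \<rho> * Y) \<le> Y * (2 * s * lb)"
    by (simp add: power2_eq_square mult_ac)
  then have "\<kappa> * \<rho> * Y \<le> 2 * s * lb"
    using Y lb s1 by (cases "Y = 0") auto
  then have Y_le: "Y \<le> 2 * s * lb / (\<kappa> * \<rho>)"
    using \<kappa>0 \<rho> by (simp add: pos_le_divide_eq mult_ac)
  show "increment_norm n a b m g \<le> 6 * s * lb / (\<kappa> * \<rho>)"
    using cone Y_le by (simp add: M_def Y_def)
  have "Q \<le> 2 * lb * Y" using basic2 by (simp add: Y_def)
  also have "\<dots> \<le> 2 * lb * (2 * s * lb / (\<kappa> * \<rho>))"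
    using Y_le lb by (intro mult_left_mono) auto
  finally show "risk a b m g \<le> 4 * s * lb\<^sup>2 / (\<kappa> * \<rho>)"
    by (simp add: Q_def power2_eq_square mult_ac)
qed

(* The basic inequality is homogeneous up to convexity, so a large increment can be shrunk to
   the boundary of the local region, where sparse_rate_local contradicts its size. *)
lemma sparse_rate:
  fixes s :: real
  assumes sets: "SA \<subseteq> {1..n}" "SB \<subseteq> {1..n}"
    and s: "s = real (card SA) + real (card SB) + real CARD('p) + 1"
    and L: "L = ((\<Sum>i\<in>SA. \<bar>a i\<bar>) + (\<Sum>j\<in>SB. \<bar>b j\<bar>)) / sqrt (real n)"
    and basic: "risk a b m g \<le> u * increment_norm n a b m g
        + lb * (L - (node_l1 n a b / sqrt (real n) - L))"
    and w: "\<And>i j. (i, j) \<in> edge_pairs n \<Longrightarrow> exp (- K) * w i j \<le> logistic_var (x0 i j)"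
      "\<And>i j. (i, j) \<in> edge_pairs n \<Longrightarrow> exp (- K) * \<rho> / 2 \<le> w i j"
    and \<rho>: "0 < \<rho>"
    and small: "36 * s / sqrt (real n) \<le> cmin / 2" "18 * s * c * u \<le> exp (- K) * \<rho> * cmin / 8"
      "12 * c * sqrt (real n) * s * lb / (\<kappa> * \<rho>) \<le> 1"
    and \<kappa>: "\<kappa> = exp (- 2 * K) * cmin / 24"
  shows "increment_norm n a b m g \<le> 6 * s * lb / (\<kappa> * \<rho>)"
    and "risk a b m g \<le> 4 * s * lb\<^sup>2 / (\<kappa> * \<rho>)"
    and "c * sqrt (real n) * increment_norm n a b m g \<le> 1"
proof -
  define M where "M = increment_norm n a b m g"
  \<comment> \<open>Twice the radius guaranteed by \<open>sparse_rate_local\<close>, so that an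
    increment shrunk to norm exactly \<open>B\<close> would satisfy B \<le> B / 2.\<close>
  define B where "B = 12 * s * lb / (\<kappa> * \<rho>)"
  have \<kappa>0: "0 < \<kappa>" using cmin by (simp add: \<kappa>)
  have s1: "1 \<le> s" using s by simp
  have B: "0 < B" using lb \<kappa>0 \<rho> s1 by (simp add: B_def)
  have cB: "c * sqrt (real n) * B \<le> 1" using small(3) by (simp add: B_def mult_ac)
  have "M \<le> B"
  proof (rule ccontr)
    assume "\<not> M \<le> B"
    then have M: "B < M" "0 < M" using B by auto
    define \<tau> where "\<tau> = B / M"
    have \<tau>: "0 \<le> \<tau>" "\<tau> \<le> 1" using B M by (auto simp: \<tau>_def)
    have norm_\<tau>: "increment_norm n (\<lambda>i. \<tau> * a i) (\<lambda>j. \<tau> * b j) (\<tau> * m) (\<tau> *\<^sub>R g) = B"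
      unfolding increment_norm_scale using B M by (simp add: \<tau>_def flip: M_def)
    have "B \<le> 6 * s * lb / (\<kappa> * \<rho>)"
      unfolding norm_\<tau>[symmetric]
    proof (rule sparse_rate_local(1)[OF sets s refl _ w \<rho> _ small(1,2) \<kappa>])
      have "risk (\<lambda>i. \<tau> * a i) (\<lambda>j. \<tau> * b j) (\<tau> * m) (\<tau> *\<^sub>R g) \<le> \<tau> * risk a b m g"
        by (rule risk_scale[OF \<tau>])
      also have "\<dots> \<le> \<tau> * (u * increment_norm n a b m g + lb * (L - (node_l1 n a b / sqrt (real n) - L)))"
        using basic \<tau> by (intro mult_left_mono) auto
      finally show "risk (\<lambda>i. \<tau> * a i) (\<lambda>j. \<tau> * b j) (\<tau> * m) (\<tau> *\<^sub>R g)
        \<le> u * increment_norm n (\<lambda>i. \<tau> * a i) (\<lambda>j. \<tau> * b j) (\<tau> * m) (\<tau> *\<^sub>R g)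
        + lb * (((\<Sum>i\<in>SA. \<bar>\<tau> * a i\<bar>) + (\<Sum>j\<in>SB. \<bar>\<tau> * b j\<bar>)) / sqrt (real n)
          - (node_l1 n (\<lambda>i. \<tau> * a i) (\<lambda>j. \<tau> * b j) / sqrt (real n)
            - ((\<Sum>i\<in>SA. \<bar>\<tau> * a i\<bar>) + (\<Sum>j\<in>SB. \<bar>\<tau> * b j\<bar>)) / sqrt (real n)))"
        using \<tau>(1) unfolding increment_norm_scale node_l1_scale L
        by (simp add: abs_mult sum_distrib_left[symmetric] algebra_simps
            add_divide_distrib diff_divide_distrib)
      show "c * sqrt (real n) * increment_norm n (\<lambda>i. \<tau> * a i) (\<lambda>j. \<tau> * b j) (\<tau> * m) (\<tau> *\<^sub>R g) \<le> 1"
        unfolding norm_\<tau> by (rule cB)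
    qed
    also have "6 * s * lb / (\<kappa> * \<rho>) = B / 2" by (simp add: B_def)
    finally have "B \<le> B / 2" .
    then show False using B by simp
  qed
  then have "c * sqrt (real n) * M \<le> c * sqrt (real n) * B"
    using c by (intro mult_left_mono) auto
  then show loc: "c * sqrt (real n) * increment_norm n a b m g \<le> 1" using cB by (simp add: M_def)
  show "increment_norm n a b m g \<le> 6 * s * lb / (\<kappa> * \<rho>)"
    by (rule sparse_rate_local(1)[OF sets s L basic w \<rho> loc small(1,2) \<kappa>])
  show "risk a b m g \<le> 4 * s * lb\<^sup>2 / (\<kappa> * \<rho>)"
    by (rule sparse_rate_local(2)[OF sets s L basic w \<rho> loc small(1,2) \<kappa>])
qed

text \<open>The way back from observed to fresh covariates. Because the same weights stand on both
  sides, no factor 1 / \<rho> is lost.\<close>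

lemma weighted_population_le:
  assumes "c * sqrt (real n) * increment_norm n a b m g \<le> 1"
    and w: "\<And>i j. (i, j) \<in> edge_pairs n \<Longrightarrow> exp (- K) * w i j \<le> logistic_var (x0 i j)"
  shows "pair_avg n (\<lambda>i j. w i j * ((a i + b j + m)\<^sup>2 + quad_form (S i j) g))
    \<le> 3 * exp K * risk a b m g + 2 * c * u * (increment_norm n a b m g)\<^sup>2"
proof -
  define R where "R = pair_avg n (\<lambda>i j. w i j * (a i + b j + m + g \<bullet> z i j)\<^sup>2)"
  have "exp (- K) * R / 3 \<le> risk a b m g"
    unfolding R_def by (rule weighted_square_le_risk[OF assms])
  then have "R \<le> 3 * exp K * risk a b m g" by (simp add: exp_minus field_simps)
  then show ?thesis
    using weighted_gram_deviation[OF n u(1) c balanced_z balanced_gram, of a b m g]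
    by (simp add: R_def)
qed

end

section \<open>The homogeneous regime for realised covariates\<close>

text \<open>When all curvatures are bounded below by one multiple of W, balancedness can be taken
  with constant weight 1 and W factors out. The size conditions \<open>large_n\<close> then do not
  involve \<rho> at all.\<close>

locale homogeneous_realization = covariate_realization n z S x0 "\<lambda>_ _. 1" c u lb cmin K
  for n and z :: "nat \<Rightarrow> nat \<Rightarrow> real ^ ('p :: finite)" and S x0 c u lb cmin K +
  fixes W \<kappa> :: real
  assumes \<kappa>: "\<kappa> = cmin / (2 * (real CARD('p) + 1))"
    and W: "0 < W" "\<And>i j. (i, j) \<in> edge_pairs n \<Longrightarrow> exp (- K) * W \<le> logistic_var (x0 i j)"
    and large_n: "2 * c * u \<le> \<kappa>" "3 * c / sqrt (real n) \<le> \<kappa> / 2"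
begin

lemma \<kappa>_pos: "0 < \<kappa>"
  using cmin by (simp add: \<kappa> add_nonneg_pos)

text \<open>The intercept and covariate columns alone satisfy a compatibility condition without any
  localisation. The 2 in the definition of \<kappa> leaves one \<kappa> T^2 to absorb the Gram
  deviation.\<close>

lemma pair_avg_square_covariates:
  "\<kappa> * (\<bar>m\<bar> + vec_l1 g)\<^sup>2 \<le> pair_avg n (\<lambda>i j. (m + g \<bullet> z i j)\<^sup>2)"
proof -
  define T where "T = \<bar>m\<bar> + vec_l1 g"
  define V where "V = m\<^sup>2 + (norm g)\<^sup>2"
  have T: "increment_norm n (\<lambda>_. 0) (\<lambda>_. 0) m g = T"
    by (simp add: increment_norm_def node_l1_def T_def)
  have "\<bar>m\<bar>\<^sup>2 \<le> 1 * m\<^sup>2" by simp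
  then have "T\<^sup>2 \<le> (1 + real CARD('p)) * V"
    unfolding T_def V_def using vec_l1_square_le[of g] by (rule cauchy_schwarz_add) auto
  then have "\<kappa> * T\<^sup>2 \<le> \<kappa> * ((1 + real CARD('p)) * V)"
    using \<kappa>_pos by (intro mult_left_mono) auto
  also have "\<kappa> * ((1 + real CARD('p)) * V) = cmin * V / 2"
    by (simp add: \<kappa> field_simps)
  finally have TV: "2 * \<kappa> * T\<^sup>2 \<le> cmin * V" by simp
  have "cmin * V \<le> m\<^sup>2 + pair_avg n (\<lambda>i j. quad_form (S i j) g)"
    using gram_ge[of g] cmin mult_left_le_one_le[of "m\<^sup>2" cmin] by (simp add: V_def distrib_left)
  also have "\<dots> = pair_avg n (\<lambda>i j. 1 * ((0 + 0 + m)\<^sup>2 + quad_form (S i j) g))"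
    by (simp add: pair_avg_add pair_avg_const n)
  also have "\<dots> \<le> pair_avg n (\<lambda>i j. 1 * (0 + 0 + m + g \<bullet> z i j)\<^sup>2) + 2 * c * u * T\<^sup>2"
    using weighted_gram_deviation[OF n u(1) c balanced_z balanced_gram, of "\<lambda>_. 0" "\<lambda>_. 0" m g]
    by (simp add: T)
  finally have "cmin * V \<le> pair_avg n (\<lambda>i j. (m + g \<bullet> z i j)\<^sup>2) + \<kappa> * T\<^sup>2"
    using mult_right_mono[OF large_n(1) zero_le_power2[of T]] by simp
  then show ?thesis using TV by (simp add: T_def)
qed

lemma abs_covariate_le:
  assumes "(i, j) \<in> edge_pairs n"
  shows "\<bar>m + g \<bullet> z i j\<bar> \<le> c * (\<bar>m\<bar> + vec_l1 g)"
proof -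
  have "\<bar>m + g \<bullet> z i j\<bar> \<le> \<bar>m\<bar> + c * vec_l1 g"
    using abs_inner_le_vec_l1[of "z i j" c g, OF z_bound[OF assms]] by linarith
  moreover have "\<bar>m\<bar> \<le> c * \<bar>m\<bar>" using c by (simp add: mult_le_cancel_right1)
  ultimately show ?thesis by (simp add: distrib_left)
qed

text \<open>With empty support every node error is penalised, so the node part is at most 1 / 32 of
  the whole norm and hence dominated by the unpenalised part.\<close>

lemma node_cone:
  assumes "risk a b m g + lb * (node_l1 n a b / sqrt (real n)) \<le> u * increment_norm n a b m g"
  shows "node_l1 n a b / sqrt (real n) \<le> \<bar>m\<bar> + vec_l1 g"
proof -
  define Y where "Y = node_l1 n a b / sqrt (real n)"
  have Y: "0 \<le> Y" by (simp add: Y_def node_l1_nonneg)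
  have "lb * Y \<le> u * increment_norm n a b m g"
    using assms risk_nonneg[of a b m g] by (simp add: Y_def)
  also have "\<dots> \<le> lb / 32 * increment_norm n a b m g"
    using u increment_norm_nonneg by (intro mult_right_mono) auto
  finally have "lb * Y \<le> lb * (increment_norm n a b m g / 32)" by simp
  then have "Y \<le> increment_norm n a b m g / 32" using lb by simp
  moreover have "increment_norm n a b m g = Y + (\<bar>m\<bar> + vec_l1 g)"
    by (simp add: increment_norm_def Y_def)
  ultimately show ?thesis using Y vec_l1_nonneg[of g] unfolding Y_def[symmetric] by linarith
qed

text \<open>\<open>exp_gap\<close> is quadratic near 0 and linear far away, so T^2 / (2 + c T) is a
  valid order of growth for all T and no local region is needed. The node part enters as a
  perturbation whose average is only T / sqrt n.\<close>

lemma risk_lower: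
  assumes cone: "node_l1 n a b / sqrt (real n) \<le> \<bar>m\<bar> + vec_l1 g"
  defines "T \<equiv> \<bar>m\<bar> + vec_l1 g"
  shows "exp (- K) * W * (\<kappa> / 2 * (T\<^sup>2 / (2 + c * T))) \<le> risk a b m g"
proof -
  define e where "e i j = m + g \<bullet> z i j" for i j
  define y where "y i j = a i + b j" for i j
  have T: "0 \<le> T" by (simp add: T_def vec_l1_nonneg)
  have cT: "0 \<le> c * T" using c T by simp
  have e: "\<bar>e i j\<bar> \<le> c * T" if "(i, j) \<in> edge_pairs n" for i j
    using abs_covariate_le[OF that, of m g] by (simp add: e_def T_def)
  have "pair_avg n (\<lambda>i j. \<bar>y i j\<bar>) \<le> (node_l1 n a b / sqrt (real n)) / sqrt (real n)"
    using pair_avg_abs_nodes[OF n, of a b] n by (simp add: y_def)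
  also have "\<dots> \<le> T / sqrt (real n)"
    using cone by (intro divide_right_mono) (auto simp: T_def)
  finally have y: "pair_avg n (\<lambda>i j. \<bar>y i j\<bar>) \<le> T / sqrt (real n)" .
  have "1 / (2 + c * T) * (\<kappa> * T\<^sup>2) \<le> 1 / (2 + c * T) * pair_avg n (\<lambda>i j. (e i j)\<^sup>2)"
    using pair_avg_square_covariates[of m g] cT by (intro mult_left_mono) (auto simp: e_def T_def)
  also have "\<dots> = pair_avg n (\<lambda>i j. 1 / (2 + c * T) * (e i j)\<^sup>2)"
    by (simp only: pair_avg_cmult)
  also have "\<dots> \<le> pair_avg n (\<lambda>i j. exp_gap (e i j))"
  proof (rule pair_avg_mono)
    fix i j assume "(i, j) \<in> edge_pairs n"
    then have "1 / (2 + c * T) * (e i j)\<^sup>2 \<le> (e i j)\<^sup>2 / (2 + \<bar>e i j\<bar>)"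
      using e[of i j] cT by (auto intro!: divide_left_mono)
    then show "1 / (2 + c * T) * (e i j)\<^sup>2 \<le> exp_gap (e i j)"
      using exp_gap_lower[of "e i j"] by linarith
  qed
  finally have 1: "\<kappa> * (T\<^sup>2 / (2 + c * T)) \<le> pair_avg n (\<lambda>i j. exp_gap (e i j))" by simp
  \<comment> \<open>Bounding min 1 x by 3 x / (2 + x) brings the perturbation into the form of the
    main term, where \<open>large_n\<close> lets it consume at most half.\<close>
  have "min 1 (c * T) * (T / sqrt (real n)) \<le> (3 * (c * T) / (2 + c * T)) * (T / sqrt (real n))"
  proof (intro mult_right_mono)
    have "min 1 (c * T) * (2 + c * T) \<le> 3 * (c * T)"
    proof (cases "c * T \<le> 1")
      case True
      then have "c * T * (2 + c * T) \<le> c * T * 3" using cT by (intro mult_left_mono) auto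
      then show ?thesis using True by (simp add: mult_ac)
    next
      case False
      then have 1: "min 1 (c * T) = 1" by simp
      have "2 + x \<le> 3 * x" if "1 < x" for x :: real using that by simp
      from this[of "c * T"] show ?thesis using False unfolding 1 by simp
    qed
    then show "min 1 (c * T) \<le> 3 * (c * T) / (2 + c * T)" using cT by (simp add: pos_le_divide_eq)
  qed (use T in auto)
  also have "\<dots> = (3 * c / sqrt (real n)) * (T\<^sup>2 / (2 + c * T))"
    by (simp add: power2_eq_square mult_ac)
  also have "\<dots> \<le> \<kappa> / 2 * (T\<^sup>2 / (2 + c * T))"
    using large_n(2) cT by (intro mult_right_mono) auto
  finally have 2: "min 1 (c * T) * (T / sqrt (real n)) \<le> \<kappa> / 2 * (T\<^sup>2 / (2 + c * T))" .
  have "pair_avg n (\<lambda>i j. exp_gap (e i j)) - min 1 (c * T) * pair_avg n (\<lambda>i j. \<bar>y i j\<bar>)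
      = pair_avg n (\<lambda>i j. exp_gap (e i j) - min 1 (c * T) * \<bar>y i j\<bar>)"
    by (simp only: pair_avg_diff pair_avg_cmult)
  also have "\<dots> \<le> pair_avg n (\<lambda>i j. exp_gap (e i j + y i j))"
  proof (rule pair_avg_mono)
    fix i j assume ij: "(i, j) \<in> edge_pairs n"
    have "min 1 \<bar>e i j\<bar> * \<bar>y i j\<bar> \<le> min 1 (c * T) * \<bar>y i j\<bar>"
      using e[OF ij] by (intro mult_right_mono) auto
    then show "exp_gap (e i j) - min 1 (c * T) * \<bar>y i j\<bar> \<le> exp_gap (e i j + y i j)"
      using exp_gap_add[of "e i j" "y i j"] by linarith
  qed
  finally have 3: "pair_avg n (\<lambda>i j. exp_gap (e i j)) - min 1 (c * T) * pair_avg n (\<lambda>i j. \<bar>y i j\<bar>)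
      \<le> pair_avg n (\<lambda>i j. exp_gap (e i j + y i j))" .
  have "min 1 (c * T) * pair_avg n (\<lambda>i j. \<bar>y i j\<bar>) \<le> min 1 (c * T) * (T / sqrt (real n))"
    using y cT by (intro mult_left_mono) auto
  then have "\<kappa> / 2 * (T\<^sup>2 / (2 + c * T)) \<le> pair_avg n (\<lambda>i j. exp_gap (e i j + y i j))"
    using 1 2 3 by linarith
  then have "exp (- K) * W * (\<kappa> / 2 * (T\<^sup>2 / (2 + c * T)))
      \<le> exp (- K) * W * pair_avg n (\<lambda>i j. exp_gap (e i j + y i j))"
    using W by (intro mult_left_mono) auto
  also have "\<dots> = pair_avg n (\<lambda>i j. exp (- K) * W * exp_gap (e i j + y i j))"
    by (simp only: pair_avg_cmult)
  also have "\<dots> \<le> risk a b m g"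
    unfolding risk_def
  proof (rule pair_avg_mono)
    fix i j assume ij: "(i, j) \<in> edge_pairs n"
    have "exp (- K) * W * exp_gap (e i j + y i j) \<le> logistic_var (x0 i j) * exp_gap (e i j + y i j)"
      using W(2)[OF ij] exp_gap_nonneg by (intro mult_right_mono) auto
    also have "\<dots> \<le> bregman (x0 i j) (e i j + y i j)" by (rule bregman_lower)
    finally show "exp (- K) * W * exp_gap (e i j + y i j) \<le> bregman (x0 i j) (a i + b j + m + g \<bullet> z i j)"
      by (simp add: e_def y_def add_ac)
  qed
  finally show ?thesis .
qed

text \<open>With H the effective curvature, the score bound leaves H T \<le> 4 \<nu> + 2 \<nu> c T.
  The condition 4 \<nu> c \<le> H absorbs the last term: it expresses that the linear growth of the
  risk beats the score.\<close>

lemma rate_by_curvature: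
  assumes cone: "risk a b m g + lb * (node_l1 n a b / sqrt (real n)) \<le> u * increment_norm n a b m g"
    and basic: "risk a b m g + lb * (node_l1 n a b / sqrt (real n))
      \<le> u * (node_l1 n a b / sqrt (real n)) + \<nu> * (\<bar>m\<bar> + vec_l1 g)"
    and \<nu>: "0 \<le> \<nu>" "4 * \<nu> * c \<le> exp (- K) * W * \<kappa>"
  shows "\<bar>m\<bar> + vec_l1 g \<le> 8 * \<nu> / (exp (- K) * W * \<kappa>)"
    and "lb * (node_l1 n a b / sqrt (real n)) \<le> 2 * \<nu> * (\<bar>m\<bar> + vec_l1 g)"
proof -
  define T where "T = \<bar>m\<bar> + vec_l1 g"
  define Y where "Y = node_l1 n a b / sqrt (real n)"
  define H where "H = exp (- K) * W * \<kappa>"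
  have T: "0 \<le> T" by (simp add: T_def vec_l1_nonneg)
  have Y: "0 \<le> Y" by (simp add: Y_def node_l1_nonneg)
  have H: "0 < H" using W \<kappa>_pos by (simp add: H_def)
  have cT: "0 \<le> c * T" using c T by simp
  have low: "H / 2 * (T\<^sup>2 / (2 + c * T)) \<le> risk a b m g"
    using risk_lower[OF node_cone[OF cone]] by (simp add: T_def H_def)
  have "u * Y \<le> lb / 32 * Y" using u Y by (intro mult_right_mono) auto
  moreover have "0 \<le> lb * Y" using lb Y by simp
  ultimately have uY: "u * Y \<le> lb * Y / 2" by linarith
  have star: "H / 2 * (T\<^sup>2 / (2 + c * T)) + lb * Y / 2 \<le> \<nu> * T"
    using low basic uY unfolding Y_def[symmetric] T_def[symmetric] by linarith
  have "0 \<le> H / 2 * (T\<^sup>2 / (2 + c * T))" using H cT by (intro mult_nonneg_nonneg) auto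
  then show "lb * (node_l1 n a b / sqrt (real n)) \<le> 2 * \<nu> * (\<bar>m\<bar> + vec_l1 g)"
    using star unfolding Y_def[symmetric] T_def[symmetric] by linarith
  have "H / 2 * (T\<^sup>2 / (2 + c * T)) \<le> \<nu> * T"
    using star mult_nonneg_nonneg[of lb Y] lb Y by linarith
  then have "(H / 2 * T\<^sup>2) / (2 + c * T) \<le> \<nu> * T" by simp
  then have "H / 2 * T\<^sup>2 \<le> \<nu> * T * (2 + c * T)"
    using cT by (subst (asm) pos_divide_le_eq) auto
  then have "H * T\<^sup>2 \<le> 2 * (\<nu> * T) * (2 + c * T)" by simp
  then have "T * (H * T) \<le> T * (2 * \<nu> * (2 + c * T))"
    by (simp add: power2_eq_square mult_ac)
  then have "H * T \<le> 2 * \<nu> * (2 + c * T)"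
    using T \<nu> c H by (cases "T = 0") auto
  also have "\<dots> = 4 * \<nu> + (4 * \<nu> * c) * T / 2" by (simp add: algebra_simps)
  also have "\<dots> \<le> 4 * \<nu> + H * T / 2"
    using \<nu>(2) T by (intro add_left_mono divide_right_mono mult_right_mono) (auto simp: H_def)
  finally have "H * T \<le> 8 * \<nu>" by simp
  then show "\<bar>m\<bar> + vec_l1 g \<le> 8 * \<nu> / (exp (- K) * W * \<kappa>)"
    using H by (simp add: pos_le_divide_eq T_def H_def mult_ac)
qed

lemma rate_by_local_space:
  assumes cone: "risk a b m g + lb * (node_l1 n a b / sqrt (real n)) \<le> u * increment_norm n a b m g"
    and r: "\<And>i j. (i, j) \<in> edge_pairs n \<Longrightarrow> \<bar>a i + b j + m + g \<bullet> z i j\<bar> \<le> 2 * r"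
  shows "\<bar>m\<bar> + vec_l1 g \<le> 4 * c * r / \<kappa>"
proof -
  define T where "T = \<bar>m\<bar> + vec_l1 g"
  have T: "0 \<le> T" by (simp add: T_def vec_l1_nonneg)
  have node: "node_l1 n a b / sqrt (real n) \<le> T"
    using node_cone[OF cone] by (simp add: T_def)
  have "node_l1 n a b / real n = (node_l1 n a b / sqrt (real n)) / sqrt (real n)" by simp
  also have "\<dots> \<le> T / sqrt (real n)" using node by (intro divide_right_mono) auto
  finally have Y: "node_l1 n a b / real n \<le> T / sqrt (real n)" .
  have "\<kappa> * T\<^sup>2 \<le> pair_avg n (\<lambda>i j. (m + g \<bullet> z i j)\<^sup>2)"
    using pair_avg_square_covariates by (simp add: T_def)
  also have "\<dots> \<le> pair_avg n (\<lambda>i j. c * T * (\<bar>a i + b j\<bar> + 2 * r))"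
  proof (rule pair_avg_mono)
    fix i j assume ij: "(i, j) \<in> edge_pairs n"
    have "\<bar>m + g \<bullet> z i j\<bar> \<le> \<bar>a i + b j\<bar> + 2 * r" using r[OF ij] by linarith
    moreover have "\<bar>m + g \<bullet> z i j\<bar> \<le> c * T" using abs_covariate_le[OF ij] by (simp add: T_def)
    ultimately have "\<bar>m + g \<bullet> z i j\<bar> * \<bar>m + g \<bullet> z i j\<bar> \<le> c * T * (\<bar>a i + b j\<bar> + 2 * r)"
      using c T by (intro mult_mono) auto
    then show "(m + g \<bullet> z i j)\<^sup>2 \<le> c * T * (\<bar>a i + b j\<bar> + 2 * r)"
      by (simp add: power2_eq_square abs_mult_self_eq)
  qed
  also have "\<dots> = c * T * (pair_avg n (\<lambda>i j. \<bar>a i + b j\<bar>) + 2 * r)"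
    by (simp only: pair_avg_cmult pair_avg_add pair_avg_const[OF n])
  also have "\<dots> \<le> c * T * (T / sqrt (real n) + 2 * r)"
    using c T Y pair_avg_abs_nodes[OF n, of a b] by (intro mult_left_mono) auto
  finally have "T * (\<kappa> * T) \<le> T * (c * (T / sqrt (real n)) + 2 * c * r)"
    by (simp add: power2_eq_square algebra_simps)
  moreover have "0 \<le> r"
    using edge_pairs_nonempty[OF n] r abs_ge_zero by (smt (verit) ex_in_conv old.prod.exhaust)
  ultimately have "\<kappa> * T \<le> c * (T / sqrt (real n)) + 2 * c * r"
    using T c by (cases "T = 0") auto
  moreover have "c * (T / sqrt (real n)) \<le> \<kappa> / 2 * T"
  proof -
    have "c / sqrt (real n) \<le> 3 * c / sqrt (real n)" using c by (intro divide_right_mono) auto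
    then have "c / sqrt (real n) * T \<le> \<kappa> / 2 * T"
      using large_n(2) T by (intro mult_right_mono) auto
    then show ?thesis by simp
  qed
  ultimately have "\<kappa> * T \<le> 4 * c * r" by linarith
  then show ?thesis using \<kappa>_pos by (simp add: pos_le_divide_eq T_def mult_ac)
qed

end

section \<open>Independence of the edge-covariate pairs\<close>

text \<open>Requiring c \<ge> 1 makes it a common bound for the noise and for its products with
  covariates, so that all fields share one Hoeffding range. The instance used later is the maximum
  of 1 and the given bound.\<close>

locale edge_model = prob_space M for M :: "'a measure" +
  fixes n :: nat and A :: "nat \<Rightarrow> nat \<Rightarrow> 'a \<Rightarrow> real" and Z :: "nat \<Rightarrow> nat \<Rightarrow> 'a \<Rightarrow> real ^ ('p :: finite)"
    and \<theta>0 :: "'p params" and c :: real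
  assumes n: "2 \<le> n"
    and adjacency: "\<And>i j \<omega>. (i, j) \<in> edge_pairs n \<Longrightarrow> \<omega> \<in> space M \<Longrightarrow> A i j \<omega> \<in> {0, 1}"
    and edges_cond_indep:
      "cond_indep_vars M (covariate_algebra n M Z) (\<lambda>_. borel) (\<lambda>(i, j). A i j) (edge_pairs n)"
    and edges_prob: "\<And>i j. (i, j) \<in> edge_pairs n \<Longrightarrow>
      AE \<omega> in M. real_cond_exp M (covariate_algebra n M Z) (indicator {\<omega> \<in> space M. A i j \<omega> = 1}) \<omega>
        = link_prob (\<lambda>i j. Z i j \<omega>) \<theta>0 i j"
    and Z_indep: "indep_vars (\<lambda>_. borel) (\<lambda>(i, j). Z i j) (edge_pairs n)"
    and Z_centered: "\<And>i j. (i, j) \<in> edge_pairs n \<Longrightarrow> expectation (Z i j) = 0"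
    and c_ge_1: "1 \<le> c"
    and Z_bounded: "\<And>i j k. (i, j) \<in> edge_pairs n \<Longrightarrow> AE \<omega> in M. \<bar>Z i j \<omega> $ k\<bar> \<le> c"
begin

section \<open>The conditional law of an edge given the covariates\<close>

definition base :: "nat \<Rightarrow> nat \<Rightarrow> real" where
  "base i j = alpha \<theta>0 i + beta \<theta>0 j + mu \<theta>0"

definition link :: "nat \<Rightarrow> nat \<Rightarrow> real ^ 'p \<Rightarrow> real" where
  "link i j v = logistic (base i j + gamma \<theta>0 \<bullet> v)"

lemma link_prob_eq: "link_prob (\<lambda>i j. Z i j \<omega>) \<theta>0 i j = link i j (Z i j \<omega>)"
  by (simp add: link_prob_def link_def lin_pred_def base_def logistic_def)

lemma link_measurable [measurable]: "link i j \<in> borel_measurable borel"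
  unfolding link_def[abs_def] by measurable

lemma link_bounds: "0 < link i j v" "link i j v < 1"
  by (simp_all add: link_def logistic_pos logistic_less_1)

lemma A_measurable [measurable]: "(i, j) \<in> edge_pairs n \<Longrightarrow> A i j \<in> borel_measurable M"
  using edges_cond_indep unfolding cond_indep_vars_def by fastforce

lemma Z_measurable [measurable]: "(i, j) \<in> edge_pairs n \<Longrightarrow> Z i j \<in> borel_measurable M"
  using Z_indep unfolding indep_vars_def by fastforce

abbreviation true_pred where "true_pred i j \<omega> \<equiv> base i j + gamma \<theta>0 \<bullet> Z i j \<omega>"

abbreviation F where "F \<equiv> covariate_algebra n M Z"

lemma covariates_measurable:
  "(\<lambda>\<omega>. \<lambda>(i, j)\<in>edge_pairs n. Z i j \<omega>) \<in> measurable M (\<Pi>\<^sub>M e\<in>edge_pairs n. borel)"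
  by (rule measurable_restrict) (auto split: prod.split)

lemma subalgebra_F: "subalgebra M F"
  unfolding subalgebra_def covariate_algebra_def
  using sets_image_in_sets[OF refl covariates_measurable] by simp

sublocale F: finite_measure_subalgebra M F
  by unfold_locales (rule subalgebra_F)

lemma Z_measurable_F [measurable]: "(i, j) \<in> edge_pairs n \<Longrightarrow> Z i j \<in> borel_measurable F"
proof -
  assume ij: "(i, j) \<in> edge_pairs n"
  have "(\<lambda>\<omega>. \<lambda>(i, j)\<in>edge_pairs n. Z i j \<omega>) \<in> measurable F (\<Pi>\<^sub>M e\<in>edge_pairs n. borel)"
    unfolding covariate_algebra_def
    by (rule measurable_vimage_algebra1) (auto simp: space_PiM)
  then have "(\<lambda>\<omega>. (\<lambda>(i, j)\<in>edge_pairs n. Z i j \<omega>) (i, j)) \<in> borel_measurable F"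
    by (rule measurable_compose[OF _ measurable_component_singleton[OF ij]])
  then show ?thesis using ij by (simp add: restrict_def)
qed

text \<open>The conditional probability that the edge variable lies in B, given that its covariate
  has the value v.\<close>

definition edge_val_prob :: "nat \<Rightarrow> nat \<Rightarrow> real set \<Rightarrow> real ^ 'p \<Rightarrow> real" where
  "edge_val_prob i j B v = indicator B 1 * link i j v + indicator B 0 * (1 - link i j v)"

lemma edge_val_prob_measurable [measurable]: "edge_val_prob i j B \<in> borel_measurable borel"
  unfolding edge_val_prob_def[abs_def] by measurable

lemma edge_val_prob_bounds: "0 \<le> edge_val_prob i j B v" "edge_val_prob i j B v \<le> 1"
  using link_bounds[of i j v] by (auto simp: edge_val_prob_def indicator_def)

text \<open>Since the edge takes values 0 and 1 only, the indicator of any event about it is an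
  affine function of the indicator of the value 1, whose conditional expectation is given.\<close>

lemma cond_exp_edge:
  assumes ij: "(i, j) \<in> edge_pairs n" and B: "B \<in> sets borel"
  shows "AE \<omega> in M. real_cond_exp M F (indicator (A i j -` B \<inter> space M)) \<omega> = edge_val_prob i j B (Z i j \<omega>)"
proof -
  define I :: "'a \<Rightarrow> real" where "I = indicator {\<omega> \<in> space M. A i j \<omega> = 1}"
  note [measurable] = A_measurable[OF ij]
  have I [measurable]: "I \<in> borel_measurable M" unfolding I_def by measurable
  have int: "integrable M I"
    by (rule integrable_const_bound[of _ 1]) (auto simp: I_def indicator_def)
  define k0 k1 :: real where "k0 = indicator B 0" and "k1 = indicator B 1"
  have 1: "AE \<omega> in M. real_cond_exp M F (indicator (A i j -` B \<inter> space M)) \<omega>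
      = real_cond_exp M F (\<lambda>\<omega>. (k1 - k0) * I \<omega> + k0) \<omega>"
  proof (rule F.real_cond_exp_cong)
    show "AE \<omega> in M. indicator (A i j -` B \<inter> space M) \<omega> = (k1 - k0) * I \<omega> + k0"
    proof (rule AE_I2)
      fix \<omega> assume "\<omega> \<in> space M"
      then show "indicator (A i j -` B \<inter> space M) \<omega> = (k1 - k0) * I \<omega> + k0"
        using adjacency[OF ij, of \<omega>] by (auto simp: I_def k0_def k1_def indicator_def)
    qed
    show "indicator (A i j -` B \<inter> space M) \<in> borel_measurable M"
      using B by (intro borel_measurable_indicator measurable_sets[OF A_measurable[OF ij]])
  qed measurable
  have 2: "AE \<omega> in M. real_cond_exp M F (\<lambda>\<omega>. (k1 - k0) * I \<omega> + k0) \<omega>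
      = real_cond_exp M F (\<lambda>\<omega>. (k1 - k0) * I \<omega>) \<omega> + real_cond_exp M F (\<lambda>\<omega>. k0) \<omega>"
    using int by (intro F.real_cond_exp_add) auto
  have 3: "AE \<omega> in M. real_cond_exp M F (\<lambda>\<omega>. (k1 - k0) * I \<omega>) \<omega> = (k1 - k0) * real_cond_exp M F I \<omega>"
    using int by (rule F.real_cond_exp_cmult)
  have 4: "AE \<omega> in M. real_cond_exp M F (\<lambda>\<omega>. k0) \<omega> = k0"
    by (rule F.real_cond_exp_F_meas) auto
  have 5: "AE \<omega> in M. real_cond_exp M F I \<omega> = link i j (Z i j \<omega>)"
    using edges_prob[OF ij] by (simp add: I_def link_prob_eq)
  show ?thesis
    using 1 2 3 4 5
    by eventually_elim (simp add: edge_val_prob_def k0_def k1_def algebra_simps)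
qed

text \<open>The factor f depends on the covariates only, so the edge event may be replaced by its
  conditional probability, which conditional independence turns into a product of functions of the
  individual covariates.\<close>

lemma expectation_edges_covariates:
  assumes J: "J \<subseteq> edge_pairs n" "J \<noteq> {}"
    and B: "\<And>i j. (i, j) \<in> J \<Longrightarrow> B (i, j) \<in> sets borel"
    and f: "f \<in> borel_measurable F" "\<And>\<omega>. \<bar>f \<omega>\<bar> \<le> K"
  shows "expectation (\<lambda>\<omega>. f \<omega> * indicator (\<Inter>(i, j)\<in>J. A i j -` B (i, j) \<inter> space M) \<omega>)
    = expectation (\<lambda>\<omega>. f \<omega> * (\<Prod>(i, j)\<in>J. edge_val_prob i j (B (i, j)) (Z i j \<omega>)))"
proof -
  define D where "D = (\<Inter>(i, j)\<in>J. A i j -` B (i, j) \<inter> space M)"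
  have fin: "finite J" using J finite_edge_pairs finite_subset by blast
  have fM [measurable]: "f \<in> borel_measurable M"
    by (rule measurable_from_subalg[OF subalgebra_F f(1)])
  have D [measurable]: "D \<in> sets M"
    unfolding D_def using J B fin
    by (intro sets.finite_INT) (auto intro!: measurable_sets[OF A_measurable])
  have "AE \<omega> in M. real_cond_exp M F (indicator D) \<omega>
      = (\<Prod>e\<in>J. real_cond_exp M F (indicator ((case e of (i, j) \<Rightarrow> A i j) -` B e \<inter> space M)) \<omega>)"
  proof -
    have "B \<in> (\<Pi> j\<in>J. sets borel)" using B by auto
    then have "AE \<omega> in M. real_cond_exp M F (indicator (\<Inter>e\<in>J. (case e of (i, j) \<Rightarrow> A i j) -` B e \<inter> space M)) \<omega>
      = (\<Prod>e\<in>J. real_cond_exp M F (indicator ((case e of (i, j) \<Rightarrow> A i j) -` B e \<inter> space M)) \<omega>)"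
      using edges_cond_indep J fin unfolding cond_indep_vars_def by blast
    moreover have "D = (\<Inter>e\<in>J. (case e of (i, j) \<Rightarrow> A i j) -` B e \<inter> space M)"
      unfolding D_def by (intro INF_cong) auto
    ultimately show ?thesis by simp
  qed
  moreover have "AE \<omega> in M. \<forall>e\<in>J. real_cond_exp M F (indicator ((case e of (i, j) \<Rightarrow> A i j) -` B e \<inter> space M)) \<omega>
      = (case e of (i, j) \<Rightarrow> edge_val_prob i j (B (i, j)) (Z i j \<omega>))"
    using fin J B by (intro AE_finite_allI) (auto split: prod.split intro!: cond_exp_edge)
  ultimately have AE: "AE \<omega> in M. real_cond_exp M F (indicator D) \<omega>
      = (\<Prod>(i, j)\<in>J. edge_val_prob i j (B (i, j)) (Z i j \<omega>))"
    by eventually_elim (auto intro!: prod.cong)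
  have int: "integrable M (\<lambda>\<omega>. f \<omega> * indicator D \<omega>)"
    by (rule integrable_const_bound[of _ K]) (use f(2) in \<open>auto simp: indicator_def abs_mult intro: order_trans[OF abs_ge_zero]\<close>)
  have "expectation (\<lambda>\<omega>. f \<omega> * indicator D \<omega>) = expectation (\<lambda>\<omega>. f \<omega> * real_cond_exp M F (indicator D) \<omega>)"
    using F.real_cond_exp_intg(2)[OF int f(1)] by simp
  also have "\<dots> = expectation (\<lambda>\<omega>. f \<omega> * (\<Prod>(i, j)\<in>J. edge_val_prob i j (B (i, j)) (Z i j \<omega>)))"
  proof (rule integral_cong_AE)
    have "(\<lambda>\<omega>. \<Prod>e\<in>J. case e of (i, j) \<Rightarrow> edge_val_prob i j (B (i, j)) (Z i j \<omega>)) \<in> borel_measurable M"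
      using J by (intro borel_measurable_prod) (auto split: prod.split intro!: measurable_compose[OF Z_measurable])
    then show "(\<lambda>\<omega>. f \<omega> * (\<Prod>(i, j)\<in>J. edge_val_prob i j (B (i, j)) (Z i j \<omega>))) \<in> borel_measurable M"
      by measurable
    show "AE \<omega> in M. f \<omega> * real_cond_exp M F (indicator D) \<omega>
      = f \<omega> * (\<Prod>(i, j)\<in>J. edge_val_prob i j (B (i, j)) (Z i j \<omega>))"
      using AE by eventually_elim simp
  qed measurable
  finally show ?thesis by (simp add: D_def)
qed

lemma expectation_edge:
  assumes ij: "(i, j) \<in> edge_pairs n" and f: "f \<in> borel_measurable borel"
    and bound: "AE \<omega> in M. \<bar>f (Z i j \<omega>)\<bar> \<le> K"
  shows "expectation (\<lambda>\<omega>. A i j \<omega> * f (Z i j \<omega>)) = expectation (\<lambda>\<omega>. link i j (Z i j \<omega>) * f (Z i j \<omega>))"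
proof -
  note [measurable] = Z_measurable[OF ij] A_measurable[OF ij] f
  \<comment> \<open>Truncation at K: the preceding lemma asks for a bound everywhere, whereas f is
    bounded only almost surely along the covariate.\<close>
  define h where "h = (\<lambda>v. max (- K) (min K (f v)))"
  have [measurable]: "h \<in> borel_measurable borel" unfolding h_def by measurable
  have K: "0 \<le> K"
  proof (rule ccontr)
    assume "\<not> 0 \<le> K"
    then have "AE \<omega> in M. \<not> \<bar>f (Z i j \<omega>)\<bar> \<le> K" by (intro AE_I2) linarith
    with bound show False by (rule AE_contr)
  qed
  have h: "\<bar>h v\<bar> \<le> K" for v using K by (auto simp: h_def)
  have fh: "AE \<omega> in M. f (Z i j \<omega>) = h (Z i j \<omega>)"
    using bound by eventually_elim (auto simp: h_def)
  have "expectation (\<lambda>\<omega>. A i j \<omega> * f (Z i j \<omega>))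
      = expectation (\<lambda>\<omega>. h (Z i j \<omega>) * indicator (\<Inter>(i, j)\<in>{(i, j)}. A i j -` {1} \<inter> space M) \<omega>)"
  proof (rule integral_cong_AE)
    show "AE \<omega> in M. A i j \<omega> * f (Z i j \<omega>) = h (Z i j \<omega>) * indicator (\<Inter>(i, j)\<in>{(i, j)}. A i j -` {1} \<inter> space M) \<omega>"
      using fh AE_space
    proof eventually_elim
      case (elim \<omega>)
      then show ?case using adjacency[OF ij elim(2)] by (auto simp: indicator_def)
    qed
  qed (auto intro!: measurable_sets[OF A_measurable[OF ij]])
  also have "\<dots> = expectation (\<lambda>\<omega>. h (Z i j \<omega>) * (\<Prod>(i, j)\<in>{(i, j)}. edge_val_prob i j {1} (Z i j \<omega>)))"
    using ij h by (intro expectation_edges_covariates[where B = "\<lambda>_. {1}"])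
      (auto intro!: measurable_compose[OF Z_measurable_F])
  also have "\<dots> = expectation (\<lambda>\<omega>. link i j (Z i j \<omega>) * f (Z i j \<omega>))"
    by (rule integral_cong_AE) (use fh in \<open>auto simp: edge_val_prob_def mult.commute\<close>)
  finally show ?thesis .
qed

text \<open>Given all covariates the edges are independent, each with a law that depends on its own
  covariate alone; independence of the covariates then makes the pairs independent. It suffices to
  test on rectangles.\<close>

lemma indep_pairs:
  "indep_vars (\<lambda>_. borel \<Otimes>\<^sub>M borel) (\<lambda>(i, j) \<omega>. (A i j \<omega>, Z i j \<omega>)) (edge_pairs n)"
proof -
  define G :: "(real \<times> (real ^ 'p)) set set" where "G = {a \<times> b | a b. a \<in> sets borel \<and> b \<in> sets borel}"
  have "\<forall>D\<in>(\<Pi> e\<in>edge_pairs n. G).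
     prob (\<Inter>e\<in>edge_pairs n. (\<lambda>(i, j) \<omega>. (A i j \<omega>, Z i j \<omega>)) e -` D e \<inter> space M)
    = (\<Prod>e\<in>edge_pairs n. prob ((\<lambda>(i, j) \<omega>. (A i j \<omega>, Z i j \<omega>)) e -` D e \<inter> space M))"
  proof
    fix D assume "D \<in> (\<Pi> e\<in>edge_pairs n. G)"
    then have "\<forall>e\<in>edge_pairs n. \<exists>BC. D e = fst BC \<times> snd BC \<and> fst BC \<in> sets borel \<and> snd BC \<in> sets borel"
      by (fastforce simp: G_def Pi_iff)
    from bchoice[OF this] obtain BC where BC: "\<And>e. e \<in> edge_pairs n \<Longrightarrow> D e = fst (BC e) \<times> snd (BC e)"
      "\<And>e. e \<in> edge_pairs n \<Longrightarrow> fst (BC e) \<in> sets borel" "\<And>e. e \<in> edge_pairs n \<Longrightarrow> snd (BC e) \<in> sets borel"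
      by blast
    define B where "B = (\<lambda>e. fst (BC e))"
    define C where "C = (\<lambda>e. snd (BC e))"
    have B: "B e \<in> sets borel" and C: "C e \<in> sets borel" and D: "D e = B e \<times> C e" if "e \<in> edge_pairs n" for e
      using BC that by (auto simp: B_def C_def)
    \<comment> \<open>The probability of the rectangle for a single pair, conditional on the
      covariate of that pair.\<close>
    define q where "q = (\<lambda>(i, j) v. indicator (C (i, j)) v * edge_val_prob i j (B (i, j)) v)"
    have q_meas: "q e \<in> borel_measurable borel" if "e \<in> edge_pairs n" for e
      unfolding q_def using C[OF that] by (cases e) auto
    have q_bound: "norm (q e v) \<le> 1" for e v
      using edge_val_prob_bounds by (cases e) (auto simp: q_def indicator_def)
    \<comment> \<open>Applied to all pairs it computes the joint probability, applied to singletons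
      the marginal ones.\<close>
    have key: "prob (\<Inter>(i, j)\<in>J. {\<omega> \<in> space M. A i j \<omega> \<in> B (i, j) \<and> Z i j \<omega> \<in> C (i, j)})
      = expectation (\<lambda>\<omega>. \<Prod>(i, j)\<in>J. q (i, j) (Z i j \<omega>))"
      if J: "J \<subseteq> edge_pairs n" "J \<noteq> {}" for J
    proof -
      have fin: "finite J" using J finite_edge_pairs finite_subset by blast
      define f :: "'a \<Rightarrow> real" where "f \<omega> = (\<Prod>(i, j)\<in>J. indicator (C (i, j)) (Z i j \<omega>))" for \<omega>
      have f: "f \<in> borel_measurable F"
        unfolding f_def using J C
        by (intro borel_measurable_prod) (auto split: prod.split intro!: measurable_compose[OF Z_measurable_F])
      have "\<bar>f \<omega>\<bar> \<le> 1" for \<omega>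
        unfolding f_def by (auto simp: abs_prod indicator_def intro!: prod_le_1)
      moreover have "B (i, j) \<in> sets borel" if "(i, j) \<in> J" for i j
        using B J that by blast
      ultimately have E: "expectation (\<lambda>\<omega>. f \<omega> * indicator (\<Inter>(i, j)\<in>J. A i j -` B (i, j) \<inter> space M) \<omega>)
        = expectation (\<lambda>\<omega>. f \<omega> * (\<Prod>(i, j)\<in>J. edge_val_prob i j (B (i, j)) (Z i j \<omega>)))"
        using expectation_edges_covariates[OF J, of B f 1] f by blast
      have set_eq: "(\<Inter>(i, j)\<in>J. {\<omega> \<in> space M. A i j \<omega> \<in> B (i, j) \<and> Z i j \<omega> \<in> C (i, j)}) \<inter> space M
         = (\<Inter>(i, j)\<in>J. {\<omega> \<in> space M. A i j \<omega> \<in> B (i, j) \<and> Z i j \<omega> \<in> C (i, j)})"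
        using J by auto
      have "expectation (indicator (\<Inter>(i, j)\<in>J. {\<omega> \<in> space M. A i j \<omega> \<in> B (i, j) \<and> Z i j \<omega> \<in> C (i, j)}))
        = expectation (\<lambda>\<omega>. f \<omega> * indicator (\<Inter>(i, j)\<in>J. A i j -` B (i, j) \<inter> space M) \<omega>)"
      proof (rule Bochner_Integration.integral_cong[OF refl])
        fix \<omega> assume \<omega>: "\<omega> \<in> space M"
        show "indicator (\<Inter>(i, j)\<in>J. {\<omega> \<in> space M. A i j \<omega> \<in> B (i, j) \<and> Z i j \<omega> \<in> C (i, j)}) \<omega>
          = f \<omega> * indicator (\<Inter>(i, j)\<in>J. A i j -` B (i, j) \<inter> space M) \<omega>"
        proof (cases "\<forall>(i, j)\<in>J. Z i j \<omega> \<in> C (i, j)")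
          case True
          then have "f \<omega> = 1" unfolding f_def by (intro prod.neutral) auto
          then show ?thesis using True \<omega> by (auto simp: indicator_def)
        next
          case False
          then have "f \<omega> = 0" unfolding f_def using fin by (intro prod_zero) (auto simp: indicator_def split: prod.splits)
          then show ?thesis using False \<omega> by (auto simp: indicator_def)
        qed
      qed
      then have "prob (\<Inter>(i, j)\<in>J. {\<omega> \<in> space M. A i j \<omega> \<in> B (i, j) \<and> Z i j \<omega> \<in> C (i, j)})
        = expectation (\<lambda>\<omega>. f \<omega> * indicator (\<Inter>(i, j)\<in>J. A i j -` B (i, j) \<inter> space M) \<omega>)"
        by (simp add: set_eq)
      also have "\<dots> = expectation (\<lambda>\<omega>. f \<omega> * (\<Prod>(i, j)\<in>J. edge_val_prob i j (B (i, j)) (Z i j \<omega>)))"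
        by (rule E)
      also have "\<dots> = expectation (\<lambda>\<omega>. \<Prod>(i, j)\<in>J. q (i, j) (Z i j \<omega>))"
        by (simp add: f_def q_def split_def flip: prod.distrib)
      finally show ?thesis .
    qed
    have vimage_eq: "(\<lambda>(i, j) \<omega>. (A i j \<omega>, Z i j \<omega>)) e -` D e \<inter> space M
      = (case e of (i, j) \<Rightarrow> {\<omega> \<in> space M. A i j \<omega> \<in> B (i, j) \<and> Z i j \<omega> \<in> C (i, j)})"
      if "e \<in> edge_pairs n" for e
      using D[OF that] by (cases e) auto
    have "(\<Inter>e\<in>edge_pairs n. (\<lambda>(i, j) \<omega>. (A i j \<omega>, Z i j \<omega>)) e -` D e \<inter> space M)
      = (\<Inter>(i, j)\<in>edge_pairs n. {\<omega> \<in> space M. A i j \<omega> \<in> B (i, j) \<and> Z i j \<omega> \<in> C (i, j)})"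
      by (rule INF_cong[OF refl vimage_eq])
    then have "prob (\<Inter>e\<in>edge_pairs n. (\<lambda>(i, j) \<omega>. (A i j \<omega>, Z i j \<omega>)) e -` D e \<inter> space M)
      = expectation (\<lambda>\<omega>. \<Prod>e\<in>edge_pairs n. q e ((case e of (i, j) \<Rightarrow> Z i j) \<omega>))"
      using key[OF subset_refl edge_pairs_nonempty[OF n]] by (simp add: split_def)
    also have "\<dots> = (\<Prod>e\<in>edge_pairs n. expectation (\<lambda>\<omega>. q e ((case e of (i, j) \<Rightarrow> Z i j) \<omega>)))"
    proof (rule indep_vars_lebesgue_integral)
      show "indep_vars (\<lambda>_. borel) (\<lambda>e \<omega>. q e ((case e of (i, j) \<Rightarrow> Z i j) \<omega>)) (edge_pairs n)"
        by (rule indep_vars_compose2[OF Z_indep q_meas])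
      show "integrable M (\<lambda>\<omega>. q e ((case e of (i, j) \<Rightarrow> Z i j) \<omega>))" if "e \<in> edge_pairs n" for e
        using that q_bound by (intro integrable_const_bound[of _ 1])
          (auto split: prod.split intro!: measurable_compose[OF Z_measurable q_meas])
    qed simp
    also have "\<dots> = (\<Prod>e\<in>edge_pairs n. prob ((\<lambda>(i, j) \<omega>. (A i j \<omega>, Z i j \<omega>)) e -` D e \<inter> space M))"
    proof (rule prod.cong[OF refl])
      fix e assume e: "e \<in> edge_pairs n"
      show "expectation (\<lambda>\<omega>. q e ((case e of (i, j) \<Rightarrow> Z i j) \<omega>))
        = prob ((\<lambda>(i, j) \<omega>. (A i j \<omega>, Z i j \<omega>)) e -` D e \<inter> space M)"
        unfolding vimage_eq[OF e] using key[of "{e}"] e by (simp add: split_def)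
    qed
    finally show "prob (\<Inter>e\<in>edge_pairs n. (\<lambda>(i, j) \<omega>. (A i j \<omega>, Z i j \<omega>)) e -` D e \<inter> space M)
      = (\<Prod>e\<in>edge_pairs n. prob ((\<lambda>(i, j) \<omega>. (A i j \<omega>, Z i j \<omega>)) e -` D e \<inter> space M))" .
  qed
  then show ?thesis
  \<comment> \<open>Measurable rectangles form an intersection-stable generator of the product
    algebra that contains the whole space.\<close>
  proof (subst indep_vars_finite[where E = "\<lambda>_. G"])
    show "sets (borel \<Otimes>\<^sub>M borel) = sigma_sets (space (borel \<Otimes>\<^sub>M borel)) G"
      by (simp add: sets_pair_measure space_pair_measure G_def)
    show "Int_stable G" unfolding G_def by (rule Int_stable_pair_measure_generator)
    show "space (borel \<Otimes>\<^sub>M borel) \<in> G"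
      by (auto simp: space_pair_measure G_def intro!: exI[of _ UNIV])
    show "G \<subseteq> Pow (space (borel \<Otimes>\<^sub>M borel))"
      by (auto simp: space_pair_measure)
  qed (use n edge_pairs_nonempty in \<open>auto split: prod.split\<close>)
qed

end

section \<open>Concentration of centred fields\<close>

lemma balanced_scale:
  assumes "balanced n u X" "0 \<le> k"
  shows "balanced n (k * u) (\<lambda>i j. k * X i j)"
proof -
  have "\<bar>k * s\<bar> \<le> k * u * N / q" if "\<bar>s\<bar> \<le> u * N / q" for s N q :: real
    using mult_left_mono[OF that assms(2)] assms(2) by (simp add: abs_mult mult.assoc)
  from this[where q = 1] this show ?thesis
    using assms unfolding balanced_def by (auto simp: split_def simp flip: sum_distrib_left)
qed

context edge_model
begin

definition centered_field :: "real \<Rightarrow> (nat \<Rightarrow> nat \<Rightarrow> 'a \<Rightarrow> real) \<Rightarrow> bool" where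
  "centered_field B X \<longleftrightarrow> indep_vars (\<lambda>_. borel) (\<lambda>(i, j). X i j) (edge_pairs n) \<and>
     (\<forall>(i, j)\<in>edge_pairs n. (AE \<omega> in M. \<bar>X i j \<omega>\<bar> \<le> B) \<and> expectation (X i j) = 0)"

lemma centered_fieldI:
  assumes "\<And>i j. (i, j) \<in> edge_pairs n \<Longrightarrow> case_prod (g i j) \<in> borel_measurable (borel \<Otimes>\<^sub>M borel)"
    and "\<And>i j. (i, j) \<in> edge_pairs n \<Longrightarrow> AE \<omega> in M. \<bar>g i j (A i j \<omega>) (Z i j \<omega>)\<bar> \<le> B"
    and "\<And>i j. (i, j) \<in> edge_pairs n \<Longrightarrow> expectation (\<lambda>\<omega>. g i j (A i j \<omega>) (Z i j \<omega>)) = 0"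
  shows "centered_field B (\<lambda>i j \<omega>. g i j (A i j \<omega>) (Z i j \<omega>))"
proof -
  have "indep_vars (\<lambda>_. borel) (\<lambda>e \<omega>. (case e of (i, j) \<Rightarrow> case_prod (g i j))
      ((case e of (i, j) \<Rightarrow> \<lambda>\<omega>. (A i j \<omega>, Z i j \<omega>)) \<omega>)) (edge_pairs n)"
    by (rule indep_vars_compose2[OF indep_pairs]) (use assms(1) in auto)
  also have "(\<lambda>e \<omega>. (case e of (i, j) \<Rightarrow> case_prod (g i j)) ((case e of (i, j) \<Rightarrow> \<lambda>\<omega>. (A i j \<omega>, Z i j \<omega>)) \<omega>))
      = (\<lambda>(i, j) \<omega>. g i j (A i j \<omega>) (Z i j \<omega>))"
    by (auto simp: fun_eq_iff)
  finally show ?thesis using assms(2,3) by (auto simp: centered_field_def)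
qed

lemma centered_field_measurable:
  "centered_field B X \<Longrightarrow> (i, j) \<in> edge_pairs n \<Longrightarrow> X i j \<in> borel_measurable M"
  unfolding centered_field_def indep_vars_def by fastforce

lemma centered_field_sum_tail:
  assumes X: "centered_field B X" and B: "0 < B" and J: "J \<subseteq> edge_pairs n" "J \<noteq> {}" and \<epsilon>: "0 \<le> \<epsilon>"
  shows "prob {\<omega> \<in> space M. \<epsilon> \<le> \<bar>\<Sum>(i, j)\<in>J. X i j \<omega>\<bar>} \<le> 2 * exp (- (\<epsilon>\<^sup>2 / (2 * real (card J) * B\<^sup>2)))"
proof -
  have fin: "finite J" using J finite_edge_pairs finite_subset by blast
  interpret H: Hoeffding_ineq M J "\<lambda>(i, j). X i j" "\<lambda>_. - B" "\<lambda>_. B" "\<Sum>e\<in>J. expectation ((\<lambda>(i, j). X i j) e)"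
  proof unfold_locales
    show "finite J" by (rule fin)
    show "indep_vars (\<lambda>_. borel) (\<lambda>(i, j). X i j) J"
      using X J indep_vars_subset unfolding centered_field_def by blast
    show "AE \<omega> in M. (case e of (i, j) \<Rightarrow> X i j) \<omega> \<in> {- B..B}" if "e \<in> J" for e
    proof -
      have "AE \<omega> in M. \<bar>X (fst e) (snd e) \<omega>\<bar> \<le> B" using X J that unfolding centered_field_def by fastforce
      then show ?thesis by eventually_elim (auto simp: split_def abs_le_iff)
    qed
  qed
  have 0: "(\<Sum>e\<in>J. expectation ((\<lambda>(i, j). X i j) e)) = 0"
    using X J unfolding centered_field_def by (intro sum.neutral) (auto simp: split_def subset_iff)
  have card: "0 < card J" using fin J by (simp add: card_gt_0_iff)
  have "prob {\<omega> \<in> space M. \<epsilon> \<le> \<bar>(\<Sum>e\<in>J. (\<lambda>(i, j). X i j) e \<omega>) - 0\<bar>}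
      \<le> 2 * exp (- 2 * \<epsilon>\<^sup>2 / (\<Sum>e\<in>J. (B - - B)\<^sup>2))"
    using H.Hoeffding_ineq_abs_ge[OF \<epsilon>] B card unfolding 0 by simp
  also have "- 2 * \<epsilon>\<^sup>2 / (\<Sum>e\<in>J. (B - - B)\<^sup>2) = - (\<epsilon>\<^sup>2 / (2 * real (card J) * B\<^sup>2))"
    using B card by (simp add: power2_eq_square field_simps)
  finally show ?thesis by (simp add: split_def)
qed

lemma centered_field_sum_measurable:
  assumes "centered_field B X" "J \<subseteq> edge_pairs n"
  shows "(\<lambda>\<omega>. \<Sum>(i, j)\<in>J. X i j \<omega>) \<in> borel_measurable M"
  using assms by (intro borel_measurable_sum) (auto split: prod.split intro: centered_field_measurable)

text \<open>A union bound over n rows, n columns and the total, each failing with probability at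
  most twice the exponential. An explicit exceptional event is produced so that later bounds can be
  combined by unions.\<close>

lemma centered_field_balanced:
  assumes X: "centered_field B X" and B: "0 < B" and u: "0 < u"
  shows "\<exists>D\<in>events. prob D \<le> (4 * real n + 2) * exp (- (u\<^sup>2 * real (num_pairs n) / (2 * B\<^sup>2))) \<and>
    (\<forall>\<omega>\<in>space M - D. balanced n u (\<lambda>i j. X i j \<omega>))"
proof -
  define N where "N = real (num_pairs n)"
  define q where "q = exp (- (u\<^sup>2 * N / (2 * B\<^sup>2)))"
  define \<epsilon> where "\<epsilon> = u * N / sqrt (real n)"
  define Row where "Row i = Pair i ` ({1..n} - {i})" for i
  define Col where "Col j = (\<lambda>i. (i, j)) ` ({1..n} - {j})" for j
  define T where "T J e = {\<omega> \<in> space M. e \<le> \<bar>\<Sum>(i, j)\<in>J. X i j \<omega>\<bar>}" for J e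
  have N: "0 < N" "N = real n * (real n - 1)"
    using num_pairs_pos[OF n] real_num_pairs[of n] n by (auto simp: N_def)
  have \<epsilon>: "0 \<le> \<epsilon>" "0 \<le> u * N" using u N by (auto simp: \<epsilon>_def)
  have RowE: "Row i \<subseteq> edge_pairs n" if "i \<in> {1..n}" for i
    using that by (auto simp: Row_def edge_pairs_def)
  have ColE: "Col i \<subseteq> edge_pairs n" if "i \<in> {1..n}" for i
    using that by (auto simp: Col_def edge_pairs_def)
  have cardR: "real (card (Row i)) = real n - 1" if "i \<in> {1..n}" for i
    unfolding Row_def using that n by (subst card_image) (auto simp: inj_on_def of_nat_diff)
  have cardC: "real (card (Col i)) = real n - 1" if "i \<in> {1..n}" for i
    unfolding Col_def using that n by (subst card_image) (auto simp: inj_on_def of_nat_diff)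
  have ev: "T J e \<in> events" if "J \<subseteq> edge_pairs n" for J e
  proof -
    note [measurable] = centered_field_sum_measurable[OF X that]
    show ?thesis unfolding T_def by measurable
  qed
  \<comment> \<open>A row has n - 1 terms and N = n (n - 1), so the threshold u N / sqrt n for rows
    and u N for the total have the same exponent.\<close>
  have nd: "\<epsilon>\<^sup>2 / (2 * (real n - 1) * B\<^sup>2) = u\<^sup>2 * N / (2 * B\<^sup>2)"
  proof -
    define d where "d = real n - 1"
    have "0 < d" using n by (simp add: d_def)
    then show ?thesis
      using n B unfolding \<epsilon>_def N(2) d_def[symmetric]
      by (simp add: power_divide power_mult_distrib power2_eq_square)
  qed
  have node: "prob (T J \<epsilon>) \<le> 2 * q" if "J \<subseteq> edge_pairs n" "real (card J) = real n - 1" for J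
  proof -
    have "J \<noteq> {}" using that n by auto
    then show ?thesis
      using centered_field_sum_tail[OF X B that(1) _ \<epsilon>(1)] unfolding that(2) nd T_def q_def by blast
  qed
  have total: "prob (T (edge_pairs n) (u * N)) \<le> 2 * q"
  proof -
    have "(u * N)\<^sup>2 / (2 * N * B\<^sup>2) = u\<^sup>2 * N / (2 * B\<^sup>2)"
      using N(1) by (simp add: power_mult_distrib power2_eq_square)
    then show ?thesis
      using centered_field_sum_tail[OF X B subset_refl edge_pairs_nonempty[OF n] \<epsilon>(2)]
      by (simp add: card_edge_pairs N_def[symmetric] T_def q_def)
  qed
  define D where "D = (\<Union>i\<in>{1..n}. T (Row i) \<epsilon>) \<union> (\<Union>i\<in>{1..n}. T (Col i) \<epsilon>) \<union> T (edge_pairs n) (u * N)"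
  have D: "D \<in> events" unfolding D_def using ev RowE ColE by (intro sets.Un sets.finite_UN) auto
  have "prob (\<Union>i\<in>{1..n}. T (Row i) \<epsilon>) \<le> (\<Sum>i\<in>{1..n}. prob (T (Row i) \<epsilon>))"
    using ev RowE by (intro finite_measure_subadditive_finite) auto
  also have "\<dots> \<le> (\<Sum>i\<in>{1..n}. 2 * q)" using node RowE cardR by (intro sum_mono) auto
  finally have R: "prob (\<Union>i\<in>{1..n}. T (Row i) \<epsilon>) \<le> real n * (2 * q)" by simp
  have "prob (\<Union>i\<in>{1..n}. T (Col i) \<epsilon>) \<le> (\<Sum>i\<in>{1..n}. prob (T (Col i) \<epsilon>))"
    using ev ColE by (intro finite_measure_subadditive_finite) auto
  also have "\<dots> \<le> (\<Sum>i\<in>{1..n}. 2 * q)" using node ColE cardC by (intro sum_mono) auto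
  finally have C: "prob (\<Union>i\<in>{1..n}. T (Col i) \<epsilon>) \<le> real n * (2 * q)" by simp
  have "prob D \<le> prob ((\<Union>i\<in>{1..n}. T (Row i) \<epsilon>) \<union> (\<Union>i\<in>{1..n}. T (Col i) \<epsilon>)) + prob (T (edge_pairs n) (u * N))"
    unfolding D_def using ev RowE ColE
    by (intro measure_Un_le sets.Un sets.finite_UN) auto
  also have "prob ((\<Union>i\<in>{1..n}. T (Row i) \<epsilon>) \<union> (\<Union>i\<in>{1..n}. T (Col i) \<epsilon>))
    \<le> prob (\<Union>i\<in>{1..n}. T (Row i) \<epsilon>) + prob (\<Union>i\<in>{1..n}. T (Col i) \<epsilon>)"
    using ev RowE ColE by (intro measure_Un_le sets.finite_UN) auto
  finally have "prob D \<le> (4 * real n + 2) * q" using R C total by (simp add: algebra_simps)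
  moreover have "balanced n u (\<lambda>i j. X i j \<omega>)" if \<omega>: "\<omega> \<in> space M - D" for \<omega>
  proof -
    have "(\<Sum>(i, j)\<in>Row i. X i j \<omega>) = (\<Sum>j\<in>{1..n} - {i}. X i j \<omega>)" for i
      unfolding Row_def by (subst sum.reindex) (auto simp: inj_on_def)
    moreover have "(\<Sum>(i, j)\<in>Col j. X i j \<omega>) = (\<Sum>i\<in>{1..n} - {j}. X i j \<omega>)" for j
      unfolding Col_def by (subst sum.reindex) (auto simp: inj_on_def)
    ultimately show ?thesis
      using \<omega> unfolding balanced_def D_def T_def \<epsilon>_def N_def by (auto simp: not_le less_imp_le)
  qed
  ultimately show ?thesis using D unfolding q_def N_def by blast
qed

text \<open>Hoeffding sees only the range of the field, Chebyshev its variance, which is far smaller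
  in a sparse network. Covariances vanish by independence, so the sum has variance at most N
  \<sigma>.\<close>

lemma centered_field_chebyshev:
  assumes X: "centered_field B X" and \<sigma>: "\<And>i j. (i, j) \<in> edge_pairs n \<Longrightarrow> expectation (\<lambda>\<omega>. (X i j \<omega>)\<^sup>2) \<le> \<sigma>"
    and v: "0 < v"
  shows "\<exists>D\<in>events. prob D \<le> \<sigma> / (real (num_pairs n) * v\<^sup>2) \<and>
    (\<forall>\<omega>\<in>space M - D. \<bar>pair_avg n (\<lambda>i j. X i j \<omega>)\<bar> \<le> v)"
proof -
  define N where "N = real (num_pairs n)"
  have N: "0 < N" using num_pairs_pos[OF n] by (simp add: N_def)
  define Y where "Y = (\<lambda>e. X (fst e) (snd e))"
  have Y_meas [measurable]: "Y e \<in> borel_measurable M" if "e \<in> edge_pairs n" for e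
    using centered_field_measurable[OF X, of "fst e" "snd e"] that by (simp add: Y_def)
  have Y_bound: "AE \<omega> in M. \<bar>Y e \<omega>\<bar> \<le> B" and Y_mean: "expectation (Y e) = 0" if "e \<in> edge_pairs n" for e
    using X that unfolding centered_field_def Y_def by fastforce+
  have Y_indep: "indep_vars (\<lambda>_. borel) Y (edge_pairs n)"
  proof -
    have "Y = (\<lambda>(i, j). X i j)" by (auto simp: Y_def fun_eq_iff)
    then show ?thesis using X by (simp add: centered_field_def)
  qed
  have Y_int: "integrable M (Y e)" if "e \<in> edge_pairs n" for e
    using Y_bound[OF that] Y_meas[OF that] by (intro integrable_const_bound[of _ B]) auto
  have YY_int: "integrable M (\<lambda>\<omega>. Y e \<omega> * Y f \<omega>)" if "e \<in> edge_pairs n" "f \<in> edge_pairs n" for e f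
  proof (rule integrable_const_bound[of _ "B * B"])
    show "AE \<omega> in M. norm (Y e \<omega> * Y f \<omega>) \<le> B * B"
      using Y_bound[OF that(1)] Y_bound[OF that(2)]
    proof eventually_elim
      case (elim \<omega>)
      then show ?case unfolding real_norm_def abs_mult by (intro mult_mono) auto
    qed
  qed (use Y_meas that in measurable)
  have cross: "expectation (\<lambda>\<omega>. Y e \<omega> * Y f \<omega>) = 0" if "e \<in> edge_pairs n" "f \<in> edge_pairs n" "e \<noteq> f" for e f
  proof -
    have "indep_vars (\<lambda>_. borel) Y {e, f}" using Y_indep that by (auto intro: indep_vars_subset)
    then have "expectation (\<lambda>\<omega>. \<Prod>i\<in>{e, f}. Y i \<omega>) = (\<Prod>i\<in>{e, f}. expectation (Y i))"
      using that Y_int by (intro indep_vars_lebesgue_integral) auto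
    then show ?thesis using that Y_mean by simp
  qed
  define S where "S \<omega> = (\<Sum>e\<in>edge_pairs n. Y e \<omega>)" for \<omega>
  have S_meas: "S \<in> borel_measurable M" unfolding S_def by measurable
  have S_sq: "(S \<omega>)\<^sup>2 = (\<Sum>e\<in>edge_pairs n. \<Sum>f\<in>edge_pairs n. Y e \<omega> * Y f \<omega>)" for \<omega>
    by (simp add: S_def power2_eq_square sum_product)
  have S_int: "integrable M (\<lambda>\<omega>. (S \<omega>)\<^sup>2)"
    unfolding S_sq using YY_int by (intro Bochner_Integration.integrable_sum) auto
  have S_mean: "expectation S = 0"
    unfolding S_def using Y_int Y_mean by (subst Bochner_Integration.integral_sum) auto
  have "expectation (\<lambda>\<omega>. (S \<omega>)\<^sup>2)
      = (\<Sum>e\<in>edge_pairs n. \<Sum>f\<in>edge_pairs n. expectation (\<lambda>\<omega>. Y e \<omega> * Y f \<omega>))"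
    unfolding S_sq using YY_int by (simp add: Bochner_Integration.integral_sum)
  also have "\<dots> = (\<Sum>e\<in>edge_pairs n. expectation (\<lambda>\<omega>. Y e \<omega> * Y e \<omega>))"
  proof (rule sum.cong[OF refl])
    fix e assume e: "e \<in> edge_pairs n"
    have "(\<Sum>f\<in>edge_pairs n. expectation (\<lambda>\<omega>. Y e \<omega> * Y f \<omega>))
      = (\<Sum>f\<in>edge_pairs n. if f = e then expectation (\<lambda>\<omega>. Y e \<omega> * Y e \<omega>) else 0)"
      using cross e by (intro sum.cong) auto
    then show "(\<Sum>f\<in>edge_pairs n. expectation (\<lambda>\<omega>. Y e \<omega> * Y f \<omega>)) = expectation (\<lambda>\<omega>. Y e \<omega> * Y e \<omega>)"
      using e by simp
  qed
  also have "\<dots> \<le> (\<Sum>e\<in>edge_pairs n. \<sigma>)"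
    using \<sigma> by (intro sum_mono) (auto simp: Y_def power2_eq_square)
  finally have var: "expectation (\<lambda>\<omega>. (S \<omega>)\<^sup>2) \<le> N * \<sigma>" by (simp add: N_def card_edge_pairs)
  define D where "D = {\<omega> \<in> space M. N * v \<le> \<bar>S \<omega>\<bar>}"
  have D: "D \<in> events" unfolding D_def using S_meas by measurable
  have "prob {\<omega> \<in> space M. N * v \<le> \<bar>S \<omega> - expectation S\<bar>} \<le> variance S / (N * v)\<^sup>2"
    by (rule Chebyshev_inequality[OF S_meas S_int]) (use N v in simp)
  then have "prob D \<le> expectation (\<lambda>\<omega>. (S \<omega>)\<^sup>2) / (N * v)\<^sup>2"
    by (simp add: S_mean D_def)
  also have "\<dots> \<le> (N * \<sigma>) / (N * v)\<^sup>2" using var by (intro divide_right_mono) auto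
  also have "\<dots> = \<sigma> / (N * v\<^sup>2)" using N by (simp add: power_mult_distrib power2_eq_square)
  finally have "prob D \<le> \<sigma> / (N * v\<^sup>2)" .
  moreover have "\<bar>pair_avg n (\<lambda>i j. X i j \<omega>)\<bar> \<le> v" if "\<omega> \<in> space M - D" for \<omega>
  proof -
    have "\<bar>S \<omega>\<bar> \<le> N * v" using that by (auto simp: D_def)
    moreover have "pair_avg n (\<lambda>i j. X i j \<omega>) = S \<omega> / N"
      by (simp add: pair_avg_def S_def Y_def N_def split_def)
    ultimately show ?thesis using N by (simp add: abs_divide pos_divide_le_eq mult.commute)
  qed
  ultimately show ?thesis using D unfolding N_def by blast
qed

section \<open>Centred fields built from covariates and noise\<close>

lemma Z_bounded_all:
  "(i, j) \<in> edge_pairs n \<Longrightarrow> AE \<omega> in M. \<forall>k. \<bar>Z i j \<omega> $ k\<bar> \<le> c"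
  using AE_finite_allI[of UNIV "\<lambda>k \<omega>. \<bar>Z i j \<omega> $ k\<bar> \<le> c" M] Z_bounded by simp

lemma Z_integrable:
  assumes "(i, j) \<in> edge_pairs n" shows "integrable M (Z i j)"
proof (rule integrable_const_bound[of _ "real CARD('p) * c"])
  show "AE \<omega> in M. norm (Z i j \<omega>) \<le> real CARD('p) * c"
    using Z_bounded_all[OF assms]
  proof eventually_elim
    case (elim \<omega>)
    have "norm (Z i j \<omega>) \<le> (\<Sum>k\<in>UNIV. \<bar>Z i j \<omega> $ k\<bar>)" by (rule norm_le_l1_cart)
    also have "\<dots> \<le> (\<Sum>k\<in>(UNIV :: 'p set). c)" using elim by (intro sum_mono) auto
    finally show ?case by simp
  qed
qed (use assms in measurable)

lemma nth_borel_measurable [measurable]: "(\<lambda>v :: real ^ 'p. v $ k) \<in> borel_measurable borel"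
  by (intro borel_measurable_continuous_onI continuous_intros)

lemma Z_nth_centered:
  assumes "(i, j) \<in> edge_pairs n" shows "expectation (\<lambda>\<omega>. Z i j \<omega> $ k) = 0"
  using integral_bounded_linear[OF bounded_linear_vec_nth Z_integrable[OF assms], of k] Z_centered[OF assms]
  by simp

definition second_moment :: "nat \<Rightarrow> nat \<Rightarrow> 'p \<Rightarrow> 'p \<Rightarrow> real" where
  "second_moment i j k l = expectation (\<lambda>\<omega>. Z i j \<omega> $ k * Z i j \<omega> $ l)"

lemma Z_prod_bound:
  assumes "(i, j) \<in> edge_pairs n"
  shows "AE \<omega> in M. \<bar>Z i j \<omega> $ k * Z i j \<omega> $ l\<bar> \<le> c * c"
  using Z_bounded_all[OF assms]
proof eventually_elim
  case (elim \<omega>)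
  then show ?case unfolding abs_mult by (intro mult_mono) (auto intro: order_trans[OF abs_ge_zero])
qed

lemma Z_prod_integrable:
  assumes "(i, j) \<in> edge_pairs n"
  shows "integrable M (\<lambda>\<omega>. Z i j \<omega> $ k * Z i j \<omega> $ l)"
proof (rule integrable_const_bound[of _ "c * c"])
  note [measurable] = Z_measurable[OF assms]
  show "(\<lambda>\<omega>. Z i j \<omega> $ k * Z i j \<omega> $ l) \<in> borel_measurable M" by measurable
qed (use Z_prod_bound[OF assms] in simp)

lemma abs_second_moment_le:
  assumes "(i, j) \<in> edge_pairs n" shows "\<bar>second_moment i j k l\<bar> \<le> c * c"
proof -
  have "\<bar>second_moment i j k l\<bar> \<le> expectation (\<lambda>\<omega>. \<bar>Z i j \<omega> $ k * Z i j \<omega> $ l\<bar>)"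
    unfolding second_moment_def by (rule integral_abs_bound)
  also have "\<dots> \<le> expectation (\<lambda>\<omega>. c * c)"
    using Z_prod_integrable[OF assms] Z_prod_bound[OF assms]
    by (intro integral_mono_AE integrable_abs) auto
  finally show ?thesis by (simp add: prob_space)
qed

lemma quad_form_second_moment:
  assumes "(i, j) \<in> edge_pairs n"
  shows "quad_form (second_moment i j) g = expectation (\<lambda>\<omega>. (g \<bullet> Z i j \<omega>)\<^sup>2)"
  unfolding inner_square_quad_form quad_form_def second_moment_def
  using Z_prod_integrable[OF assms] by (simp add: Bochner_Integration.integral_sum)

definition noise :: "nat \<Rightarrow> nat \<Rightarrow> 'a \<Rightarrow> real" where
  "noise i j \<omega> = A i j \<omega> - link i j (Z i j \<omega>)"

lemma abs_noise_le:
  assumes "(i, j) \<in> edge_pairs n" "\<omega> \<in> space M" shows "\<bar>noise i j \<omega>\<bar> \<le> 1"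
  using adjacency[OF assms] link_bounds[of i j "Z i j \<omega>"] by (auto simp: noise_def)

lemma expectation_noise_mult:
  assumes ij: "(i, j) \<in> edge_pairs n" and f: "f \<in> borel_measurable borel"
    and bound: "AE \<omega> in M. \<bar>f (Z i j \<omega>)\<bar> \<le> K"
  shows "integrable M (\<lambda>\<omega>. noise i j \<omega> * f (Z i j \<omega>))"
    and "expectation (\<lambda>\<omega>. noise i j \<omega> * f (Z i j \<omega>)) = 0"
proof -
  note [measurable] = Z_measurable[OF ij] A_measurable[OF ij] f
  have 1: "integrable M (\<lambda>\<omega>. A i j \<omega> * f (Z i j \<omega>))"
  proof (rule integrable_const_bound[of _ K])
    show "AE \<omega> in M. norm (A i j \<omega> * f (Z i j \<omega>)) \<le> K"
      using bound AE_space
    proof eventually_elim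
      case (elim \<omega>)
      then show ?case using adjacency[OF ij elim(2)] by auto
    qed
  qed measurable
  have 2: "integrable M (\<lambda>\<omega>. link i j (Z i j \<omega>) * f (Z i j \<omega>))"
  proof (rule integrable_const_bound[of _ K])
    show "AE \<omega> in M. norm (link i j (Z i j \<omega>) * f (Z i j \<omega>)) \<le> K"
      using bound
    proof eventually_elim
      case (elim \<omega>)
      have "norm (link i j (Z i j \<omega>) * f (Z i j \<omega>)) \<le> 1 * \<bar>f (Z i j \<omega>)\<bar>"
        unfolding real_norm_def abs_mult using link_bounds[of i j "Z i j \<omega>"] by (intro mult_right_mono) auto
      then show ?case using elim by simp
    qed
  qed measurable
  have eq: "noise i j \<omega> * f (Z i j \<omega>) = A i j \<omega> * f (Z i j \<omega>) - link i j (Z i j \<omega>) * f (Z i j \<omega>)" for \<omega>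
    by (simp add: noise_def left_diff_distrib)
  show "integrable M (\<lambda>\<omega>. noise i j \<omega> * f (Z i j \<omega>))" unfolding eq using 1 2 by simp
  show "expectation (\<lambda>\<omega>. noise i j \<omega> * f (Z i j \<omega>)) = 0"
    unfolding eq using 1 2 expectation_edge[OF ij f bound] by simp
qed

lemma case_prod_measurable_edge:
  assumes [measurable]: "f \<in> borel_measurable borel"
  shows "(\<lambda>(a :: real, v :: real ^ 'p). (a - link i j v) * f v) \<in> borel_measurable (borel \<Otimes>\<^sub>M borel)"
  unfolding split_def by measurable

lemma centered_field_noise_mult:
  assumes f: "f \<in> borel_measurable borel"
    and bound: "\<And>i j. (i, j) \<in> edge_pairs n \<Longrightarrow> AE \<omega> in M. \<bar>f (Z i j \<omega>)\<bar> \<le> c"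
  shows "centered_field c (\<lambda>i j \<omega>. noise i j \<omega> * f (Z i j \<omega>))"
  unfolding noise_def
proof (rule centered_fieldI[where g = "\<lambda>i j a v. (a - link i j v) * f v"])
  fix i j assume ij: "(i, j) \<in> edge_pairs n"
  show "(\<lambda>(a, v). (a - link i j v) * f v) \<in> borel_measurable (borel \<Otimes>\<^sub>M borel)"
    by (rule case_prod_measurable_edge[OF f])
  show "expectation (\<lambda>\<omega>. (A i j \<omega> - link i j (Z i j \<omega>)) * f (Z i j \<omega>)) = 0"
    using expectation_noise_mult(2)[OF ij f bound[OF ij]] by (simp add: noise_def)
  show "AE \<omega> in M. \<bar>(A i j \<omega> - link i j (Z i j \<omega>)) * f (Z i j \<omega>)\<bar> \<le> c"
    using bound[OF ij] AE_space
  proof eventually_elim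
    case (elim \<omega>)
    have "\<bar>noise i j \<omega> * f (Z i j \<omega>)\<bar> \<le> 1 * \<bar>f (Z i j \<omega>)\<bar>"
      unfolding abs_mult using abs_noise_le[OF ij elim(2)] by (intro mult_right_mono) auto
    then show ?case using elim by (simp add: noise_def)
  qed
qed

lemma centered_field_noise: "centered_field c noise"
  using centered_field_noise_mult[of "\<lambda>_. 1"] c_ge_1 by simp

lemma centered_field_noise_covariate: "centered_field c (\<lambda>i j \<omega>. noise i j \<omega> * Z i j \<omega> $ k)"
  using Z_bounded by (intro centered_field_noise_mult) auto

lemma centered_field_covariate:
  assumes "\<And>i j. 0 \<le> w i j \<and> w i j \<le> 1"
  shows "centered_field c (\<lambda>i j \<omega>. w i j * Z i j \<omega> $ k)"
proof (rule centered_fieldI[where g = "\<lambda>i j a v. w i j * v $ k"])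
  fix i j assume ij: "(i, j) \<in> edge_pairs n"
  show "(\<lambda>(a :: real, v :: real ^ 'p). w i j * v $ k) \<in> borel_measurable (borel \<Otimes>\<^sub>M borel)"
    unfolding split_def by measurable
  show "expectation (\<lambda>\<omega>. w i j * Z i j \<omega> $ k) = 0" using Z_nth_centered[OF ij] by simp
  show "AE \<omega> in M. \<bar>w i j * Z i j \<omega> $ k\<bar> \<le> c"
    using Z_bounded[OF ij, of k]
  proof eventually_elim
    case (elim \<omega>)
    have "\<bar>w i j * Z i j \<omega> $ k\<bar> \<le> 1 * \<bar>Z i j \<omega> $ k\<bar>"
      unfolding abs_mult using assms[of i j] by (intro mult_right_mono) auto
    then show ?case using elim by simp
  qed
qed

text \<open>A centred product of covariates is bounded by 2 c^2. Dividing by 2 c gives the common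
  range c; undoing the scaling turns level u into 2 c u.\<close>

lemma centered_field_gram:
  assumes w: "\<And>i j. 0 \<le> w i j \<and> w i j \<le> 1"
  shows "centered_field c (\<lambda>i j \<omega>. 1 / (2 * c) * (w i j * (Z i j \<omega> $ k * Z i j \<omega> $ l - second_moment i j k l)))"
proof (rule centered_fieldI[where g = "\<lambda>i j a v. 1 / (2 * c) * (w i j * (v $ k * v $ l - second_moment i j k l))"])
  fix i j assume ij: "(i, j) \<in> edge_pairs n"
  show "(\<lambda>(a :: real, v :: real ^ 'p). 1 / (2 * c) * (w i j * (v $ k * v $ l - second_moment i j k l)))
      \<in> borel_measurable (borel \<Otimes>\<^sub>M borel)"
    unfolding split_def by measurable
  have "expectation (\<lambda>\<omega>. Z i j \<omega> $ k * Z i j \<omega> $ l - second_moment i j k l) = 0"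
    using Z_prod_integrable[OF ij] by (simp add: second_moment_def prob_space)
  then show "expectation (\<lambda>\<omega>. 1 / (2 * c) * (w i j * (Z i j \<omega> $ k * Z i j \<omega> $ l - second_moment i j k l))) = 0"
    by simp
  show "AE \<omega> in M. \<bar>1 / (2 * c) * (w i j * (Z i j \<omega> $ k * Z i j \<omega> $ l - second_moment i j k l))\<bar> \<le> c"
    using Z_prod_bound[OF ij, of k l]
  proof eventually_elim
    case (elim \<omega>)
    define d where "d = Z i j \<omega> $ k * Z i j \<omega> $ l - second_moment i j k l"
    have d: "\<bar>d\<bar> \<le> 2 * (c * c)"
      using elim abs_second_moment_le[OF ij, of k l] unfolding d_def by linarith
    have "\<bar>1 / (2 * c) * (w i j * d)\<bar> = 1 / (2 * c) * (w i j * \<bar>d\<bar>)"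
      using c_ge_1 w[of i j] by (simp add: abs_mult)
    also have "\<dots> \<le> 1 / (2 * c) * (1 * (2 * (c * c)))"
      using c_ge_1 w[of i j] d by (intro mult_left_mono mult_mono) auto
    also have "\<dots> = c" using c_ge_1 by simp
    finally show ?case by (simp add: d_def)
  qed
qed

end

section \<open>Population risk\<close>

text \<open>A minimiser of the Rayleigh quotient on the unit sphere exists by compactness and is an
  eigenvector, so its value is an eigenvalue and hence at least l.\<close>

lemma symmetric_quad_ge_eigenvalue:
  fixes S :: "real ^ 'm ^ 'm"
  assumes sym: "transpose S = S" and ev: "\<And>e. e \<in> eigenvalues S \<Longrightarrow> l \<le> e"
  shows "l * (norm v)\<^sup>2 \<le> v \<bullet> (S *v v)"
proof -
  have self_adjoint: "x \<bullet> (S *v y) = (S *v x) \<bullet> y" for x y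
    using dot_lmul_matrix[of x S y] by (metis sym transpose_matrix_vector)
  have cont: "continuous_on (sphere 0 1) (\<lambda>x. x \<bullet> (S *v x))"
    by (intro continuous_intros matrix_vector_mult_linear_continuous_on)
  have "sphere (0 :: real ^ 'm) 1 \<noteq> {}"
    by (metis ex_in_conv mem_sphere_0 vector_choose_size zero_le_one)
  then obtain x where x: "norm x = 1" and min: "\<And>y. norm y = 1 \<Longrightarrow> x \<bullet> (S *v x) \<le> y \<bullet> (S *v y)"
    using continuous_attains_inf[OF compact_sphere _ cont] by (auto simp: sphere_def dist_norm)
  define e where "e = x \<bullet> (S *v x)"
  have ge: "e * (norm y)\<^sup>2 \<le> y \<bullet> (S *v y)" for y
  proof (cases "y = 0")
    case False
    define t where "t = norm y"
    have t: "0 < t" using False by (simp add: t_def)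
    have "norm ((1 / t) *\<^sub>R y) = 1" using t by (simp add: t_def)
    from min[OF this] have "e \<le> (1 / t) * ((1 / t) * (y \<bullet> (S *v y)))"
      by (simp add: e_def matrix_vector_mult_scaleR)
    then show ?thesis using t by (simp add: t_def[symmetric] field_simps power2_eq_square)
  qed simp
  define w where "w = S *v x - e *\<^sub>R x"
  define q where "q = w \<bullet> (S *v w) - e * (norm w)\<^sup>2"
  have xw: "x \<bullet> (S *v w) - e * (x \<bullet> w) = (norm w)\<^sup>2"
  proof -
    have "x \<bullet> (S *v w) = (S *v x) \<bullet> w" by (rule self_adjoint)
    then show ?thesis by (simp add: w_def dot_square_norm[symmetric] inner_diff_left)
  qed
  \<comment> \<open>First-order optimality: moving x in the direction of the residual w cannot make
    the form fall below e times the squared norm.\<close>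
  have pert: "0 \<le> 2 * t * (norm w)\<^sup>2 + t\<^sup>2 * q" for t
  proof -
    have "0 \<le> (x + t *\<^sub>R w) \<bullet> (S *v (x + t *\<^sub>R w)) - e * (norm (x + t *\<^sub>R w))\<^sup>2"
      using ge[of "x + t *\<^sub>R w"] by simp
    also have "(norm (x + t *\<^sub>R w))\<^sup>2 = 1 + 2 * t * (x \<bullet> w) + t\<^sup>2 * (norm w)\<^sup>2"
    proof -
      have "x \<bullet> x = 1" using x power2_norm_eq_inner[of x] by simp
      then show ?thesis
        unfolding power2_norm_eq_inner
        by (simp add: inner_add_left inner_add_right inner_commute power2_eq_square algebra_simps)
    qed
    also have "(x + t *\<^sub>R w) \<bullet> (S *v (x + t *\<^sub>R w)) = e + 2 * t * (x \<bullet> (S *v w)) + t\<^sup>2 * (w \<bullet> (S *v w))"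
      using self_adjoint[of w x]
      by (simp add: matrix_vector_right_distrib matrix_vector_mult_scaleR inner_add_left inner_add_right
          e_def power2_eq_square inner_commute algebra_simps)
    also have "e + 2 * t * (x \<bullet> (S *v w)) + t\<^sup>2 * (w \<bullet> (S *v w)) - e * (1 + 2 * t * (x \<bullet> w) + t\<^sup>2 * (norm w)\<^sup>2)
      = 2 * t * (x \<bullet> (S *v w) - e * (x \<bullet> w)) + t\<^sup>2 * q"
      by (simp add: q_def algebra_simps)
    finally show ?thesis by (simp add: xw)
  qed
  have "w = 0"
  proof (rule ccontr)
    assume "w \<noteq> 0"
    define a where "a = (norm w)\<^sup>2"
    have a: "0 < a" using \<open>w \<noteq> 0\<close> by (simp add: a_def)
    \<comment> \<open>Small enough that t |q| \<le> a, while the perturbation by - t demands 2 a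
      \<le> t q.\<close>
    define t where "t = a / (1 + \<bar>q\<bar>)"
    have t: "0 < t" using a by (simp add: t_def add_pos_nonneg)
    have "t * \<bar>q\<bar> \<le> t * (1 + \<bar>q\<bar>)" using t by (intro mult_left_mono) auto
    also have "\<dots> = a" by (simp add: t_def)
    finally have tq: "t * \<bar>q\<bar> \<le> a" .
    have "0 \<le> t * (t * q - 2 * a)" using pert[of "- t"] by (simp add: a_def power2_eq_square algebra_simps)
    then have "2 * a \<le> t * q" using t by (simp add: zero_le_mult_iff)
    also have "\<dots> \<le> t * \<bar>q\<bar>" using t by (intro mult_left_mono) auto
    finally show False using tq a by simp
  qed
  then have "e \<in> eigenvalues S"
    using x unfolding eigenvalues_def w_def by (auto intro!: exI[of _ x])
  then have "l * (norm v)\<^sup>2 \<le> e * (norm v)\<^sup>2" using ev by (intro mult_right_mono) auto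
  then show ?thesis using ge[of v] by linarith
qed

context edge_model
begin

lemma pair_avg_second_moment:
  "pair_avg n (\<lambda>i j. second_moment i j k l) = gram_matrix n M Z $ k $ l"
proof -
  have "expectation (\<lambda>\<omega>. \<Sum>e\<in>edge_pairs n. Z (fst e) (snd e) \<omega> $ k * Z (fst e) (snd e) \<omega> $ l)
    = (\<Sum>e\<in>edge_pairs n. second_moment (fst e) (snd e) k l)"
    unfolding second_moment_def using Z_prod_integrable by (subst Bochner_Integration.integral_sum) auto
  then show ?thesis by (simp add: pair_avg_def gram_matrix_def split_def)
qed

lemma pair_avg_second_moment_ge:
  assumes "\<And>e. e \<in> eigenvalues (gram_matrix n M Z) \<Longrightarrow> l \<le> e"
  shows "l * (norm g)\<^sup>2 \<le> pair_avg n (\<lambda>i j. quad_form (second_moment i j) g)"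
proof -
  have "transpose (gram_matrix n M Z) = gram_matrix n M Z"
    by (simp add: transpose_def gram_matrix_def vec_eq_iff mult.commute)
  from symmetric_quad_ge_eigenvalue[OF this assms, of g]
  have "l * (norm g)\<^sup>2 \<le> g \<bullet> (gram_matrix n M Z *v g)" .
  also have "\<dots> = quad_form (\<lambda>k l. gram_matrix n M Z $ k $ l) g"
    by (simp add: inner_vec_def matrix_vector_mult_def quad_form_def sum_distrib_left mult_ac)
  also have "\<dots> = pair_avg n (\<lambda>i j. 1 * quad_form (second_moment i j) g)"
    unfolding pair_avg_quad_form by (simp add: pair_avg_second_moment)
  finally show ?thesis by simp
qed

lemma second_moment_nonneg: "(i, j) \<in> edge_pairs n \<Longrightarrow> 0 \<le> quad_form (second_moment i j) g"
  by (simp add: quad_form_second_moment)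

section \<open>Exceptional events\<close>

lemma event_INT:
  assumes "finite I" "\<And>i. i \<in> I \<Longrightarrow> \<exists>D\<in>events. prob D \<le> q \<and> (\<forall>\<omega>\<in>space M - D. P i \<omega>)"
  shows "\<exists>D\<in>events. prob D \<le> real (card I) * q \<and> (\<forall>\<omega>\<in>space M - D. \<forall>i\<in>I. P i \<omega>)"
proof -
  from assms(2) obtain D where D: "\<And>i. i \<in> I \<Longrightarrow> D i \<in> events" "\<And>i. i \<in> I \<Longrightarrow> prob (D i) \<le> q"
    "\<And>i \<omega>. i \<in> I \<Longrightarrow> \<omega> \<in> space M - D i \<Longrightarrow> P i \<omega>"
    by metis
  have "prob (\<Union>i\<in>I. D i) \<le> (\<Sum>i\<in>I. prob (D i))"
    using D assms(1) by (intro finite_measure_subadditive_finite) auto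
  also have "\<dots> \<le> (\<Sum>i\<in>I. q)" using D by (intro sum_mono) auto
  finally have "prob (\<Union>i\<in>I. D i) \<le> real (card I) * q" by simp
  moreover have "(\<Union>i\<in>I. D i) \<in> events" using D assms(1) by (intro sets.finite_UN) auto
  ultimately show ?thesis using D(3) by (intro bexI[of _ "\<Union>i\<in>I. D i"]) auto
qed

lemma event_conj:
  assumes "\<exists>D\<in>events. prob D \<le> q \<and> (\<forall>\<omega>\<in>space M - D. P \<omega>)"
    and "\<exists>D\<in>events. prob D \<le> r \<and> (\<forall>\<omega>\<in>space M - D. Q \<omega>)"
  shows "\<exists>D\<in>events. prob D \<le> q + r \<and> (\<forall>\<omega>\<in>space M - D. P \<omega> \<and> Q \<omega>)"
proof -
  from assms obtain D E where D: "D \<in> events" "prob D \<le> q" "\<forall>\<omega>\<in>space M - D. P \<omega>"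
    and E: "E \<in> events" "prob E \<le> r" "\<forall>\<omega>\<in>space M - E. Q \<omega>" by blast
  have "prob (D \<union> E) \<le> q + r" using measure_Un_le[OF D(1) E(1)] D(2) E(2) by linarith
  then show ?thesis using D E by (intro bexI[of _ "D \<union> E"]) auto
qed

text \<open>The four families serve, in order, the intercept and node part of the score, its
  covariate part, the cross term of the weighted square and its second moments.\<close>

definition all_balanced :: "real \<Rightarrow> (nat \<Rightarrow> nat \<Rightarrow> real) \<Rightarrow> 'a \<Rightarrow> bool" where
  "all_balanced u w \<omega> \<longleftrightarrow> balanced n u (\<lambda>i j. noise i j \<omega>) \<and>
     (\<forall>k. balanced n u (\<lambda>i j. noise i j \<omega> * Z i j \<omega> $ k)) \<and>
     (\<forall>k. balanced n u (\<lambda>i j. w i j * Z i j \<omega> $ k)) \<and>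
     (\<forall>k l. balanced n (2 * c * u) (\<lambda>i j. w i j * (Z i j \<omega> $ k * Z i j \<omega> $ l - second_moment i j k l)))"

lemma all_balanced_event:
  assumes w: "\<And>i j. 0 \<le> w i j \<and> w i j \<le> 1" and u: "0 < u"
  shows "\<exists>D\<in>events. prob D \<le> (1 + real CARD('p))\<^sup>2 * ((4 * real n + 2) * exp (- (u\<^sup>2 * real (num_pairs n) / (2 * c\<^sup>2))))
    \<and> (\<forall>\<omega>\<in>space M - D. all_balanced u w \<omega>)"
proof -
  define q where "q = (4 * real n + 2) * exp (- (u\<^sup>2 * real (num_pairs n) / (2 * c\<^sup>2)))"
  have c: "0 < c" using c_ge_1 by simp
  have 1: "\<exists>D\<in>events. prob D \<le> q \<and> (\<forall>\<omega>\<in>space M - D. balanced n u (\<lambda>i j. noise i j \<omega>))"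
    unfolding q_def by (rule centered_field_balanced[OF centered_field_noise c u])
  have step1: "\<exists>D\<in>events. prob D \<le> q \<and> (\<forall>\<omega>\<in>space M - D. balanced n u (\<lambda>i j. noise i j \<omega> * Z i j \<omega> $ k))" for k
    unfolding q_def by (rule centered_field_balanced[OF centered_field_noise_covariate c u])
  have 2: "\<exists>D\<in>events. prob D \<le> real CARD('p) * q
     \<and> (\<forall>\<omega>\<in>space M - D. \<forall>k\<in>UNIV. balanced n u (\<lambda>i j. noise i j \<omega> * Z i j \<omega> $ k))"
    by (rule event_INT[OF finite step1])
  have step2: "\<exists>D\<in>events. prob D \<le> q \<and> (\<forall>\<omega>\<in>space M - D. balanced n u (\<lambda>i j. w i j * Z i j \<omega> $ k))" for k
    unfolding q_def by (rule centered_field_balanced[OF centered_field_covariate[OF w] c u])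
  have 3: "\<exists>D\<in>events. prob D \<le> real CARD('p) * q
     \<and> (\<forall>\<omega>\<in>space M - D. \<forall>k\<in>UNIV. balanced n u (\<lambda>i j. w i j * Z i j \<omega> $ k))"
    by (rule event_INT[OF finite step2])
  have step3: "\<exists>D\<in>events. prob D \<le> q \<and> (\<forall>\<omega>\<in>space M - D. balanced n (2 * c * u)
     (\<lambda>i j. w i j * (Z i j \<omega> $ k * Z i j \<omega> $ l - second_moment i j k l)))" for k l
  proof -
    have gram: "centered_field c (\<lambda>i j \<omega>. 1 / (2 * c) *
        (w i j * (Z i j \<omega> $ k * Z i j \<omega> $ l - second_moment i j k l)))"
      by (rule centered_field_gram[OF w])
    from centered_field_balanced[OF gram c u, folded q_def]
    obtain D where D: "D \<in> events" "prob D \<le> q" "\<forall>\<omega>\<in>space M - D.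
      balanced n u (\<lambda>i j. 1 / (2 * c) * (w i j * (Z i j \<omega> $ k * Z i j \<omega> $ l - second_moment i j k l)))"
      by (elim bexE conjE) (rule that)
    have "balanced n (2 * c * u) (\<lambda>i j. w i j * (Z i j \<omega> $ k * Z i j \<omega> $ l - second_moment i j k l))"
      if "\<omega> \<in> space M - D" for \<omega>
      using balanced_scale[OF D(3)[rule_format, OF that], of "2 * c"] c by simp
    then show ?thesis using D(1,2) by (intro bexI[of _ D] conjI ballI)
  qed
  have step4: "\<exists>D\<in>events. prob D \<le> real CARD('p) * q \<and> (\<forall>\<omega>\<in>space M - D. \<forall>l\<in>UNIV. balanced n (2 * c * u)
     (\<lambda>i j. w i j * (Z i j \<omega> $ k * Z i j \<omega> $ l - second_moment i j k l)))" for k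
    by (rule event_INT[OF finite step3])
  have 4: "\<exists>D\<in>events. prob D \<le> real CARD('p) * (real CARD('p) * q) \<and> (\<forall>\<omega>\<in>space M - D. \<forall>k\<in>UNIV. \<forall>l\<in>UNIV.
     balanced n (2 * c * u) (\<lambda>i j. w i j * (Z i j \<omega> $ k * Z i j \<omega> $ l - second_moment i j k l)))"
    by (rule event_INT[OF finite step4])
  \<comment> \<open>There are 1 + p + p + p^2 fields, and each fails with probability at most
    q.\<close>
  have "q + (real CARD('p) * q + (real CARD('p) * q + real CARD('p) * (real CARD('p) * q)))
     = (1 + real CARD('p))\<^sup>2 * q"
    by (simp add: power2_eq_square algebra_simps)
  note eq = this
  from event_conj[OF 1 event_conj[OF 2 event_conj[OF 3 4]]]
  have "\<exists>D\<in>events. prob D \<le> (1 + real CARD('p))\<^sup>2 * q \<and> (\<forall>\<omega>\<in>space M - D. all_balanced u w \<omega>)"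
    unfolding eq all_balanced_def ball_UNIV .
  then show ?thesis unfolding q_def .
qed

text \<open>For an edge in {0, 1} with conditional mean P, the squared noise equals noise * (1 - 2
  P) + P * (1 - P). The first term has mean 0 and the second is the Bernoulli variance.\<close>

lemma expectation_noise_square:
  assumes ij: "(i, j) \<in> edge_pairs n"
    and \<sigma>: "AE \<omega> in M. logistic_var (true_pred i j \<omega>) \<le> \<sigma>"
  shows "expectation (\<lambda>\<omega>. (noise i j \<omega>)\<^sup>2) \<le> \<sigma>"
proof -
  note [measurable] = Z_measurable[OF ij] A_measurable[OF ij]
  have f: "(\<lambda>v. 1 - 2 * link i j v) \<in> borel_measurable borel" by measurable
  have bound: "AE \<omega> in M. \<bar>1 - 2 * link i j (Z i j \<omega>)\<bar> \<le> 1"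
    using link_bounds[of i j] by (intro AE_I2) (auto simp: abs_le_iff less_imp_le)
  have lv: "logistic_var (base i j + gamma \<theta>0 \<bullet> v) = link i j v * (1 - link i j v)" for v
    by (simp add: logistic_var_def link_def)
  have int: "integrable M (\<lambda>\<omega>. link i j (Z i j \<omega>) * (1 - link i j (Z i j \<omega>)))"
  proof (rule integrable_const_bound[of _ 1])
    show "AE \<omega> in M. norm (link i j (Z i j \<omega>) * (1 - link i j (Z i j \<omega>))) \<le> 1"
      using logistic_var_pos logistic_var_le_1 unfolding lv[symmetric]
      by (intro AE_I2) (simp add: less_imp_le)
  qed measurable
  have "expectation (\<lambda>\<omega>. (noise i j \<omega>)\<^sup>2)
    = expectation (\<lambda>\<omega>. noise i j \<omega> * (1 - 2 * link i j (Z i j \<omega>)) + link i j (Z i j \<omega>) * (1 - link i j (Z i j \<omega>)))"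
  proof (rule Bochner_Integration.integral_cong[OF refl])
    fix \<omega> assume "\<omega> \<in> space M"
    then have "A i j \<omega> = 0 \<or> A i j \<omega> = 1" using adjacency[OF ij] by auto
    then show "(noise i j \<omega>)\<^sup>2 = noise i j \<omega> * (1 - 2 * link i j (Z i j \<omega>)) + link i j (Z i j \<omega>) * (1 - link i j (Z i j \<omega>))"
      by (auto simp: noise_def power2_eq_square algebra_simps)
  qed
  also have "\<dots> = expectation (\<lambda>\<omega>. link i j (Z i j \<omega>) * (1 - link i j (Z i j \<omega>)))"
    using expectation_noise_mult[OF ij f bound] int by simp
  also have "\<dots> \<le> expectation (\<lambda>\<omega>. \<sigma>)"
    using int \<sigma> unfolding lv by (intro integral_mono_AE) auto
  finally show ?thesis by (simp add: prob_space)
qed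

text \<open>The finer level v is needed only for the p + 1 total sums paired with mu and gamma, so a
  polynomial tail and a union bound over these sums suffice.\<close>

lemma noise_variance_event:
  assumes \<sigma>: "\<And>i j. (i, j) \<in> edge_pairs n \<Longrightarrow> AE \<omega> in M. logistic_var (true_pred i j \<omega>) \<le> \<sigma>"
    and v: "0 < v"
  shows "\<exists>D\<in>events. prob D \<le> (1 + real CARD('p)) * (c\<^sup>2 * \<sigma> / (real (num_pairs n) * v\<^sup>2)) \<and>
    (\<forall>\<omega>\<in>space M - D. \<bar>pair_avg n (\<lambda>i j. noise i j \<omega>)\<bar> \<le> v \<and> (\<forall>k. \<bar>pair_avg n (\<lambda>i j. noise i j \<omega> * Z i j \<omega> $ k)\<bar> \<le> v))"
proof -
  define q where "q = c\<^sup>2 * \<sigma> / (real (num_pairs n) * v\<^sup>2)"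
  have noise_int: "integrable M (\<lambda>\<omega>. (noise i j \<omega>)\<^sup>2)" if "(i, j) \<in> edge_pairs n" for i j
  proof (rule integrable_const_bound[of _ 1])
    show "AE \<omega> in M. norm ((noise i j \<omega>)\<^sup>2) \<le> 1"
      using abs_noise_le[OF that] by (intro AE_I2) (simp add: abs_square_le_1)
  qed (use centered_field_measurable[OF centered_field_noise that] in measurable)
  have \<sigma>0: "0 \<le> \<sigma>"
  proof -
    obtain i j where ij: "(i, j) \<in> edge_pairs n" using edge_pairs_nonempty[OF n] by fastforce
    have "0 \<le> expectation (\<lambda>\<omega>. (noise i j \<omega>)\<^sup>2)" by (intro integral_nonneg_AE) auto
    then show ?thesis using expectation_noise_square[OF ij \<sigma>[OF ij]] by linarith
  qed
  have sq1: "expectation (\<lambda>\<omega>. (noise i j \<omega>)\<^sup>2) \<le> c\<^sup>2 * \<sigma>" if "(i, j) \<in> edge_pairs n" for i j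
  proof -
    have "1 * \<sigma> \<le> c\<^sup>2 * \<sigma>" using c_ge_1 \<sigma>0 by (intro mult_right_mono) (auto simp: one_le_power)
    then show ?thesis using expectation_noise_square[OF that \<sigma>[OF that]] by linarith
  qed
  have sq2: "expectation (\<lambda>\<omega>. (noise i j \<omega> * Z i j \<omega> $ k)\<^sup>2) \<le> c\<^sup>2 * \<sigma>" if ij: "(i, j) \<in> edge_pairs n" for i j k
  proof -
    have le: "AE \<omega> in M. (noise i j \<omega> * Z i j \<omega> $ k)\<^sup>2 \<le> c\<^sup>2 * (noise i j \<omega>)\<^sup>2"
      using Z_bounded[OF ij, of k]
    proof eventually_elim
      case (elim \<omega>)
      then have "(Z i j \<omega> $ k)\<^sup>2 \<le> c\<^sup>2" using c_ge_1 abs_le_square_iff[of "Z i j \<omega> $ k" c] by simp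
      then have "(Z i j \<omega> $ k)\<^sup>2 * (noise i j \<omega>)\<^sup>2 \<le> c\<^sup>2 * (noise i j \<omega>)\<^sup>2"
        by (rule mult_right_mono) simp
      then show ?case by (simp add: power_mult_distrib mult.commute)
    qed
    have "expectation (\<lambda>\<omega>. (noise i j \<omega> * Z i j \<omega> $ k)\<^sup>2) \<le> expectation (\<lambda>\<omega>. c\<^sup>2 * (noise i j \<omega>)\<^sup>2)"
    proof (rule integral_mono_AE'[OF _ le])
      show "integrable M (\<lambda>\<omega>. c\<^sup>2 * (noise i j \<omega>)\<^sup>2)" using noise_int[OF ij] by simp
    qed auto
    also have "\<dots> \<le> c\<^sup>2 * \<sigma>"
      using expectation_noise_square[OF ij \<sigma>[OF ij]] by (simp add: mult_left_mono)
    finally show ?thesis .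
  qed
  have 1: "\<exists>D\<in>events. prob D \<le> q \<and> (\<forall>\<omega>\<in>space M - D. \<bar>pair_avg n (\<lambda>i j. noise i j \<omega>)\<bar> \<le> v)"
    unfolding q_def by (rule centered_field_chebyshev[OF centered_field_noise sq1 v])
  have step5: "\<exists>D\<in>events. prob D \<le> q \<and> (\<forall>\<omega>\<in>space M - D. \<bar>pair_avg n (\<lambda>i j. noise i j \<omega> * Z i j \<omega> $ k)\<bar> \<le> v)" for k
    unfolding q_def by (rule centered_field_chebyshev[OF centered_field_noise_covariate sq2 v])
  have 2: "\<exists>D\<in>events. prob D \<le> real CARD('p) * q
     \<and> (\<forall>\<omega>\<in>space M - D. \<forall>k\<in>UNIV. \<bar>pair_avg n (\<lambda>i j. noise i j \<omega> * Z i j \<omega> $ k)\<bar> \<le> v)"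
    by (rule event_INT[OF finite step5])
  have "q + real CARD('p) * q = (1 + real CARD('p)) * q" by (simp add: distrib_right)
  then show ?thesis
    using event_conj[OF 1 2] unfolding q_def[symmetric] by simp
qed

section \<open>Expected divergence over fresh covariates\<close>

definition population_risk :: "(nat \<Rightarrow> real) \<Rightarrow> (nat \<Rightarrow> real) \<Rightarrow> real \<Rightarrow> real ^ 'p \<Rightarrow> real" where
  "population_risk a b m g = pair_avg n (\<lambda>i j. expectation (\<lambda>\<omega>.
     bregman (true_pred i j \<omega>) (a i + b j + m + g \<bullet> Z i j \<omega>)))"

lemma AE_abs_inner_Z_le:
  assumes "(i, j) \<in> edge_pairs n"
  shows "AE \<omega> in M. \<bar>g \<bullet> Z i j \<omega>\<bar> \<le> c * vec_l1 g"
  using Z_bounded_all[OF assms] by eventually_elim (rule abs_inner_le_vec_l1, blast)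

lemma AE_abs_predictor_le:
  assumes "(i, j) \<in> edge_pairs n"
  shows "AE \<omega> in M. \<bar>x + g \<bullet> Z i j \<omega>\<bar> \<le> \<bar>x\<bar> + c * vec_l1 g"
  using AE_abs_inner_Z_le[OF assms, of g] by eventually_elim linarith

lemma bregman_integrable:
  assumes ij: "(i, j) \<in> edge_pairs n"
  shows "integrable M (\<lambda>\<omega>. bregman (x0 + g0 \<bullet> Z i j \<omega>) (x + g \<bullet> Z i j \<omega>))"
proof (rule integrable_const_bound[of _ "\<bar>x\<bar> + c * vec_l1 g"])
  show "AE \<omega> in M. norm (bregman (x0 + g0 \<bullet> Z i j \<omega>) (x + g \<bullet> Z i j \<omega>)) \<le> \<bar>x\<bar> + c * vec_l1 g"
    using AE_abs_predictor_le[OF ij, of x g]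
  proof eventually_elim
    case (elim \<omega>)
    then show ?case
      using bregman_le_abs[of "x0 + g0 \<bullet> Z i j \<omega>" "x + g \<bullet> Z i j \<omega>"]
        bregman_nonneg[of "x0 + g0 \<bullet> Z i j \<omega>" "x + g \<bullet> Z i j \<omega>"] by simp
  qed
  show "(\<lambda>\<omega>. bregman (x0 + g0 \<bullet> Z i j \<omega>) (x + g \<bullet> Z i j \<omega>)) \<in> borel_measurable M"
    using Z_measurable[OF ij] by (intro bregman_measurable) auto
qed

lemma excess_risk_eq:
  "excess_risk n M A Z \<theta>0 \<theta> = population_risk (\<lambda>i. alpha \<theta> i - alpha \<theta>0 i) (\<lambda>j. beta \<theta> j - beta \<theta>0 j)
     (mu \<theta> - mu \<theta>0) (gamma \<theta> - gamma \<theta>0)"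
proof -
  define d where "d i j v = (alpha \<theta> i - alpha \<theta>0 i) + (beta \<theta> j - beta \<theta>0 j) + (mu \<theta> - mu \<theta>0)
    + (gamma \<theta> - gamma \<theta>0) \<bullet> v" for i j and v :: "real ^ 'p"
  define G where "G e \<omega> = (case e of (i, j) \<Rightarrow> bregman (true_pred i j \<omega>) (d i j (Z i j \<omega>)))" for e \<omega>
  define H where "H e \<omega> = (case e of (i, j) \<Rightarrow> noise i j \<omega> * d i j (Z i j \<omega>))" for e \<omega>
  have pt: "neg_log_lik n (\<lambda>i j. A i j \<omega>) (\<lambda>i j. Z i j \<omega>) \<theta> - neg_log_lik n (\<lambda>i j. A i j \<omega>) (\<lambda>i j. Z i j \<omega>) \<theta>0
     = (\<Sum>e\<in>edge_pairs n. G e \<omega> - H e \<omega>)" for \<omega>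
    unfolding neg_log_lik_def sum_subtractf[symmetric]
  proof (rule sum.cong[OF refl], clarify)
    fix i j
    have "lin_pred (\<lambda>i j. Z i j \<omega>) \<theta>0 i j = true_pred i j \<omega>"
      "lin_pred (\<lambda>i j. Z i j \<omega>) \<theta> i j = true_pred i j \<omega> + d i j (Z i j \<omega>)"
      by (simp_all add: lin_pred_def base_def d_def inner_diff_left)
    then show "- A i j \<omega> * lin_pred (\<lambda>i j. Z i j \<omega>) \<theta> i j + ln (1 + exp (lin_pred (\<lambda>i j. Z i j \<omega>) \<theta> i j)) -
       (- A i j \<omega> * lin_pred (\<lambda>i j. Z i j \<omega>) \<theta>0 i j + ln (1 + exp (lin_pred (\<lambda>i j. Z i j \<omega>) \<theta>0 i j)))
      = G (i, j) \<omega> - H (i, j) \<omega>"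
      by (simp add: G_def H_def bregman_def softplus_def noise_def link_def algebra_simps)
  qed
  have G_int: "integrable M (G e)" if "e \<in> edge_pairs n" for e
    using that bregman_integrable[of "fst e" "snd e"] unfolding G_def[abs_def] d_def by (auto simp: split_def)
  have H_int: "integrable M (H e)" "expectation (H e) = 0" if "e \<in> edge_pairs n" for e
  proof -
    obtain i j where e: "e = (i, j)" by (cases e)
    define x where "x = (alpha \<theta> i - alpha \<theta>0 i) + (beta \<theta> j - beta \<theta>0 j) + (mu \<theta> - mu \<theta>0)"
    have ij: "(i, j) \<in> edge_pairs n" using that e by simp
    have f: "(\<lambda>v. x + (gamma \<theta> - gamma \<theta>0) \<bullet> v) \<in> borel_measurable borel" by measurable
    note N = expectation_noise_mult[OF ij f AE_abs_predictor_le[OF ij]]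
    show "integrable M (H e)" "expectation (H e) = 0"
      using N by (simp_all add: H_def[abs_def] d_def x_def e)
  qed
  have "expectation (\<lambda>\<omega>. \<Sum>e\<in>edge_pairs n. G e \<omega> - H e \<omega>) = (\<Sum>e\<in>edge_pairs n. expectation (G e))"
    using G_int H_int by (subst Bochner_Integration.integral_sum) auto
  then show ?thesis
    unfolding excess_risk_def pt population_risk_def pair_avg_def by (simp add: G_def[abs_def] d_def split_def)
qed

lemma expectation_predictor_square:
  assumes ij: "(i, j) \<in> edge_pairs n"
  shows "integrable M (\<lambda>\<omega>. (x + g \<bullet> Z i j \<omega>)\<^sup>2)"
    and "expectation (\<lambda>\<omega>. (x + g \<bullet> Z i j \<omega>)\<^sup>2) = x\<^sup>2 + quad_form (second_moment i j) g"
proof -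
  note [measurable] = Z_measurable[OF ij]
  have 1: "integrable M (\<lambda>\<omega>. (y + g \<bullet> Z i j \<omega>)\<^sup>2)" for y
  proof (rule integrable_const_bound[of _ "(\<bar>y\<bar> + c * vec_l1 g)\<^sup>2"])
    show "AE \<omega> in M. norm ((y + g \<bullet> Z i j \<omega>)\<^sup>2) \<le> (\<bar>y\<bar> + c * vec_l1 g)\<^sup>2"
      using AE_abs_predictor_le[OF ij, of y g]
    proof eventually_elim
      case (elim \<omega>)
      then have "\<bar>y + g \<bullet> Z i j \<omega>\<bar>\<^sup>2 \<le> (\<bar>y\<bar> + c * vec_l1 g)\<^sup>2" by (intro power_mono) auto
      then show ?case by simp
    qed
  qed measurable
  have 2: "integrable M (\<lambda>\<omega>. g \<bullet> Z i j \<omega>)" "expectation (\<lambda>\<omega>. g \<bullet> Z i j \<omega>) = 0"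
    using Z_integrable[OF ij] Z_centered[OF ij]
      integral_bounded_linear[OF bounded_linear_inner_right Z_integrable[OF ij], of g]
    by (auto intro: integrable_bounded_linear[OF bounded_linear_inner_right])
  have 3: "integrable M (\<lambda>\<omega>. (g \<bullet> Z i j \<omega>)\<^sup>2)" using 1[of 0] by simp
  show "integrable M (\<lambda>\<omega>. (x + g \<bullet> Z i j \<omega>)\<^sup>2)" by (rule 1)
  have "(x + g \<bullet> Z i j \<omega>)\<^sup>2 = x\<^sup>2 + 2 * x * (g \<bullet> Z i j \<omega>) + (g \<bullet> Z i j \<omega>)\<^sup>2" for \<omega>
    by (simp add: power2_eq_square algebra_simps)
  then show "expectation (\<lambda>\<omega>. (x + g \<bullet> Z i j \<omega>)\<^sup>2) = x\<^sup>2 + quad_form (second_moment i j) g"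
    using 2 3 by (simp add: quad_form_second_moment[OF ij] prob_space)
qed

lemma population_risk_le_quadratic:
  assumes loc: "c * sqrt (real n) * increment_norm n a b m g \<le> 1"
    and w: "\<And>i j. (i, j) \<in> edge_pairs n \<Longrightarrow>
      AE \<omega> in M. logistic_var (true_pred i j \<omega>) \<le> exp K * w i j"
  shows "population_risk a b m g
    \<le> 2 * exp K * pair_avg n (\<lambda>i j. w i j * ((a i + b j + m)\<^sup>2 + quad_form (second_moment i j) g))"
  unfolding population_risk_def pair_avg_cmult[symmetric]
proof (rule pair_avg_mono)
  fix i j assume ij: "(i, j) \<in> edge_pairs n"
  define d where "d \<omega> = a i + b j + m + g \<bullet> Z i j \<omega>" for \<omega>
  have "expectation (\<lambda>\<omega>. bregman (true_pred i j \<omega>) (d \<omega>)) \<le> expectation (\<lambda>\<omega>. (2 * exp K * w i j) * (d \<omega>)\<^sup>2)"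
  proof (rule integral_mono_AE)
    show "integrable M (\<lambda>\<omega>. bregman (true_pred i j \<omega>) (d \<omega>))"
      unfolding d_def by (rule bregman_integrable[OF ij])
    show "integrable M (\<lambda>\<omega>. (2 * exp K * w i j) * (d \<omega>)\<^sup>2)"
      unfolding d_def using expectation_predictor_square(1)[OF ij] by simp
    show "AE \<omega> in M. bregman (true_pred i j \<omega>) (d \<omega>) \<le> (2 * exp K * w i j) * (d \<omega>)\<^sup>2"
      using w[OF ij] Z_bounded_all[OF ij]
    proof eventually_elim
      case (elim \<omega>)
      define x where "x = true_pred i j \<omega>"
      have "\<bar>d \<omega>\<bar> \<le> c * sqrt (real n) * increment_norm n a b m g"
        unfolding d_def using ij elim(2)
        by (intro abs_predictor_le n c_ge_1) (auto simp: edge_pairs_def)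
      then have d1: "\<bar>d \<omega>\<bar> \<le> 1" using loc by linarith
      \<comment> \<open>The crude bound 4 on exp |d| gives the remainder estimate the clean form 2
        d^2.\<close>
      have "exp \<bar>d \<omega>\<bar> \<le> exp 1" using d1 by simp
      also have "exp 1 \<le> (3 :: real)" by (rule exp_le)
      finally have "exp \<bar>d \<omega>\<bar> \<le> 4" by simp
      then have "(d \<omega>)\<^sup>2 * exp \<bar>d \<omega>\<bar> \<le> (d \<omega>)\<^sup>2 * 4" by (intro mult_left_mono) auto
      then have e: "exp \<bar>d \<omega>\<bar> - 1 - \<bar>d \<omega>\<bar> \<le> 2 * (d \<omega>)\<^sup>2"
        using exp_remainder_le[of "\<bar>d \<omega>\<bar>"] by simp
      have "bregman x (d \<omega>) \<le> logistic_var x * (exp \<bar>d \<omega>\<bar> - 1 - \<bar>d \<omega>\<bar>)" by (rule bregman_upper)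
      also have "\<dots> \<le> logistic_var x * (2 * (d \<omega>)\<^sup>2)"
        using e logistic_var_pos[of x] by (intro mult_left_mono) auto
      also have "\<dots> \<le> (exp K * w i j) * (2 * (d \<omega>)\<^sup>2)"
        using elim(1) by (intro mult_right_mono) (auto simp: x_def)
      finally show ?case by (simp add: x_def mult_ac)
    qed
  qed
  also have "\<dots> = 2 * exp K * (w i j * ((a i + b j + m)\<^sup>2 + quad_form (second_moment i j) g))"
    unfolding d_def using expectation_predictor_square[OF ij, of "a i + b j + m" g] by simp
  finally show "expectation (\<lambda>\<omega>. bregman (true_pred i j \<omega>) (a i + b j + m + g \<bullet> Z i j \<omega>))
    \<le> 2 * exp K * (w i j * ((a i + b j + m)\<^sup>2 + quad_form (second_moment i j) g))"
    by (simp add: d_def)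
qed

lemma AE_abs_covariate_le:
  assumes "(i, j) \<in> edge_pairs n"
  shows "AE \<omega> in M. \<bar>m + g \<bullet> Z i j \<omega>\<bar> \<le> c * (\<bar>m\<bar> + vec_l1 g)"
  using AE_abs_predictor_le[OF assms, of m g]
proof eventually_elim
  case (elim \<omega>)
  moreover have "\<bar>m\<bar> \<le> c * \<bar>m\<bar>" using c_ge_1 by (simp add: mult_le_cancel_right1)
  ultimately show ?case by (simp add: distrib_left)
qed

lemma population_risk_le_linear:
  "population_risk a b m g \<le> c * (\<bar>m\<bar> + vec_l1 g) + node_l1 n a b / real n"
proof -
  define T where "T = \<bar>m\<bar> + vec_l1 g"
  have "population_risk a b m g \<le> pair_avg n (\<lambda>i j. c * T + \<bar>a i + b j\<bar>)"
    unfolding population_risk_def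
  proof (rule pair_avg_mono)
    fix i j assume ij: "(i, j) \<in> edge_pairs n"
    have "expectation (\<lambda>\<omega>. bregman (true_pred i j \<omega>) (a i + b j + m + g \<bullet> Z i j \<omega>))
      \<le> expectation (\<lambda>\<omega>. c * T + \<bar>a i + b j\<bar>)"
    proof (rule integral_mono_AE)
      show "integrable M (\<lambda>\<omega>. bregman (true_pred i j \<omega>) (a i + b j + m + g \<bullet> Z i j \<omega>))"
        by (rule bregman_integrable[OF ij])
      show "AE \<omega> in M. bregman (true_pred i j \<omega>) (a i + b j + m + g \<bullet> Z i j \<omega>) \<le> c * T + \<bar>a i + b j\<bar>"
        using AE_abs_covariate_le[OF ij, of m g]
      proof eventually_elim
        case (elim \<omega>)
        then show ?case
          using bregman_le_abs[of "true_pred i j \<omega>" "a i + b j + m + g \<bullet> Z i j \<omega>"]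
          unfolding T_def by linarith
      qed
    qed simp
    then show "expectation (\<lambda>\<omega>. bregman (true_pred i j \<omega>) (a i + b j + m + g \<bullet> Z i j \<omega>))
      \<le> c * T + \<bar>a i + b j\<bar>" by (simp add: prob_space)
  qed
  also have "\<dots> = c * T + pair_avg n (\<lambda>i j. \<bar>a i + b j\<bar>)"
    by (simp add: pair_avg_add pair_avg_const n)
  finally show ?thesis using pair_avg_abs_nodes[OF n, of a b] by (simp add: T_def)
qed

text \<open>The covariate part of the increment is uniformly bounded by c T and treated
  quadratically with variance \<sigma>. The node part is small only on average and is therefore
  treated linearly.\<close>

lemma population_risk_le_mixed:
  assumes \<sigma>: "\<And>i j. (i, j) \<in> edge_pairs n \<Longrightarrow> AE \<omega> in M. logistic_var (true_pred i j \<omega>) \<le> \<sigma>"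
    and T: "T = \<bar>m\<bar> + vec_l1 g"
  shows "population_risk a b m g \<le> \<sigma> * (c * T)\<^sup>2 * exp (2 * (c * T)) + node_l1 n a b / real n"
proof -
  define B where "B = \<sigma> * (c * T)\<^sup>2 * exp (2 * (c * T))"
  have "population_risk a b m g \<le> pair_avg n (\<lambda>i j. B + \<bar>a i + b j\<bar>)"
    unfolding population_risk_def
  proof (rule pair_avg_mono)
    fix i j assume ij: "(i, j) \<in> edge_pairs n"
    have "expectation (\<lambda>\<omega>. bregman (true_pred i j \<omega>) (a i + b j + m + g \<bullet> Z i j \<omega>))
      \<le> expectation (\<lambda>\<omega>. B + \<bar>a i + b j\<bar>)"
    proof (rule integral_mono_AE)
      show "integrable M (\<lambda>\<omega>. bregman (true_pred i j \<omega>) (a i + b j + m + g \<bullet> Z i j \<omega>))"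
        by (rule bregman_integrable[OF ij])
      show "AE \<omega> in M. bregman (true_pred i j \<omega>) (a i + b j + m + g \<bullet> Z i j \<omega>) \<le> B + \<bar>a i + b j\<bar>"
        using AE_abs_covariate_le[OF ij, of m g] \<sigma>[OF ij]
      proof eventually_elim
        case (elim \<omega>)
        define x where "x = true_pred i j \<omega>"
        define e where "e = m + g \<bullet> Z i j \<omega>"
        define s where "s = \<bar>2 * e\<bar>"
        have s: "0 \<le> s" "s \<le> 2 * (c * T)" using elim(1) by (auto simp: s_def e_def T)
        have "0 \<le> \<sigma>" using elim(2) logistic_var_pos[of x] by (simp add: x_def)
        \<comment> \<open>The splitting evaluates divergences at doubled arguments; hence s = |2 e|
          and the exponent 2 (c T).\<close>
        have "bregman x (2 * e) \<le> logistic_var x * (exp s - 1 - s)"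
          unfolding s_def by (rule bregman_upper)
        also have "\<dots> \<le> \<sigma> * (s\<^sup>2 * exp s / 2)"
        proof (rule mult_mono)
          show "0 \<le> exp s - 1 - s" using exp_ge_add_one_self[of s] by linarith
        qed (use elim(2) \<open>0 \<le> \<sigma>\<close> exp_remainder_le[OF s(1)] in \<open>simp_all add: x_def\<close>)
        also have "\<dots> \<le> \<sigma> * ((2 * (c * T))\<^sup>2 * exp (2 * (c * T)) / 2)"
          using s \<open>0 \<le> \<sigma>\<close> by (intro mult_left_mono divide_right_mono mult_mono power_mono) auto
        also have "\<dots> = 2 * B" by (simp add: B_def power2_eq_square)
        finally have "bregman x (2 * e) / 2 \<le> B" by simp
        moreover have "bregman x (2 * (a i + b j)) / 2 \<le> \<bar>a i + b j\<bar>"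
          using bregman_le_abs[of x "2 * (a i + b j)"] by (simp only: abs_mult) simp
        moreover have eq: "a i + b j + m + g \<bullet> Z i j \<omega> = e + (a i + b j)" by (simp add: e_def)
        ultimately show ?case
          using bregman_add[of x e "a i + b j"] unfolding x_def[symmetric] eq by linarith
      qed
    qed simp
    then show "expectation (\<lambda>\<omega>. bregman (true_pred i j \<omega>) (a i + b j + m + g \<bullet> Z i j \<omega>))
      \<le> B + \<bar>a i + b j\<bar>" by (simp add: prob_space)
  qed
  also have "\<dots> = B + pair_avg n (\<lambda>i j. \<bar>a i + b j\<bar>)"
    by (simp add: pair_avg_add pair_avg_const n)
  finally show ?thesis using pair_avg_abs_nodes[OF n, of a b] by (simp add: B_def)
qed

end

section \<open>The estimator in the sparse regime\<close>

text \<open>Everything for a single n. The lower bound on the penalty enters through its leading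
  term \<open>lb_ge\<close>, and \<open>K\<close> bounds the covariate part of the true
  predictor.\<close>

locale estimation_model = edge_model M n A Z \<theta>0 c
  for M :: "'a measure" and n A and Z :: "nat \<Rightarrow> nat \<Rightarrow> 'a \<Rightarrow> real ^ ('p :: finite)" and \<theta>0 c +
  fixes \<theta>hat :: "'a \<Rightarrow> 'p params" and \<rho> r lam lb K cmin a0 L0 :: real
  assumes \<rho>: "0 < \<rho>" "\<rho> \<le> 1 / 2"
    and link_range: "\<And>i j. (i, j) \<in> edge_pairs n \<Longrightarrow>
      AE \<omega> in M. \<rho> \<le> link_prob (\<lambda>i j. Z i j \<omega>) \<theta>0 i j \<and> link_prob (\<lambda>i j. Z i j \<omega>) \<theta>0 i j \<le> 1 - \<rho>"
    and r: "r = - ln (\<rho> / (1 - \<rho>))"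
    and cmin: "0 < cmin" "cmin \<le> 1"
    and eigenvalues_ge: "\<And>e. e \<in> eigenvalues (gram_matrix n M Z) \<Longrightarrow> cmin \<le> e"
    and true_local: "AE \<omega> in M. \<theta>0 \<in> local_space n r (\<lambda>i j. Z i j \<omega>)"
    and estimator: "AE \<omega> in M. is_arg_min (penalized_loss n lam (\<lambda>i j. A i j \<omega>) (\<lambda>i j. Z i j \<omega>))
      (\<lambda>\<theta>. \<theta> \<in> local_space n r (\<lambda>i j. Z i j \<omega>)) (\<theta>hat \<omega>)"
    and estimator_measurable:
      "\<And>i. i \<in> {1..n} \<Longrightarrow> (\<lambda>\<omega>. alpha (\<theta>hat \<omega>) i) \<in> borel_measurable M"
      "\<And>j. j \<in> {1..n} \<Longrightarrow> (\<lambda>\<omega>. beta (\<theta>hat \<omega>) j) \<in> borel_measurable M"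
      "(\<lambda>\<omega>. mu (\<theta>hat \<omega>)) \<in> borel_measurable M"
      "(\<lambda>\<omega>. gamma (\<theta>hat \<omega>)) \<in> borel_measurable M"
    and lb: "lb = sqrt (real n) * lam"
    and L0: "L0 = ln (2 * real (2 * n + CARD('p) + 1))"
    and a0: "a0 = sqrt (2 * L0 / real (num_pairs n)) * c"
    and lb_ge: "64 * a0 \<le> lb"
    and K: "c * vec_l1 (gamma \<theta>0) \<le> K"
begin

section \<open>Errors of the estimator and the noise level\<close>

definition da where "da \<omega> i = alpha (\<theta>hat \<omega>) i - alpha \<theta>0 i"
definition db where "db \<omega> j = beta (\<theta>hat \<omega>) j - beta \<theta>0 j"
definition dm where "dm \<omega> = mu (\<theta>hat \<omega>) - mu \<theta>0"
definition dg where "dg \<omega> = gamma (\<theta>hat \<omega>) - gamma \<theta>0"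
abbreviation hat_increment where "hat_increment i j \<omega> \<equiv> da \<omega> i + db \<omega> j + dm \<omega> + dg \<omega> \<bullet> Z i j \<omega>"
abbreviation hat_norm where "hat_norm \<omega> \<equiv> increment_norm n (da \<omega>) (db \<omega>) (dm \<omega>) (dg \<omega>)"
abbreviation hat_population_risk where "hat_population_risk \<omega> \<equiv> population_risk (da \<omega>) (db \<omega>) (dm \<omega>) (dg \<omega>)"
definition SA where "SA = {i \<in> {1..n}. alpha \<theta>0 i \<noteq> 0}"
definition SB where "SB = {j \<in> {1..n}. beta \<theta>0 j \<noteq> 0}"
definition s where "s = real (card SA) + real (card SB) + real CARD('p) + 1"
definition error where
  "error \<omega> = hat_population_risk \<omega> + lb * hat_norm \<omega>"
text \<open>The factor 2 multiplies the exponent of the tail by 4, enough to beat the union bound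
  over the nodes; \<open>lb_ge\<close> still leaves u \<le> lb / 32.\<close>

definition u where "u = 2 * a0"

lemma n_pos: "0 < real n" "1 \<le> sqrt (real n)" using n by auto

lemma N_pos: "0 < real (num_pairs n)" using num_pairs_pos[OF n] by simp

lemma s_ge: "1 \<le> s" by (simp add: s_def)

lemma L0_ge: "1 \<le> L0"
proof -
  have "exp 1 \<le> (3 :: real)" by (rule exp_le)
  also have "3 \<le> 2 * real (2 * n + CARD('p) + 1)" using n by simp
  finally have "ln (exp 1) \<le> L0" unfolding L0 by (subst ln_le_cancel_iff) auto
  then show ?thesis by simp
qed

lemma a0_square: "2 * L0 / real (num_pairs n) \<le> a0\<^sup>2"
proof -
  have 0: "0 \<le> 2 * L0 / real (num_pairs n)" using L0_ge by (intro divide_nonneg_nonneg) auto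
  have "2 * L0 / real (num_pairs n) * 1 \<le> 2 * L0 / real (num_pairs n) * c\<^sup>2"
    using 0 c_ge_1 by (intro mult_left_mono) (auto simp: one_le_power)
  also have "\<dots> = a0\<^sup>2" using 0 by (simp add: a0 power_mult_distrib)
  finally show ?thesis by simp
qed

lemma a0_pos: "0 < a0"
  using L0_ge N_pos c_ge_1 by (simp add: a0)

lemma u_bounds: "0 < u" "u \<le> lb / 32" "0 < lb" "a0 \<le> lb"
  using a0_pos lb_ge by (auto simp: u_def)

lemma lb_square: "2 * L0 / real (num_pairs n) \<le> lb\<^sup>2" "1 / real (num_pairs n) \<le> lb\<^sup>2"
proof -
  have "a0\<^sup>2 \<le> lb\<^sup>2" using u_bounds a0_pos by (intro power_mono) auto
  then show 1: "2 * L0 / real (num_pairs n) \<le> lb\<^sup>2" using a0_square by linarith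
  have "1 / real (num_pairs n) \<le> 2 * L0 / real (num_pairs n)"
    using L0_ge by (intro divide_right_mono) auto
  then show "1 / real (num_pairs n) \<le> lb\<^sup>2" using 1 by linarith
qed

text \<open>The rate a0, and with it the penalty, is at least of order 1 / n. Conversely, a small
  penalty forces n to be large.\<close>

lemma a0_times_n: "1 \<le> real n * a0"
proof -
  have "real (num_pairs n) \<le> (real n)\<^sup>2"
    using n by (simp add: real_num_pairs power2_eq_square)
  then have "1 / (real n)\<^sup>2 \<le> 1 / real (num_pairs n)"
    using N_pos n_pos by (intro divide_left_mono mult_pos_pos) auto
  also have "\<dots> \<le> 2 * L0 / real (num_pairs n)" using L0_ge by (intro divide_right_mono) auto
  also have "\<dots> \<le> a0\<^sup>2" by (rule a0_square)
  finally have "(real n)\<^sup>2 * (1 / (real n)\<^sup>2) \<le> (real n)\<^sup>2 * a0\<^sup>2" by (rule mult_left_mono) simp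
  then have "1\<^sup>2 \<le> (real n * a0)\<^sup>2" using n_pos(1) by (simp add: power_mult_distrib)
  then show ?thesis by (rule power2_le_imp_le) (use n_pos a0_pos in auto)
qed

text \<open>The exponent equals 4 L0, so the exponential is the inverse fourth power of q = exp L0,
  and q dominates both 4 n + 2 and n.\<close>

lemma tail_le: "(4 * real n + 2) * exp (- (u\<^sup>2 * real (num_pairs n) / (2 * c\<^sup>2))) \<le> 1 / real n"
proof -
  define q where "q = 2 * real (2 * n + CARD('p) + 1)"
  have q: "4 * real n + 2 \<le> q" "real n \<le> q" "1 \<le> q" by (auto simp: q_def)
  have "u\<^sup>2 * real (num_pairs n) / (2 * c\<^sup>2) = 4 * L0"
  proof -
    have "a0\<^sup>2 = 2 * L0 / real (num_pairs n) * c\<^sup>2"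
      using L0_ge by (simp add: a0 power_mult_distrib)
    then show ?thesis using N_pos c_ge_1 by (simp add: u_def power_mult_distrib)
  qed
  moreover have "exp (4 * L0) = q ^ 4"
  proof -
    have "exp L0 = q" unfolding L0 q_def by (rule exp_ln) simp
    then show ?thesis using exp_of_nat_mult[of 4 L0] by simp
  qed
  ultimately have "exp (- (u\<^sup>2 * real (num_pairs n) / (2 * c\<^sup>2))) = 1 / q ^ 4"
    by (simp add: exp_minus inverse_eq_divide)
  then have "(4 * real n + 2) * exp (- (u\<^sup>2 * real (num_pairs n) / (2 * c\<^sup>2))) \<le> q * (1 / q ^ 4)"
    using q by (auto intro!: divide_right_mono)
  also have "\<dots> = 1 / q ^ 3" using q by (simp add: power_Suc eval_nat_numeral)
  also have "\<dots> \<le> 1 / q"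
    using q by (intro divide_left_mono) (auto intro: self_le_power)
  also have "\<dots> \<le> 1 / real n" using q n by (intro divide_left_mono) auto
  finally show ?thesis .
qed

lemma AE_shift: "(i, j) \<in> edge_pairs n \<Longrightarrow> AE \<omega> in M. \<bar>gamma \<theta>0 \<bullet> Z i j \<omega>\<bar> \<le> K"
  by (rule eventually_mono[OF AE_abs_inner_Z_le[of i j "gamma \<theta>0"]]) (use K in auto)

text \<open>The covariates shift the true predictor by at most K, and self-concordance turns this
  shift into a factor exp K. The random curvature may thus be replaced by a deterministic
  one.\<close>

lemma AE_variance:
  assumes "(i, j) \<in> edge_pairs n"
  shows "AE \<omega> in M. exp (- K) * logistic_var (base i j) \<le> logistic_var (true_pred i j \<omega>)"
    and "AE \<omega> in M. logistic_var (true_pred i j \<omega>) \<le> exp K * logistic_var (base i j)"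
proof -
  show "AE \<omega> in M. exp (- K) * logistic_var (base i j) \<le> logistic_var (true_pred i j \<omega>)"
    using AE_shift[OF assms]
  proof eventually_elim
    case (elim \<omega>)
    have "exp (- K) * logistic_var (base i j) \<le> exp (- \<bar>gamma \<theta>0 \<bullet> Z i j \<omega>\<bar>) * logistic_var (base i j)"
      using elim by (intro mult_right_mono) (auto simp: less_imp_le logistic_var_pos)
    then show ?case using logistic_var_shift[of "gamma \<theta>0 \<bullet> Z i j \<omega>" "base i j"] by linarith
  qed
  show "AE \<omega> in M. logistic_var (true_pred i j \<omega>) \<le> exp K * logistic_var (base i j)"
    using AE_shift[OF assms]
  proof eventually_elim
    case (elim \<omega>)
    have "exp \<bar>gamma \<theta>0 \<bullet> Z i j \<omega>\<bar> * logistic_var (base i j) \<le> exp K * logistic_var (base i j)"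
      using elim by (intro mult_right_mono) (auto simp: less_imp_le logistic_var_pos)
    then show ?case using logistic_var_shift_upper[of "base i j" "gamma \<theta>0 \<bullet> Z i j \<omega>"] by linarith
  qed
qed

text \<open>A link probability in [\<rho>, 1 - \<rho>] has variance at least \<rho> (1 - \<rho>)
  \<ge> \<rho> / 2. The claim is deterministic, so its failure would contradict an almost sure
  statement.\<close>

lemma base_variance_ge:
  assumes ij: "(i, j) \<in> edge_pairs n"
  shows "exp (- K) * \<rho> / 2 \<le> logistic_var (base i j)"
proof (rule ccontr)
  assume *: "\<not> exp (- K) * \<rho> / 2 \<le> logistic_var (base i j)"
  have "AE \<omega> in M. False"
    using link_range[OF ij] AE_variance(2)[OF ij]
  proof eventually_elim
    case (elim \<omega>)
    define p where "p = link i j (Z i j \<omega>)"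
    have p: "\<rho> \<le> p" "p \<le> 1 - \<rho>" using elim(1) by (auto simp: p_def link_prob_eq)
    have "0 \<le> (p - \<rho>) * (1 - \<rho> - p)" using p by (intro mult_nonneg_nonneg) auto
    then have "\<rho> * (1 - \<rho>) \<le> p * (1 - p)" by (simp add: algebra_simps)
    moreover have "\<rho> * (1 / 2) \<le> \<rho> * (1 - \<rho>)" using \<rho> by (intro mult_left_mono) auto
    ultimately have "\<rho> / 2 \<le> logistic_var (true_pred i j \<omega>)"
      by (simp add: logistic_var_def p_def link_def)
    then have "\<rho> / 2 \<le> exp K * logistic_var (base i j)" using elim(2) by linarith
    then have "exp (- K) * (\<rho> / 2) \<le> exp (- K) * (exp K * logistic_var (base i j))"
      by (intro mult_left_mono) auto
    then show ?case using * by (simp flip: mult.assoc exp_add)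
  qed
  then show False by simp
qed

text \<open>Off the support of f0 the difference of absolute values is exactly |f - f0|; on the
  support it is at least - |f - f0| by the triangle inequality.\<close>

lemma l1_difference_ge:
  fixes f f0 :: "nat \<Rightarrow> real"
  assumes "finite I"
  shows "(\<Sum>i\<in>I. \<bar>f i - f0 i\<bar>) - 2 * (\<Sum>i\<in>{i \<in> I. f0 i \<noteq> 0}. \<bar>f i - f0 i\<bar>)
    \<le> (\<Sum>i\<in>I. \<bar>f i\<bar>) - (\<Sum>i\<in>I. \<bar>f0 i\<bar>)"
proof -
  have "(\<Sum>i\<in>{i \<in> I. f0 i \<noteq> 0}. \<bar>f i - f0 i\<bar>) = (\<Sum>i\<in>I. if f0 i \<noteq> 0 then \<bar>f i - f0 i\<bar> else 0)"
    using assms by (simp add: sum.inter_filter)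
  then have "(\<Sum>i\<in>I. \<bar>f i - f0 i\<bar>) - 2 * (\<Sum>i\<in>{i \<in> I. f0 i \<noteq> 0}. \<bar>f i - f0 i\<bar>)
      = (\<Sum>i\<in>I. \<bar>f i - f0 i\<bar> - 2 * (if f0 i \<noteq> 0 then \<bar>f i - f0 i\<bar> else 0))"
    by (simp only: sum_subtractf sum_distrib_left)
  also have "\<dots> \<le> (\<Sum>i\<in>I. \<bar>f i\<bar> - \<bar>f0 i\<bar>)" by (intro sum_mono) auto
  finally show ?thesis by (simp add: sum_subtractf)
qed

definition realized_risk where
  "realized_risk \<omega> = pair_avg n (\<lambda>i j. bregman (true_pred i j \<omega>)
     (hat_increment i j \<omega>))"

definition support_norm where
  "support_norm \<omega> = ((\<Sum>i\<in>SA. \<bar>da \<omega> i\<bar>) + (\<Sum>j\<in>SB. \<bar>db \<omega> j\<bar>)) / sqrt (real n)"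

lemma lin_pred_hat:
  "lin_pred (\<lambda>i j. Z i j \<omega>) (\<theta>hat \<omega>) i j = true_pred i j \<omega> + (hat_increment i j \<omega>)"
  by (simp add: lin_pred_def base_def da_def db_def dm_def dg_def inner_diff_left)

lemma lin_pred_true: "lin_pred (\<lambda>i j. Z i j \<omega>) \<theta>0 i j = true_pred i j \<omega>"
  by (simp add: lin_pred_def base_def)

text \<open>The true parameter is feasible by \<open>true_local\<close>, so the penalised loss at
  the estimator is no larger. Centring the edges at their conditional means turns the loss
  difference into divergence minus noise.\<close>

lemma basic_inequality:
  "AE \<omega> in M. realized_risk \<omega>
    \<le> pair_avg n (\<lambda>i j. noise i j \<omega> * (hat_increment i j \<omega>))
      + lb * (support_norm \<omega> - (node_l1 n (da \<omega>) (db \<omega>) / sqrt (real n) - support_norm \<omega>))"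
  using true_local estimator
proof eventually_elim
  case (elim \<omega>)
  define P where "P \<theta> = (\<Sum>i=1..n. \<bar>alpha \<theta> i\<bar>) + (\<Sum>j=1..n. \<bar>beta \<theta> j\<bar>)" for \<theta> :: "'p params"
  define d where "d i j = hat_increment i j \<omega>" for i j
  define N where "N = real (num_pairs n)"
  let ?l = "neg_log_lik n (\<lambda>i j. A i j \<omega>) (\<lambda>i j. Z i j \<omega>)"
  have "\<not> penalized_loss n lam (\<lambda>i j. A i j \<omega>) (\<lambda>i j. Z i j \<omega>) \<theta>0
     < penalized_loss n lam (\<lambda>i j. A i j \<omega>) (\<lambda>i j. Z i j \<omega>) (\<theta>hat \<omega>)"
    using elim unfolding is_arg_min_def by blast
  then have le: "?l (\<theta>hat \<omega>) / N + lam * P (\<theta>hat \<omega>) \<le> ?l \<theta>0 / N + lam * P \<theta>0"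
    by (simp add: penalized_loss_def P_def N_def)
  have "?l (\<theta>hat \<omega>) / N - ?l \<theta>0 / N
      = pair_avg n (\<lambda>i j. bregman (true_pred i j \<omega>) (d i j) - noise i j \<omega> * d i j)"
    unfolding neg_log_lik_def pair_avg_def N_def diff_divide_distrib[symmetric] sum_subtractf[symmetric]
  proof (rule arg_cong[where f = "\<lambda>x. x / _"], rule sum.cong[OF refl], clarify)
    fix i j
    show "- A i j \<omega> * lin_pred (\<lambda>i j. Z i j \<omega>) (\<theta>hat \<omega>) i j + ln (1 + exp (lin_pred (\<lambda>i j. Z i j \<omega>) (\<theta>hat \<omega>) i j)) -
       (- A i j \<omega> * lin_pred (\<lambda>i j. Z i j \<omega>) \<theta>0 i j + ln (1 + exp (lin_pred (\<lambda>i j. Z i j \<omega>) \<theta>0 i j)))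
      = bregman (true_pred i j \<omega>) (d i j) - noise i j \<omega> * d i j"
      unfolding lin_pred_hat lin_pred_true d_def[symmetric]
      by (simp add: bregman_def softplus_def noise_def link_def algebra_simps)
  qed
  also have "\<dots> = realized_risk \<omega> - pair_avg n (\<lambda>i j. noise i j \<omega> * d i j)"
    by (simp add: pair_avg_diff realized_risk_def d_def)
  finally have lik: "?l (\<theta>hat \<omega>) / N - ?l \<theta>0 / N = realized_risk \<omega> - pair_avg n (\<lambda>i j. noise i j \<omega> * d i j)" .
  have lam: "lam = lb / sqrt (real n)" using n_pos by (simp add: lb)
  have lam0: "0 \<le> lam" unfolding lam using u_bounds by simp
  have "node_l1 n (da \<omega>) (db \<omega>) - 2 * ((\<Sum>i\<in>SA. \<bar>da \<omega> i\<bar>) + (\<Sum>j\<in>SB. \<bar>db \<omega> j\<bar>)) \<le> P (\<theta>hat \<omega>) - P \<theta>0"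
    using l1_difference_ge[of "{1..n}" "alpha (\<theta>hat \<omega>)" "alpha \<theta>0"]
      l1_difference_ge[of "{1..n}" "beta (\<theta>hat \<omega>)" "beta \<theta>0"]
    by (simp add: node_l1_def da_def db_def SA_def SB_def P_def)
  then have "lam * (node_l1 n (da \<omega>) (db \<omega>) - 2 * ((\<Sum>i\<in>SA. \<bar>da \<omega> i\<bar>) + (\<Sum>j\<in>SB. \<bar>db \<omega> j\<bar>)))
      \<le> lam * (P (\<theta>hat \<omega>) - P \<theta>0)"
    using lam0 by (rule mult_left_mono)
  also have "lam * (node_l1 n (da \<omega>) (db \<omega>) - 2 * ((\<Sum>i\<in>SA. \<bar>da \<omega> i\<bar>) + (\<Sum>j\<in>SB. \<bar>db \<omega> j\<bar>)))
      = - (lb * (support_norm \<omega> - (node_l1 n (da \<omega>) (db \<omega>) / sqrt (real n) - support_norm \<omega>)))"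
    unfolding lam support_norm_def by (simp add: algebra_simps add_divide_distrib diff_divide_distrib)
  finally have "- (lb * (support_norm \<omega> - (node_l1 n (da \<omega>) (db \<omega>) / sqrt (real n) - support_norm \<omega>)))
      \<le> lam * P (\<theta>hat \<omega>) - lam * P \<theta>0"
    by (simp add: right_diff_distrib)
  then show ?case using le lik unfolding d_def[symmetric] by linarith
qed

lemma AE_edges:
  assumes "\<And>i j. (i, j) \<in> edge_pairs n \<Longrightarrow> AE \<omega> in M. P i j \<omega>"
  shows "AE \<omega> in M. \<forall>(i, j)\<in>edge_pairs n. P i j \<omega>"
proof (rule AE_finite_allI[OF finite_edge_pairs])
  show "AE \<omega> in M. case e of (i, j) \<Rightarrow> P i j \<omega>" if "e \<in> edge_pairs n" for e
    using that assms by (cases e) simp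
qed

lemma AE_Z_bounded: "AE \<omega> in M. \<forall>(i, j)\<in>edge_pairs n. \<forall>k. \<bar>Z i j \<omega> $ k\<bar> \<le> c"
  by (rule AE_edges, rule Z_bounded_all)

lemma AE_variance_edges: "AE \<omega> in M. \<forall>(i, j)\<in>edge_pairs n.
    exp (- K) * logistic_var (base i j) \<le> logistic_var (true_pred i j \<omega>)"
  by (rule AE_edges, rule AE_variance)

text \<open>The three bounds on \<epsilon> yield the smallness conditions of
  \<open>sparse_rate\<close>. The expected risk is then bounded by a weighted square over fresh
  covariates and, through the Gram deviation, by the realised risk.\<close>

lemma sparse_bound:
  assumes \<kappa>: "\<kappa> = exp (- 2 * K) * cmin / 24"
    and \<epsilon>: "\<epsilon> \<le> \<kappa> / (12 * c)" "\<epsilon> \<le> exp (- K) * cmin / (8 * c)" "\<epsilon> \<le> cmin"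
    and small: "sqrt (real n) * s * lb / \<rho> \<le> \<epsilon>"
  shows "\<exists>D\<in>events. prob D \<le> (1 + real CARD('p))\<^sup>2 * (1 / real n) \<and>
    (AE \<omega> in M. \<omega> \<notin> D \<longrightarrow> error \<omega> \<le> (2 * exp K * (12 * exp K + 6) + 6) / \<kappa> * (s * lb\<^sup>2 / \<rho>))"
proof -
  define w where "w i j = logistic_var (base i j)" for i j
  have w01: "0 \<le> w i j \<and> w i j \<le> 1" for i j
    using logistic_var_pos logistic_var_le_1 by (simp add: w_def less_imp_le)
  have \<kappa>0: "0 < \<kappa>" using cmin by (simp add: \<kappa>)
  have c: "0 < c" using c_ge_1 by simp
  have small': "sqrt (real n) * s * lb \<le> \<epsilon> * \<rho>" using small \<rho> by (simp add: pos_divide_le_eq)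
  have \<epsilon>0: "0 < \<epsilon>"
  proof -
    have "0 < sqrt (real n) * s * lb / \<rho>" using n_pos s_ge u_bounds \<rho> by auto
    then show ?thesis using small by linarith
  qed
  \<comment> \<open>No separate assumption that n is large is made: since lb \<ge> 64 / n, smallness
    of sqrt n s lb / \<rho> makes s / sqrt n small too.\<close>
  have small1: "36 * s / sqrt (real n) \<le> cmin / 2"
  proof -
    have "64 * 1 \<le> real n * lb"
    proof -
      have "real n * (64 * a0) \<le> real n * lb" using lb_ge by (intro mult_left_mono) auto
      then show ?thesis using a0_times_n by linarith
    qed
    then have "s / sqrt (real n) * 64 \<le> s / sqrt (real n) * (real n * lb)"
      using s_ge by (intro mult_left_mono) auto
    also have "\<dots> = (real n / sqrt (real n)) * s * lb" by simp
    also have "real n / sqrt (real n) = sqrt (real n)" by (simp add: real_div_sqrt)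
    also have "sqrt (real n) * s * lb \<le> \<epsilon> * \<rho>" by (rule small')
    also have "\<dots> \<le> cmin * (1 / 2)" using \<epsilon> \<epsilon>0 \<rho> by (intro mult_mono) auto
    finally have "s / sqrt (real n) \<le> cmin / 128" by linarith
    moreover have "36 * s / sqrt (real n) = 36 * (s / sqrt (real n))" by simp
    ultimately show ?thesis using cmin by linarith
  qed
  have small2: "18 * s * c * u \<le> exp (- K) * \<rho> * cmin / 8"
  proof -
    have "18 * s * c * u \<le> 18 * s * c * (lb / 32)" using s_ge c u_bounds by (intro mult_left_mono) auto
    also have "\<dots> \<le> c * (1 * s * lb)" using s_ge c u_bounds by simp
    also have "\<dots> \<le> c * (sqrt (real n) * s * lb)"
      using n_pos s_ge c u_bounds by (intro mult_left_mono mult_right_mono) auto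
    also have "\<dots> \<le> c * (\<epsilon> * \<rho>)" using small' c by (intro mult_left_mono) auto
    also have "\<dots> \<le> c * (exp (- K) * cmin / (8 * c) * \<rho>)"
      using \<epsilon>(2) c \<rho> by (intro mult_left_mono mult_right_mono) auto
    also have "\<dots> = exp (- K) * \<rho> * cmin / 8" using c by simp
    finally show ?thesis .
  qed
  have small3: "12 * c * sqrt (real n) * s * lb / (\<kappa> * \<rho>) \<le> 1"
  proof -
    have "12 * c * (sqrt (real n) * s * lb) \<le> 12 * c * (\<kappa> / (12 * c) * \<rho>)"
      using small' mult_right_mono[OF \<epsilon>(1), of \<rho>] \<rho> c by (intro mult_left_mono) auto
    also have "\<dots> = \<kappa> * \<rho>" using c by simp
    finally show ?thesis using \<kappa>0 \<rho> by (simp add: mult.assoc)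
  qed
  obtain D where D: "D \<in> events"
    "prob D \<le> (1 + real CARD('p))\<^sup>2 * ((4 * real n + 2) * exp (- (u\<^sup>2 * real (num_pairs n) / (2 * c\<^sup>2))))"
    "\<forall>\<omega>\<in>space M - D. all_balanced u w \<omega>"
    using all_balanced_event[of w, OF w01 u_bounds(1)] by (elim bexE conjE) (rule that)
  have "prob D \<le> (1 + real CARD('p))\<^sup>2 * (1 / real n)"
    by (rule order_trans[OF D(2) mult_left_mono[OF tail_le]]) simp
  moreover have "AE \<omega> in M. \<omega> \<notin> D \<longrightarrow> error \<omega> \<le> (2 * exp K * (12 * exp K + 6) + 6) / \<kappa> * (s * lb\<^sup>2 / \<rho>)"
    using basic_inequality AE_Z_bounded AE_variance_edges AE_space
  proof eventually_elim
    case (elim \<omega>)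
    show ?case
    proof
      assume "\<omega> \<notin> D"
      then have bal: "all_balanced u w \<omega>" using D(3) elim(4) by auto
      interpret R: covariate_realization n "\<lambda>i j. Z i j \<omega>" second_moment
        "\<lambda>i j. true_pred i j \<omega>" w c u lb cmin K
        using bal n c_ge_1 u_bounds cmin elim(2) pair_avg_second_moment_ge[OF eigenvalues_ge] second_moment_nonneg
        by unfold_locales (auto simp: all_balanced_def)
      define M' where "M' = hat_norm \<omega>"
      have risk: "R.risk (da \<omega>) (db \<omega>) (dm \<omega>) (dg \<omega>) = realized_risk \<omega>"
        by (simp add: R.risk_def realized_risk_def)
      have score: "pair_avg n (\<lambda>i j. noise i j \<omega> * (hat_increment i j \<omega>)) \<le> u * M'"
        using balanced_score[OF n, of u "\<lambda>i j. noise i j \<omega>" "\<lambda>i j. Z i j \<omega>" "da \<omega>" "db \<omega>" "dm \<omega>" "dg \<omega>"] bal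
        by (auto simp: all_balanced_def M'_def)
      have SAB: "SA \<subseteq> {1..n}" "SB \<subseteq> {1..n}" by (auto simp: SA_def SB_def)
      have basic: "R.risk (da \<omega>) (db \<omega>) (dm \<omega>) (dg \<omega>) \<le> u * hat_norm \<omega>
        + lb * (support_norm \<omega> - (node_l1 n (da \<omega>) (db \<omega>) / sqrt (real n) - support_norm \<omega>))"
        unfolding risk M'_def[symmetric] using elim(1) score by linarith
      have w1: "exp (- K) * w i j \<le> logistic_var (true_pred i j \<omega>)" if "(i, j) \<in> edge_pairs n" for i j
        using elim(3) that by (auto simp: w_def)
      have w2: "exp (- K) * \<rho> / 2 \<le> w i j" if "(i, j) \<in> edge_pairs n" for i j
        using base_variance_ge[OF that] by (simp add: w_def)
      note rate = R.sparse_rate[OF SAB s_def support_norm_def basic w1 w2 \<rho>(1) small1 small2 small3 \<kappa>]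
      have M': "M' \<le> 6 * s * lb / (\<kappa> * \<rho>)" using rate(1) by (simp add: M'_def)
      have M'0: "0 \<le> M'" by (simp add: M'_def increment_norm_nonneg)
      have loc: "c * sqrt (real n) * M' \<le> 1" using rate(3) by (simp add: M'_def)
      define E where "E = s * lb\<^sup>2 / (\<kappa> * \<rho>)"
      have lbM: "lb * M' \<le> 6 * E"
        using mult_left_mono[OF M', of lb] u_bounds by (simp add: E_def power2_eq_square mult_ac)
      have "hat_population_risk \<omega>
        \<le> 2 * exp K * pair_avg n (\<lambda>i j. w i j * ((da \<omega> i + db \<omega> j + dm \<omega>)\<^sup>2 + quad_form (second_moment i j) (dg \<omega>)))"
        by (rule population_risk_le_quadratic) (use rate(3) AE_variance(2) in \<open>auto simp: w_def\<close>)
      also have "\<dots> \<le> 2 * exp K * (3 * exp K * R.risk (da \<omega>) (db \<omega>) (dm \<omega>) (dg \<omega>) + 2 * c * u * M'\<^sup>2)"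
        using R.weighted_population_le[OF rate(3) w1] by (intro mult_left_mono) (auto simp: M'_def)
      also have "\<dots> \<le> 2 * exp K * (3 * exp K * (4 * E) + 6 * E)"
      proof (intro mult_left_mono add_mono)
        show "R.risk (da \<omega>) (db \<omega>) (dm \<omega>) (dg \<omega>) \<le> 4 * E" using rate(2) by (simp add: E_def)
        \<comment> \<open>The deviation is quadratic in M', but localisation gives c M' \<le> 1, so
          one power is spent there and the other remains in lb M'.\<close>
        have "2 * c * u * M'\<^sup>2 = (2 * u) * M' * (c * M')" by (simp add: power2_eq_square)
        also have "\<dots> \<le> lb * M' * 1"
        proof (intro mult_mono)
          have "c * M' * 1 \<le> c * M' * sqrt (real n)" using c M'0 n_pos by (intro mult_left_mono) auto
          then show "c * M' \<le> 1" using loc by (simp add: mult_ac)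
        qed (use u_bounds M'0 c in auto)
        finally show "2 * c * u * M'\<^sup>2 \<le> 6 * E" using lbM by linarith
      qed auto
      finally have "error \<omega> \<le> 2 * exp K * (3 * exp K * (4 * E) + 6 * E) + 6 * E"
        using lbM by (simp add: error_def M'_def)
      also have "\<dots> = (2 * exp K * (12 * exp K + 6) + 6) / \<kappa> * (s * lb\<^sup>2 / \<rho>)"
        by (simp add: E_def algebra_simps add_divide_distrib)
      finally show "error \<omega> \<le> (2 * exp K * (12 * exp K + 6) + 6) / \<kappa> * (s * lb\<^sup>2 / \<rho>)" .
    qed
  qed
  ultimately show ?thesis using D(1) by (intro bexI[of _ D] conjI)
qed

end

section \<open>The estimator in the homogeneous regime\<close>

text \<open>Unlike \<open>balanced_score\<close>, this separates two levels: the node part, which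
  the penalty absorbs, keeps u, and the unpenalised part gets the finer v.\<close>

lemma score_le_node_vec:
  assumes n: "2 \<le> n" and bal: "balanced n u X"
    and v: "\<bar>pair_avg n X\<bar> \<le> v" "\<And>k. \<bar>pair_avg n (\<lambda>i j. X i j * z i j $ k)\<bar> \<le> v"
  shows "\<bar>pair_avg n (\<lambda>i j. X i j * (a i + b j + m + g \<bullet> z i j))\<bar>
    \<le> u * (node_l1 n a b / sqrt (real n)) + v * (\<bar>m\<bar> + vec_l1 g)"
proof -
  have "pair_avg n (\<lambda>i j. X i j * (a i + b j + m + g \<bullet> z i j))
      = pair_avg n (\<lambda>i j. X i j * (a i + b j + 0) + m * X i j + (\<Sum>k\<in>UNIV. g $ k * (X i j * z i j $ k)))"
    by (intro pair_avg_cong) (simp add: algebra_simps inner_vec_def sum_distrib_left)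
  also have "\<dots> = pair_avg n (\<lambda>i j. X i j * (a i + b j + 0)) + m * pair_avg n X
      + (\<Sum>k\<in>UNIV. g $ k * pair_avg n (\<lambda>i j. X i j * z i j $ k))"
    by (simp only: pair_avg_add pair_avg_cmult pair_avg_sum)
  finally have eq: "pair_avg n (\<lambda>i j. X i j * (a i + b j + m + g \<bullet> z i j))
    = pair_avg n (\<lambda>i j. X i j * (a i + b j + 0)) + m * pair_avg n X
      + (\<Sum>k\<in>UNIV. g $ k * pair_avg n (\<lambda>i j. X i j * z i j $ k))" .
  have "\<bar>\<Sum>k\<in>UNIV. g $ k * pair_avg n (\<lambda>i j. X i j * z i j $ k)\<bar> \<le> (\<Sum>k\<in>UNIV. \<bar>g $ k\<bar> * v)"
    by (rule order_trans[OF sum_abs]) (use v(2) in \<open>auto simp: abs_mult intro!: sum_mono mult_left_mono\<close>)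
  then have 1: "\<bar>\<Sum>k\<in>UNIV. g $ k * pair_avg n (\<lambda>i j. X i j * z i j $ k)\<bar> \<le> v * vec_l1 g"
    by (simp add: vec_l1_def sum_distrib_left mult.commute)
  have "\<bar>m * pair_avg n X\<bar> \<le> v * \<bar>m\<bar>"
    using mult_right_mono[OF v(1), of "\<bar>m\<bar>"] by (simp add: abs_mult mult.commute)
  then show ?thesis
    using 1 balanced_pair_avg[OF n bal, of a b 0] unfolding eq by (simp add: distrib_left)
qed

context estimation_model
begin

text \<open>With \<tau> = 1 / (N \<rho>) one has ln (1 / \<rho>) = ln N + ln \<tau> \<le> 2 L0 +
  \<tau>. The assumption says Q \<tau> \<ge> 1, so both terms are multiples of L0 \<tau>, which
  \<open>lb_square\<close> bounds. In the second claim, lb > 1 is covered by ln (1 / \<rho>) \<le> 1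
  / \<rho>.\<close>

lemma radius_le:
  assumes Q: "\<rho> * real (num_pairs n) \<le> Q"
  shows "r \<le> (Q + 1) * (lb\<^sup>2 / \<rho>)" and "r \<le> (Q + 1) * (lb / \<rho>)"
proof -
  define N where "N = real (num_pairs n)"
  have N: "0 < N" using N_pos by (simp add: N_def)
  define \<tau> where "\<tau> = 1 / (N * \<rho>)"
  have \<tau>: "0 < \<tau>" using N \<rho> by (simp add: \<tau>_def)
  have Q\<tau>: "1 \<le> Q * \<tau>" using Q N \<rho> by (simp add: \<tau>_def N_def pos_le_divide_eq mult.commute)
  have "0 < \<rho> * N" using N \<rho> by simp
  then have Q0: "0 < Q" using Q unfolding N_def by linarith
  have r1: "r \<le> ln (1 / \<rho>)"
  proof -
    have "r = ln ((1 - \<rho>) / \<rho>)" unfolding r using \<rho> by (simp add: ln_div)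
    also have "\<dots> \<le> ln (1 / \<rho>)" using \<rho> by (subst ln_le_cancel_iff) (auto intro!: divide_right_mono)
    finally show ?thesis .
  qed
  have "ln (1 / \<rho>) = ln N + ln \<tau>"
    using N \<rho> by (simp add: \<tau>_def ln_mult ln_div)
  also have "ln \<tau> \<le> \<tau>" using \<tau> ln_le_minus_one[of \<tau>] by simp
  also have "ln N \<le> 2 * L0"
  proof -
    have "N \<le> (real n)\<^sup>2" unfolding N_def using n by (simp add: real_num_pairs power2_eq_square)
    also have "\<dots> \<le> (2 * real (2 * n + CARD('p) + 1))\<^sup>2" by (intro power_mono) auto
    finally have "ln N \<le> ln ((2 * real (2 * n + CARD('p) + 1))\<^sup>2)"
      using N by (subst ln_le_cancel_iff) auto
    also have "\<dots> = 2 * L0" unfolding L0 by (subst ln_realpow) auto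
    finally show ?thesis .
  qed
  finally have "ln (1 / \<rho>) \<le> 2 * L0 * 1 + 1 * \<tau>" by simp
  also have "\<dots> \<le> 2 * L0 * (Q * \<tau>) + L0 * \<tau>"
    using L0_ge Q\<tau> \<tau> by (intro add_mono mult_left_mono mult_right_mono) auto
  also have "\<dots> = (Q + 1 / 2) * (2 * L0 / N / \<rho>)"
  proof -
    have "2 * L0 / N / \<rho> = 2 * L0 * \<tau>" by (simp add: \<tau>_def)
    then show ?thesis by (simp add: algebra_simps)
  qed
  also have "\<dots> \<le> (Q + 1) * (lb\<^sup>2 / \<rho>)"
    using lb_square(1) Q0 \<rho> L0_ge N
    by (intro mult_mono divide_right_mono) (auto simp: N_def)
  finally show 2: "r \<le> (Q + 1) * (lb\<^sup>2 / \<rho>)" using r1 by linarith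
  show "r \<le> (Q + 1) * (lb / \<rho>)"
  proof (cases "lb \<le> 1")
    case True
    then have "lb\<^sup>2 \<le> lb" using u_bounds by (simp add: power2_eq_square mult_left_le)
    then have "(Q + 1) * (lb\<^sup>2 / \<rho>) \<le> (Q + 1) * (lb / \<rho>)"
      using Q0 \<rho> by (intro mult_left_mono divide_right_mono) auto
    then show ?thesis using 2 by linarith
  next
    case False
    have "r \<le> 1 / \<rho>" using r1 ln_le_minus_one[of "1 / \<rho>"] \<rho> by simp
    also have "\<dots> \<le> lb / \<rho>" using False \<rho> by (intro divide_right_mono) auto
    also have "\<dots> = 1 * (lb / \<rho>)" by simp
    also have "\<dots> \<le> (Q + 1) * (lb / \<rho>)"
      using Q0 u_bounds \<rho> by (intro mult_right_mono) auto
    finally show ?thesis .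
  qed
qed

lemma local_space_bound:
  assumes "\<theta> \<in> local_space n q z" "(i, j) \<in> edge_pairs n"
  shows "\<bar>lin_pred z \<theta> i j\<bar> \<le> q"
proof -
  have "\<bar>lin_pred z \<theta> i j\<bar> \<le> (MAX (i, j)\<in>edge_pairs n. \<bar>lin_pred z \<theta> i j\<bar>)"
    by (rule Max_ge[OF finite_imageI[OF finite_edge_pairs]], rule image_eqI[OF _ assms(2)]) simp
  then show ?thesis using assms(1) by (simp add: local_space_def)
qed

lemma AE_increment_local:
  "AE \<omega> in M. \<forall>(i, j)\<in>edge_pairs n. \<bar>hat_increment i j \<omega>\<bar> \<le> 2 * r"
  using true_local estimator
proof eventually_elim
  case (elim \<omega>)
  then have hat: "\<theta>hat \<omega> \<in> local_space n r (\<lambda>i j. Z i j \<omega>)" by (simp add: is_arg_min_def)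
  have "\<bar>hat_increment i j \<omega>\<bar> \<le> 2 * r" if "(i, j) \<in> edge_pairs n" for i j
    using local_space_bound[OF hat that] local_space_bound[OF elim(1) that]
    unfolding lin_pred_hat lin_pred_true by linarith
  then show ?case by blast
qed

lemma lb_square_le: "1 / real (num_pairs n) \<le> lb\<^sup>2 / \<rho>"
proof -
  have "lb\<^sup>2 * 1 \<le> lb\<^sup>2 * (1 / \<rho>)" using \<rho> by (intro mult_left_mono) auto
  then show ?thesis using lb_square(2) by simp
qed

(* The Chebyshev level v is of the order sqrt (W / N). If the curvature W is large compared with v,
   it controls the error; otherwise W is at most a multiple of 1 / N, so that \<rho> is tiny and
   the trivial bound by the radius of the local space is good enough. *)
lemma homogeneous_bound:
  assumes zero: "SA = {}" "SB = {}"
    and \<kappa>: "\<kappa> = cmin / (2 * (real CARD('p) + 1))"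
    and large: "2 * c * u \<le> \<kappa>" "3 * c / sqrt (real n) \<le> \<kappa> / 2"
    and \<epsilon>: "0 < \<epsilon>" "\<epsilon> \<le> sqrt (real n) * lb / \<rho>"
    and \<delta>: "0 < \<delta>"
    and B1: "B1 = (1 + real CARD('p)) * c\<^sup>2 * exp K / \<delta> * exp K / \<kappa>"
    and B2: "B2 = 64 * exp 4 * c\<^sup>2 * (exp K)\<^sup>2 * B1 / \<kappa>"
    and B3: "B3 = 2 * (exp K)\<^sup>2 * B1 / \<kappa>"
    and C: "C = B2 + 16 * B1 / \<epsilon> + 16 * B1 + 8 * (1 + B3) + 4 * c / \<kappa> * (c + 3) * (16 * c\<^sup>2 * B3 + 1)"
  shows "\<exists>D\<in>events. prob D \<le> (1 + real CARD('p))\<^sup>2 * (1 / real n) + \<delta> \<and>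
    (AE \<omega> in M. \<omega> \<notin> D \<longrightarrow> error \<omega> \<le> C * (lb\<^sup>2 / \<rho>))"
proof -
  define N where "N = real (num_pairs n)"
  define W where "W = logistic_var (mu \<theta>0)"
  define k1 where "k1 = (1 + real CARD('p)) * c\<^sup>2 * exp K / \<delta>"
  \<comment> \<open>Chosen so that the Chebyshev failure probability is exactly \<delta>.\<close>
  define v where "v = sqrt (k1 * W / N)"
  define H where "H = exp (- K) * W * \<kappa>"
  define R where "R = lb\<^sup>2 / \<rho>"
  have c: "0 < c" using c_ge_1 by simp
  have N: "0 < N" using N_pos by (simp add: N_def)
  have W: "0 < W" by (simp add: W_def logistic_var_pos)
  have \<kappa>0: "0 < \<kappa>" using cmin by (simp add: \<kappa> add_nonneg_pos)
  have k1: "0 < k1" using c \<delta> by (auto simp: k1_def intro!: divide_pos_pos mult_pos_pos add_pos_nonneg)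
  have v2: "v\<^sup>2 = k1 * W / N" using k1 W N by (simp add: v_def)
  have v: "0 < v" using k1 W N by (simp add: v_def)
  have H: "0 < H" using W \<kappa>0 by (simp add: H_def)
  have R: "0 < R" using u_bounds \<rho> by (simp add: R_def)
  have NR: "1 / N \<le> R" using lb_square_le by (simp add: N_def R_def)
  have B1': "B1 = k1 * exp K / \<kappa>" by (simp add: B1 k1_def)
  have B: "0 < B1" "0 < B2" "0 < B3" using k1 \<kappa>0 c by (auto simp: B1' B2 B3)
  have base: "base i j = mu \<theta>0" if "(i, j) \<in> edge_pairs n" for i j
    using zero that by (auto simp: base_def SA_def SB_def edge_pairs_def)
  \<comment> \<open>The variance W cancels between squared noise level and curvature: their ratio is
    of order 1 / N whatever the density.\<close>
  have v2H: "v\<^sup>2 / H = B1 / N"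
    using W by (simp add: v2 H_def B1' exp_minus field_simps)
  have W_ge: "exp (- K) * \<rho> / 2 \<le> W"
  proof -
    obtain i j where ij: "(i, j) \<in> edge_pairs n" using edge_pairs_nonempty[OF n] by fastforce
    show ?thesis using base_variance_ge[OF ij] base[OF ij] by (simp add: W_def)
  qed
  have H_ge: "\<kappa> * \<rho> / (2 * (exp K)\<^sup>2) \<le> H"
  proof -
    have "exp (- K) * (exp (- K) * \<rho> / 2) * \<kappa> \<le> H"
      unfolding H_def using W_ge \<kappa>0 by (intro mult_right_mono mult_left_mono) auto
    then show ?thesis by (simp add: exp_minus field_simps power2_eq_square)
  qed
  have \<sigma>: "AE \<omega> in M. logistic_var (true_pred i j \<omega>) \<le> exp K * W" if "(i, j) \<in> edge_pairs n" for i j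
    using AE_variance(2)[OF that] base[OF that] by (simp add: W_def)
  have one: "0 \<le> (1 :: real) \<and> (1 :: real) \<le> 1" by simp
  have one: "0 \<le> (1 :: real) \<and> (1 :: real) \<le> 1" by simp
  have one: "0 \<le> (1 :: real) \<and> (1 :: real) \<le> 1" by simp
  have one: "0 \<le> (1 :: real) \<and> (1 :: real) \<le> 1" by simp
  have one: "0 \<le> (1 :: real) \<and> (1 :: real) \<le> 1" by simp
  have one: "0 \<le> (1 :: real) \<and> (1 :: real) \<le> 1" by simp
  have one: "0 \<le> (1 :: real) \<and> (1 :: real) \<le> 1" by simp
  obtain D1 where D1: "D1 \<in> events"
    "prob D1 \<le> (1 + real CARD('p))\<^sup>2 * ((4 * real n + 2) * exp (- (u\<^sup>2 * real (num_pairs n) / (2 * c\<^sup>2))))"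
    "\<forall>\<omega>\<in>space M - D1. all_balanced u (\<lambda>_ _. 1) \<omega>"
    using all_balanced_event[of "\<lambda>_ _. 1", OF one u_bounds(1)] by (elim bexE conjE) (rule that)
  obtain D2 where D2: "D2 \<in> events"
    "prob D2 \<le> (1 + real CARD('p)) * (c\<^sup>2 * (exp K * W) / (real (num_pairs n) * v\<^sup>2))"
    "\<forall>\<omega>\<in>space M - D2. \<bar>pair_avg n (\<lambda>i j. noise i j \<omega>)\<bar> \<le> v \<and> (\<forall>k. \<bar>pair_avg n (\<lambda>i j. noise i j \<omega> * Z i j \<omega> $ k)\<bar> \<le> v)"
    using noise_variance_event[where \<sigma> = "exp K * W", OF _ v] \<sigma> by blast
  have p1: "prob D1 \<le> (1 + real CARD('p))\<^sup>2 * (1 / real n)"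
    by (rule order_trans[OF D1(2) mult_left_mono[OF tail_le]]) simp
  have "(1 + real CARD('p)) * (c\<^sup>2 * (exp K * W) / (real (num_pairs n) * v\<^sup>2)) = \<delta>"
  proof -
    have "real (num_pairs n) * v\<^sup>2 = k1 * W" using N by (simp add: v2 N_def)
    moreover have "(1 + real CARD('p)) * (c\<^sup>2 * (exp K * W)) = \<delta> * (k1 * W)"
      using \<delta> by (simp add: k1_def)
    ultimately show ?thesis using k1 W by simp
  qed
  then have "prob (D1 \<union> D2) \<le> (1 + real CARD('p))\<^sup>2 * (1 / real n) + \<delta>"
    using measure_Un_le[OF D1(1) D2(1)] p1 D2(2) by linarith
  moreover have "AE \<omega> in M. \<omega> \<notin> D1 \<union> D2 \<longrightarrow> error \<omega> \<le> C * R"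
    using basic_inequality AE_Z_bounded AE_variance_edges AE_increment_local AE_space
  proof eventually_elim
    case (elim \<omega>)
    show ?case
    proof
      assume \<omega>: "\<omega> \<notin> D1 \<union> D2"
      then have bal: "all_balanced u (\<lambda>_ _. 1) \<omega>" using D1(3) elim(5) by auto
      have cheb: "\<bar>pair_avg n (\<lambda>i j. noise i j \<omega>)\<bar> \<le> v" "\<bar>pair_avg n (\<lambda>i j. noise i j \<omega> * Z i j \<omega> $ k)\<bar> \<le> v" for k
        using D2(3) \<omega> elim(5) by auto
      have curv: "exp (- K) * W \<le> logistic_var (true_pred i j \<omega>)" if "(i, j) \<in> edge_pairs n" for i j
        using elim(3) that base[OF that] unfolding W_def by fastforce
      interpret R: homogeneous_realization n "\<lambda>i j. Z i j \<omega>" second_moment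
        "\<lambda>i j. true_pred i j \<omega>" c u lb cmin K W \<kappa>
        using bal n c_ge_1 u_bounds cmin elim(2) pair_avg_second_moment_ge[OF eigenvalues_ge] second_moment_nonneg
          \<kappa> W large curv
        by unfold_locales (auto simp: all_balanced_def)
      define M' where "M' = hat_norm \<omega>"
      define Y where "Y = node_l1 n (da \<omega>) (db \<omega>) / sqrt (real n)"
      define T where "T = \<bar>dm \<omega>\<bar> + vec_l1 (dg \<omega>)"
      have T0: "0 \<le> T" by (simp add: T_def vec_l1_nonneg)
      have Y0: "0 \<le> Y" by (simp add: Y_def node_l1_nonneg)
      have M'_eq: "M' = Y + T" by (simp add: M'_def Y_def T_def increment_norm_def)
      have err: "error \<omega> = hat_population_risk \<omega> + (lb * Y + lb * T)"
        by (simp add: error_def M'_def[symmetric] M'_eq distrib_left)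
      have Yn: "node_l1 n (da \<omega>) (db \<omega>) / real n = Y / sqrt (real n)"
        using n by (simp add: Y_def)
      have risk: "R.risk (da \<omega>) (db \<omega>) (dm \<omega>) (dg \<omega>) = realized_risk \<omega>"
        by (simp add: R.risk_def realized_risk_def)
      have basic: "realized_risk \<omega> + lb * Y
        \<le> pair_avg n (\<lambda>i j. noise i j \<omega> * (hat_increment i j \<omega>))"
        using elim(1) by (simp add: support_norm_def zero Y_def)
      have score: "pair_avg n (\<lambda>i j. noise i j \<omega> * (hat_increment i j \<omega>)) \<le> u * M'"
        using balanced_score[OF n, of u "\<lambda>i j. noise i j \<omega>" "\<lambda>i j. Z i j \<omega>" "da \<omega>" "db \<omega>" "dm \<omega>" "dg \<omega>"] bal
        by (auto simp: all_balanced_def M'_def)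
      have score2: "pair_avg n (\<lambda>i j. noise i j \<omega> * (hat_increment i j \<omega>)) \<le> u * Y + v * T"
        using score_le_node_vec[OF n, of u "\<lambda>i j. noise i j \<omega>" v "\<lambda>i j. Z i j \<omega>" "da \<omega>" "db \<omega>" "dm \<omega>" "dg \<omega>"] bal cheb
        by (auto simp: all_balanced_def Y_def T_def)
      have cone: "R.risk (da \<omega>) (db \<omega>) (dm \<omega>) (dg \<omega>) + lb * (node_l1 n (da \<omega>) (db \<omega>) / sqrt (real n))
        \<le> u * hat_norm \<omega>"
        unfolding risk Y_def[symmetric] M'_def[symmetric] using basic score by linarith
      have YT: "Y \<le> T" using R.node_cone[OF cone] by (simp add: Y_def T_def)
      show "error \<omega> \<le> C * R"
      proof (cases "4 * v * c \<le> H")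
        case True
        have basic2: "R.risk (da \<omega>) (db \<omega>) (dm \<omega>) (dg \<omega>) + lb * (node_l1 n (da \<omega>) (db \<omega>) / sqrt (real n))
          \<le> u * (node_l1 n (da \<omega>) (db \<omega>) / sqrt (real n)) + v * (\<bar>dm \<omega>\<bar> + vec_l1 (dg \<omega>))"
          unfolding risk Y_def[symmetric] T_def[symmetric] using basic score2 by linarith
        note rate = R.rate_by_curvature[OF cone basic2 less_imp_le[OF v] True[unfolded H_def]]
        have T: "T \<le> 8 * v / H" using rate(1) by (simp add: T_def H_def)
        have "lb * Y \<le> 2 * v * T" using rate(2) by (simp add: Y_def T_def)
        also have "\<dots> \<le> 2 * v * (8 * v / H)" using T v by (intro mult_left_mono) auto
        also have "\<dots> = 16 * (v\<^sup>2 / H)" by (simp add: power2_eq_square)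
        finally have lbY: "lb * Y \<le> 16 * B1 * (1 / N)" by (simp add: v2H)
        then have e1: "lb * Y \<le> 16 * B1 * R" using mult_left_mono[OF NR, of "16 * B1"] B by simp
        \<comment> \<open>The term Y / sqrt n comes without the penalty factor. The lower bound
          \<epsilon> \<rho> \<le> sqrt n lb, available because the sparse regime is left, allows it
          to be recovered from lb Y.\<close>
        have e2: "Y / sqrt (real n) \<le> 16 * B1 / \<epsilon> * R"
        proof -
          have \<epsilon>': "\<epsilon> * \<rho> \<le> sqrt (real n) * lb" using \<epsilon> \<rho> by (simp add: pos_le_divide_eq)
          have "Y / sqrt (real n) = (lb * Y) / (sqrt (real n) * lb)" using u_bounds by simp
          also have "\<dots> \<le> (16 * B1 * (1 / N)) / (\<epsilon> * \<rho>)"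
            using lbY \<epsilon> \<epsilon>' \<rho> B N by (intro frac_le) auto
          also have "\<dots> = 16 * B1 / \<epsilon> * ((1 / N) / \<rho>)" by simp
          also have "\<dots> \<le> 16 * B1 / \<epsilon> * R"
            unfolding R_def using lb_square(2) B \<epsilon> \<rho>
            by (intro mult_left_mono divide_right_mono) (auto simp: N_def)
          finally show ?thesis .
        qed
        \<comment> \<open>Compared by squares, since only v^2 / H is known. Bounding B3 by (1 +
          B3)^2 makes the right-hand side a perfect square.\<close>
        have vH: "v / H \<le> (1 + B3) * (lb / \<rho>)"
        proof (rule power2_le_imp_le)
          have "(v / H)\<^sup>2 = (v\<^sup>2 / H) * (1 / H)" by (simp add: power2_eq_square)
          also have "\<dots> \<le> (B1 / N) * (2 * (exp K)\<^sup>2 / (\<kappa> * \<rho>))"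
          proof (rule mult_mono)
            have "1 / H \<le> 1 / (\<kappa> * \<rho> / (2 * (exp K)\<^sup>2))"
              using H_ge \<kappa>0 \<rho> H by (intro divide_left_mono) auto
            then show "1 / H \<le> 2 * (exp K)\<^sup>2 / (\<kappa> * \<rho>)" by simp
          qed (use v2H B N H in auto)
          also have "\<dots> = B3 * ((1 / N) / \<rho>)" by (simp add: B3 mult_ac)
          also have "\<dots> \<le> (1 + B3)\<^sup>2 * (lb\<^sup>2 / \<rho>\<^sup>2)"
          proof (intro mult_mono)
            show "B3 \<le> (1 + B3)\<^sup>2" using B by (simp add: power2_eq_square algebra_simps)
            have "(1 / N) / \<rho> \<le> lb\<^sup>2 / \<rho>"
              using lb_square(2) \<rho> by (intro divide_right_mono) (auto simp: N_def)
            also have "\<dots> \<le> lb\<^sup>2 / \<rho>\<^sup>2"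
              using \<rho> by (intro divide_left_mono) (auto simp: power2_eq_square mult_left_le)
            finally show "(1 / N) / \<rho> \<le> lb\<^sup>2 / \<rho>\<^sup>2" .
          qed (use N \<rho> in auto)
          also have "\<dots> = ((1 + B3) * (lb / \<rho>))\<^sup>2" by (simp add: power_mult_distrib power_divide)
          finally show "(v / H)\<^sup>2 \<le> ((1 + B3) * (lb / \<rho>))\<^sup>2" .
        qed (use B u_bounds \<rho> in auto)
        have e3: "lb * T \<le> 8 * (1 + B3) * R"
        proof -
          have "lb * T \<le> lb * (8 * ((1 + B3) * (lb / \<rho>)))"
            using T vH u_bounds by (intro mult_left_mono) auto
          also have "\<dots> = 8 * (1 + B3) * R" by (simp add: R_def power2_eq_square)
          finally show ?thesis .
        qed
        \<comment> \<open>The case assumption caps c T at 2, which keeps the exponential in the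
          mixed risk bound below exp 4.\<close>
        have cT: "c * T \<le> c * (8 * v / H)" using T c by (intro mult_left_mono) auto
        have "c * (8 * v / H) = 2 * (4 * v * c) / H" by simp
        also have "\<dots> \<le> 2" using True H by (simp add: pos_divide_le_eq mult_ac)
        finally have cT2: "c * T \<le> 2" using cT by linarith
        \<comment> \<open>Written as (W / H) * (v^2 / H), both factors are free of W, so the
          quadratic part of the risk is of order 1 / N.\<close>
        have e4: "exp K * W * (c * T)\<^sup>2 * exp (2 * (c * T)) \<le> B2 * R"
        proof -
          have "exp K * W * (c * T)\<^sup>2 * exp (2 * (c * T)) \<le> exp K * W * (c * (8 * v / H))\<^sup>2 * exp 4"
          proof (rule mult_mono)
            have "(c * T)\<^sup>2 \<le> (c * (8 * v / H))\<^sup>2" using c T0 by (intro power_mono[OF cT]) auto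
            then show "exp K * W * (c * T)\<^sup>2 \<le> exp K * W * (c * (8 * v / H))\<^sup>2"
              using W by (intro mult_left_mono) auto
            have "2 * (c * T) \<le> 4" using cT2 by linarith
            then show "exp (2 * (c * T)) \<le> exp 4" by (subst exp_le_cancel_iff)
          qed (use W in auto)
          also have "\<dots> = (exp K * exp 4 * 64 * c\<^sup>2) * ((W / H) * (v\<^sup>2 / H))"
            by (simp add: power2_eq_square)
          also have "W / H = exp K / \<kappa>" using W by (simp add: H_def exp_minus field_simps)
          also have "v\<^sup>2 / H = B1 / N" by (rule v2H)
          also have "(exp K * exp 4 * 64 * c\<^sup>2) * (exp K / \<kappa> * (B1 / N)) = B2 * (1 / N)"
            by (simp add: B2 power2_eq_square)
          also have "\<dots> \<le> B2 * R" using NR B by (intro mult_left_mono) auto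
          finally show ?thesis .
        qed
        have "hat_population_risk \<omega>
          \<le> exp K * W * (c * T)\<^sup>2 * exp (2 * (c * T)) + Y / sqrt (real n)"
          unfolding Yn[symmetric] by (rule population_risk_le_mixed[OF \<sigma> T_def])
        then have "error \<omega> \<le> (B2 + 16 * B1 / \<epsilon> + 16 * B1 + 8 * (1 + B3)) * R"
          unfolding err distrib_right using e1 e2 e3 e4 by linarith
        also have "\<dots> \<le> C * R"
          unfolding C using R B \<kappa>0 c by (intro mult_right_mono) auto
        finally show ?thesis .
      next
        case False
        define Q where "Q = 16 * c\<^sup>2 * B3"
        \<comment> \<open>Squaring H < 4 v c and dividing by H leaves v^2 / H, which is of order 1 /
          N. As H dominates a multiple of \<rho>, the product \<rho> N stays bounded.\<close>
        have "H < 16 * c\<^sup>2 * B1 / N"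
        proof -
          have "H * H < (4 * v * c) * (4 * v * c)" using False H c v by (intro mult_strict_mono) auto
          then have "H * H < 16 * c\<^sup>2 * (v\<^sup>2 / H) * H" using H by (simp add: power2_eq_square mult_ac)
          then have "H < 16 * c\<^sup>2 * (v\<^sup>2 / H)" using H by (simp only: mult_less_cancel_right_pos)
          then show ?thesis by (simp add: v2H)
        qed
        then have "\<kappa> * \<rho> / (2 * (exp K)\<^sup>2) \<le> 16 * c\<^sup>2 * B1 / N" using H_ge by linarith
        then have "\<rho> * N \<le> 16 * c\<^sup>2 * B1 * (2 * (exp K)\<^sup>2) / \<kappa>"
          using N \<kappa>0 by (simp add: field_simps)
        then have "\<rho> * real (num_pairs n) \<le> Q" by (simp add: Q_def B3 N_def mult_ac)
        note r_le = radius_le[OF this]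
        have Q: "0 \<le> Q" using B by (simp add: Q_def)
        have "T \<le> 4 * c * r / \<kappa>"
          unfolding T_def by (rule R.rate_by_local_space[OF cone]) (use elim(4) in auto)
        then have T: "T \<le> 4 * c / \<kappa> * r" by simp
        have T1: "T \<le> 4 * c / \<kappa> * ((Q + 1) * R)"
          using mult_left_mono[OF r_le(1), of "4 * c / \<kappa>"] T c \<kappa>0 unfolding R_def by simp
        have T2: "lb * T \<le> 4 * c / \<kappa> * ((Q + 1) * R)"
        proof -
          have "T \<le> 4 * c / \<kappa> * ((Q + 1) * (lb / \<rho>))"
            using mult_left_mono[OF r_le(2), of "4 * c / \<kappa>"] T c \<kappa>0 by simp
          then have "lb * T \<le> lb * (4 * c / \<kappa> * ((Q + 1) * (lb / \<rho>)))"
            using u_bounds by (intro mult_left_mono) auto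
          then show ?thesis by (simp add: R_def power2_eq_square mult_ac)
        qed
        have "Y / sqrt (real n) \<le> Y / 1" using n_pos Y0 by (intro divide_left_mono) auto
        then have "hat_population_risk \<omega> \<le> c * T + T"
          using population_risk_le_linear[of "da \<omega>" "db \<omega>" "dm \<omega>" "dg \<omega>"] YT
          unfolding Yn T_def[symmetric] by simp
        moreover have "lb * Y \<le> lb * T" using YT u_bounds by (intro mult_left_mono) auto
        moreover define X where "X = 4 * c / \<kappa> * ((Q + 1) * R)"
        have X: "T \<le> X" "lb * T \<le> X" using T1 T2 by (simp_all only: X_def)
        moreover have "c * T \<le> c * X" using X c by (intro mult_left_mono) auto
        ultimately have "error \<omega> \<le> c * X + 3 * X" unfolding err by linarith
        also have "\<dots> = (4 * c / \<kappa> * (c + 3) * (Q + 1)) * R" unfolding X_def by algebra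
        also have "\<dots> \<le> C * R"
          unfolding C Q_def[symmetric] using R B \<epsilon> by (intro mult_right_mono) auto
        finally show ?thesis .
      qed
    qed
  qed
  ultimately show ?thesis
    using D1(1) D2(1) unfolding R_def by (intro bexI[of _ "D1 \<union> D2"] conjI) auto
qed

section \<open>Measurability and tightness of the error\<close>

lemma population_risk_measurable:
  assumes a: "\<And>i. i \<in> {1..n} \<Longrightarrow> (\<lambda>\<omega>. a \<omega> i) \<in> borel_measurable M"
    and b: "\<And>j. j \<in> {1..n} \<Longrightarrow> (\<lambda>\<omega>. b \<omega> j) \<in> borel_measurable M"
    and [measurable]: "m \<in> borel_measurable M" "g \<in> borel_measurable M"
  shows "(\<lambda>\<omega>. population_risk (a \<omega>) (b \<omega>) (m \<omega>) (g \<omega>)) \<in> borel_measurable M"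
  unfolding population_risk_def pair_avg_def
proof (intro borel_measurable_divide borel_measurable_sum borel_measurable_const)
  fix e assume e: "e \<in> edge_pairs n"
  obtain i j where ij: "e = (i, j)" by (cases e)
  define x where "x \<omega> = a \<omega> i + b \<omega> j + m \<omega>" for \<omega>
  have x [measurable]: "x \<in> borel_measurable M"
    unfolding x_def using a b e ij by (intro borel_measurable_add) (auto simp: edge_pairs_def)
  have [measurable]: "Z i j \<in> borel_measurable M" using e ij Z_measurable by auto
  have "(\<lambda>\<omega>. \<integral>\<omega>'. bregman (base i j + gamma \<theta>0 \<bullet> Z i j \<omega>') (x \<omega> + g \<omega> \<bullet> Z i j \<omega>') \<partial>M) \<in> borel_measurable M"
  proof (rule borel_measurable_lebesgue_integral)
    show "(\<lambda>(\<omega>, \<omega>'). bregman (base i j + gamma \<theta>0 \<bullet> Z i j \<omega>') (x \<omega> + g \<omega> \<bullet> Z i j \<omega>'))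
      \<in> borel_measurable (M \<Otimes>\<^sub>M M)"
      unfolding split_def by (intro bregman_measurable) measurable
  qed
  then show "(\<lambda>\<omega>. case e of (i, j) \<Rightarrow> expectation (\<lambda>\<omega>'. bregman (base i j + gamma \<theta>0 \<bullet> Z i j \<omega>')
     (a \<omega> i + b \<omega> j + m \<omega> + g \<omega> \<bullet> Z i j \<omega>'))) \<in> borel_measurable M"
    by (simp add: ij x_def)
qed

lemma error_measurable: "error \<in> borel_measurable M"
proof -
  have a: "(\<lambda>\<omega>. da \<omega> i) \<in> borel_measurable M" if "i \<in> {1..n}" for i
    using estimator_measurable(1)[OF that] unfolding da_def by simp
  have b: "(\<lambda>\<omega>. db \<omega> i) \<in> borel_measurable M" if "i \<in> {1..n}" for i
    using estimator_measurable(2)[OF that] unfolding db_def by simp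
  have m [measurable]: "dm \<in> borel_measurable M"
    using estimator_measurable(3) unfolding dm_def[abs_def] by simp
  have g [measurable]: "dg \<in> borel_measurable M"
    using estimator_measurable(4) unfolding dg_def[abs_def] by simp
  have "(\<lambda>\<omega>. node_l1 n (da \<omega>) (db \<omega>)) \<in> borel_measurable M"
    unfolding node_l1_def using a b by (intro borel_measurable_add borel_measurable_sum borel_measurable_abs) auto
  moreover have "(\<lambda>\<omega>. vec_l1 (dg \<omega>)) \<in> borel_measurable M"
    unfolding vec_l1_def by measurable
  ultimately have "(\<lambda>\<omega>. hat_norm \<omega>) \<in> borel_measurable M"
    unfolding increment_norm_def using m
    by (intro borel_measurable_add borel_measurable_divide borel_measurable_abs borel_measurable_const)
  with population_risk_measurable[OF a b m g] show ?thesis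
    unfolding error_def[abs_def]
    by (intro borel_measurable_add borel_measurable_times borel_measurable_const)
qed

lemma prob_error_le_ge:
  assumes "D \<in> events" "AE \<omega> in M. \<omega> \<notin> D \<longrightarrow> error \<omega> \<le> x"
  shows "1 - prob D \<le> prob {\<omega> \<in> space M. error \<omega> \<le> x}"
proof -
  note [measurable] = error_measurable
  have "1 - prob D = prob (space M - D)" using assms(1) by (simp add: prob_compl)
  also have "\<dots> \<le> prob {\<omega> \<in> space M. error \<omega> \<le> x}"
  proof (rule finite_measure_mono_AE)
    show "AE \<omega> in M. \<omega> \<in> space M - D \<longrightarrow> \<omega> \<in> {\<omega> \<in> space M. error \<omega> \<le> x}"
      using assms(2) by eventually_elim blast
  qed measurable
  finally show ?thesis .
qed

text \<open>The sublevel sets of a real-valued variable exhaust the space, and continuity from below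
  brings their probability above any q strictly less than 1.\<close>

lemma error_tight:
  assumes "q < 1" shows "\<exists>x. \<forall>y\<ge>x. q \<le> prob {\<omega> \<in> space M. error \<omega> \<le> y}"
proof -
  note [measurable] = error_measurable
  define G where "G k = {\<omega> \<in> space M. error \<omega> \<le> real k}" for k :: nat
  have "(\<lambda>k. prob (G k)) \<longlonglongrightarrow> prob (\<Union>k. G k)"
  proof (rule finite_Lim_measure_incseq)
    have "G k \<in> events" for k unfolding G_def by measurable
    then show "range G \<subseteq> events" by blast
    show "incseq G"
    proof (rule incseq_SucI)
      show "G k \<subseteq> G (Suc k)" for k unfolding G_def by (auto intro: order_trans)
    qed
  qed
  moreover have "(\<Union>k. G k) = space M"
  proof
    show "space M \<subseteq> (\<Union>k. G k)"
    proof
      fix \<omega> assume "\<omega> \<in> space M"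
      moreover obtain k where "error \<omega> \<le> real k" using real_arch_simple by blast
      ultimately show "\<omega> \<in> (\<Union>k. G k)" unfolding G_def by blast
    qed
  qed (auto simp: G_def)
  ultimately have "(\<lambda>k. prob (G k)) \<longlonglongrightarrow> 1" by (simp add: prob_space)
  then have "\<forall>\<^sub>F k in sequentially. q < prob (G k)" using assms by (rule order_tendstoD(1))
  from eventually_happens'[OF sequentially_bot this] obtain k where k: "q < prob (G k)" by blast
  have "q \<le> prob {\<omega> \<in> space M. error \<omega> \<le> y}" if "real k \<le> y" for y
  proof -
    have "prob (G k) \<le> prob {\<omega> \<in> space M. error \<omega> \<le> y}"
    proof (rule finite_measure_mono)
      show "G k \<subseteq> {\<omega> \<in> space M. error \<omega> \<le> y}"
        unfolding G_def using that by (auto intro: order_trans)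
    qed measurable
    then show ?thesis using k by linarith
  qed
  then show ?thesis by blast
qed

end

section \<open>The oracle inequality\<close>

lemma vec_l1_le_norm: "vec_l1 (g :: real ^ 'p) \<le> real CARD('p) * norm g"
proof -
  have "vec_l1 g \<le> (\<Sum>k\<in>(UNIV :: 'p set). norm g)"
    unfolding vec_l1_def by (intro sum_mono component_le_norm_cart)
  then show ?thesis by simp
qed

lemma card_support: "card (support n \<theta>) = card {i \<in> {1..n}. alpha \<theta> i \<noteq> 0} + card {j \<in> {1..n}. beta \<theta> j \<noteq> 0}"
proof -
  define B where "B = {j \<in> {1..n}. beta \<theta> j \<noteq> 0}"
  have "support n \<theta> = {i \<in> {1..n}. alpha \<theta> i \<noteq> 0} \<union> (\<lambda>j. j + n) ` B"
  proof (intro equalityI subsetI)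
    fix k assume k: "k \<in> support n \<theta>"
    show "k \<in> {i \<in> {1..n}. alpha \<theta> i \<noteq> 0} \<union> (\<lambda>j. j + n) ` B"
    proof (cases "k \<le> n")
      case True
      then show ?thesis using k by (auto simp: support_def vartheta_def)
    next
      case False
      then have "k - n \<in> B" "k = k - n + n" using k by (auto simp: support_def vartheta_def B_def)
      then show ?thesis by blast
    qed
  qed (auto simp: support_def vartheta_def B_def)
  moreover have "card ((\<lambda>j. j + n) ` B) = card B" by (intro card_image) auto
  moreover have "{i \<in> {1..n}. alpha \<theta> i \<noteq> 0} \<inter> (\<lambda>j. j + n) ` B = {}" by (auto simp: B_def)
  ultimately show ?thesis by (simp add: card_Un_disjoint B_def)
qed

lemma vartheta_l1:
  "(\<Sum>k=1..2 * n. \<bar>vartheta n \<theta> k - vartheta n \<theta>' k\<bar>)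
    = node_l1 n (\<lambda>i. alpha \<theta> i - alpha \<theta>' i) (\<lambda>j. beta \<theta> j - beta \<theta>' j)"
proof -
  have "{1..2 * n} = {1..n} \<union> {n + 1..2 * n}" by auto
  then have "(\<Sum>k=1..2 * n. \<bar>vartheta n \<theta> k - vartheta n \<theta>' k\<bar>)
    = (\<Sum>k=1..n. \<bar>vartheta n \<theta> k - vartheta n \<theta>' k\<bar>) + (\<Sum>k=n + 1..2 * n. \<bar>vartheta n \<theta> k - vartheta n \<theta>' k\<bar>)"
    by (simp add: sum.union_disjoint)
  also have "(\<Sum>k=n + 1..2 * n. \<bar>vartheta n \<theta> k - vartheta n \<theta>' k\<bar>) = (\<Sum>j=1..n. \<bar>beta \<theta> j - beta \<theta>' j\<bar>)"
    by (rule sum.reindex_bij_witness[of _ "\<lambda>j. j + n" "\<lambda>k. k - n"]) (auto simp: vartheta_def)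
  also have "(\<Sum>k=1..n. \<bar>vartheta n \<theta> k - vartheta n \<theta>' k\<bar>) = (\<Sum>i=1..n. \<bar>alpha \<theta> i - alpha \<theta>' i\<bar>)"
    by (intro sum.cong) (auto simp: vartheta_def)
  finally show ?thesis by (simp add: node_l1_def)
qed

lemma a_rate_tendsto_0: "a_rate p c \<longlonglongrightarrow> 0"
proof -
  have "(\<lambda>n. sqrt (2 * ln (2 * (2 * real n + real p + 1)) / (real n * (real n - 1)))) \<longlonglongrightarrow> 0"
    by real_asymp
  then have "(\<lambda>n. sqrt (2 * ln (2 * (2 * real n + real p + 1)) / (real n * (real n - 1))) * max 1 c) \<longlonglongrightarrow> 0 * max 1 c"
    by (intro tendsto_mult tendsto_const)
  moreover have "\<forall>\<^sub>F n in sequentially. sqrt (2 * ln (2 * (2 * real n + real p + 1)) / (real n * (real n - 1))) * max 1 c = a_rate p c n"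
    using eventually_ge_at_top[of 1] by eventually_elim (simp add: a_rate_def real_num_pairs)
  ultimately show ?thesis using Lim_transform_eventually by fastforce
qed

context estimation_model
begin

lemma error_eq:
  "error \<omega> = excess_risk n M A Z \<theta>0 (\<theta>hat \<omega>) + lb *
     (1 / sqrt (real n) * (\<Sum>k=1..2 * n. \<bar>vartheta n (\<theta>hat \<omega>) k - vartheta n \<theta>0 k\<bar>)
       + \<bar>mu (\<theta>hat \<omega>) - mu \<theta>0\<bar> + (\<Sum>k\<in>UNIV. \<bar>gamma (\<theta>hat \<omega>) $ k - gamma \<theta>0 $ k\<bar>))"
  unfolding error_def excess_risk_eq vartheta_l1
  by (simp add: da_def[abs_def] db_def[abs_def] dm_def dg_def increment_norm_def vec_l1_def)

lemma s_eq: "s = real (card (support n \<theta>0) + CARD('p) + 1)"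
  by (simp add: s_def card_support SA_def SB_def)

end

theorem theorem5:
  fixes M :: "nat \<Rightarrow> 'a measure"
    and A :: "nat \<Rightarrow> nat \<Rightarrow> nat \<Rightarrow> 'a \<Rightarrow> real"
    and Z :: "nat \<Rightarrow> nat \<Rightarrow> nat \<Rightarrow> 'a \<Rightarrow> real ^ 'p"
    and \<theta>0 :: "nat \<Rightarrow> ('p :: finite) params"
    and \<theta>hat :: "nat \<Rightarrow> 'a \<Rightarrow> 'p params"
    and \<rho> r lam lambar :: "nat \<Rightarrow> real"
    and s0 :: "nat \<Rightarrow> nat"
    and \<Gamma> :: "(real ^ 'p) set"
    and c cmin Cmax t :: real
  assumes prob_space: "\<And>n. n \<ge> 2 \<Longrightarrow> prob_space (M n)"
    and adjacency: "\<And>n i j \<omega>. n \<ge> 2 \<Longrightarrow> i \<in> {1..n} \<Longrightarrow> j \<in> {1..n} \<Longrightarrow> \<omega> \<in> space (M n)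
          \<Longrightarrow> A n i j \<omega> \<in> {0, 1}"
    and no_loops: "\<And>n i \<omega>. n \<ge> 2 \<Longrightarrow> i \<in> {1..n} \<Longrightarrow> \<omega> \<in> space (M n) \<Longrightarrow> A n i i \<omega> = 0"
    and edges_cond_indep: "\<And>n. n \<ge> 2 \<Longrightarrow>
          cond_indep_vars (M n) (covariate_algebra n (M n) (Z n)) (\<lambda>_. borel)
            (\<lambda>(i, j). A n i j) (edge_pairs n)"
    and edges_prob: "\<And>n i j. n \<ge> 2 \<Longrightarrow> (i, j) \<in> edge_pairs n \<Longrightarrow>
          AE \<omega> in M n. real_cond_exp (M n) (covariate_algebra n (M n) (Z n))
              (indicator {\<omega> \<in> space (M n). A n i j \<omega> = 1}) \<omega>
            = link_prob (\<lambda>i j. Z n i j \<omega>) (\<theta>0 n) i j"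
    and true_param: "\<And>n. n \<ge> 2 \<Longrightarrow> \<theta>0 n \<in> param_space n"
    and alpha_min: "\<And>n. n \<ge> 2 \<Longrightarrow> (MIN i\<in>{1..n}. alpha (\<theta>0 n) i) = 0"
    and beta_min: "\<And>n. n \<ge> 2 \<Longrightarrow> (MIN j\<in>{1..n}. beta (\<theta>0 n) j) = 0"
    and s0: "\<And>n. s0 n = card (support n (\<theta>0 n))"
    and rho_range: "\<And>n. n \<ge> 2 \<Longrightarrow> 0 < \<rho> n \<and> \<rho> n \<le> 1 / 2"
    and link_bounds: "\<And>n i j. n \<ge> 2 \<Longrightarrow> (i, j) \<in> edge_pairs n \<Longrightarrow>
          AE \<omega> in M n. \<rho> n \<le> link_prob (\<lambda>i j. Z n i j \<omega>) (\<theta>0 n) i j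
            \<and> link_prob (\<lambda>i j. Z n i j \<omega>) (\<theta>0 n) i j \<le> 1 - \<rho> n"
    and r: "\<And>n. r n = - ln (\<rho> n / (1 - \<rho> n))"
    and Z_indep: "\<And>n. n \<ge> 2 \<Longrightarrow>
          prob_space.indep_vars (M n) (\<lambda>_. borel) (\<lambda>(i, j). Z n i j) (edge_pairs n)"
    and Z_centered: "\<And>n i j. n \<ge> 2 \<Longrightarrow> (i, j) \<in> edge_pairs n \<Longrightarrow> (\<integral>\<omega>. Z n i j \<omega> \<partial>M n) = 0"
    and c_pos: "0 < c"
    and Z_bounded: "\<And>n i j k. n \<ge> 2 \<Longrightarrow> (i, j) \<in> edge_pairs n \<Longrightarrow>
          AE \<omega> in M n. \<bar>Z n i j \<omega> $ k\<bar> \<le> c"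
    and Gamma: "compact \<Gamma>" "convex \<Gamma>"
    and gamma_in: "\<And>n. n \<ge> 2 \<Longrightarrow> gamma (\<theta>0 n) \<in> \<Gamma>"
    and cmin: "0 < cmin" "cmin < Cmax" "cmin < 1 / 2"
    and eigenvalues: "\<And>n. n \<ge> 2 \<Longrightarrow> eigenvalues (gram_matrix n (M n) (Z n)) \<subseteq> {cmin..Cmax}"
    and true_param_local: "\<And>n. n \<ge> 2 \<Longrightarrow>
          AE \<omega> in M n. \<theta>0 n \<in> local_space n (r n) (\<lambda>i j. Z n i j \<omega>)"
    and estimator_measurable: "\<And>n i. n \<ge> 2 \<Longrightarrow> i \<in> {1..n} \<Longrightarrow>
          (\<lambda>\<omega>. alpha (\<theta>hat n \<omega>) i) \<in> borel_measurable (M n)"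
          "\<And>n j. n \<ge> 2 \<Longrightarrow> j \<in> {1..n} \<Longrightarrow> (\<lambda>\<omega>. beta (\<theta>hat n \<omega>) j) \<in> borel_measurable (M n)"
          "\<And>n. n \<ge> 2 \<Longrightarrow> (\<lambda>\<omega>. mu (\<theta>hat n \<omega>)) \<in> borel_measurable (M n)"
          "\<And>n. n \<ge> 2 \<Longrightarrow> (\<lambda>\<omega>. gamma (\<theta>hat n \<omega>)) \<in> borel_measurable (M n)"
    and estimator: "\<And>n. n \<ge> 2 \<Longrightarrow>
          AE \<omega> in M n. is_arg_min
            (penalized_loss n (lam n) (\<lambda>i j. A n i j \<omega>) (\<lambda>i j. Z n i j \<omega>))
            (\<lambda>\<theta>. \<theta> \<in> local_space n (r n) (\<lambda>i j. Z n i j \<omega>))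
            (\<theta>hat n \<omega>)"
    and lambar_eq: "\<And>n. lambar n = sqrt (real n) * lam n"
    and rate: "(\<lambda>n. sqrt (real n) * real (s0 n) * inverse (\<rho> n) * lambar n) \<longlonglongrightarrow> 0"
    and t_pos: "0 < t"
    and lambar_ge: "\<And>n. n \<ge> 2 \<Longrightarrow>
          lambar n \<ge> 8 * (8 * a_rate CARD('p) c n
            + 2 * sqrt (t / real (num_pairs n) *
                (11 * max 1 (c\<^sup>2 * real CARD('p)) + 16 * max 1 c * sqrt (real n) * a_rate CARD('p) c n))
            + 4 * t * max 1 c * sqrt (real n) / (3 * real (num_pairs n)))"
  shows "\<exists>C>0. \<forall>n\<ge>2.
          measure (M n) {\<omega> \<in> space (M n).
            excess_risk n (M n) (A n) (Z n) (\<theta>0 n) (\<theta>hat n \<omega>)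
              + lambar n *
                (1 / sqrt (real n) * (\<Sum>k=1..2 * n. \<bar>vartheta n (\<theta>hat n \<omega>) k - vartheta n (\<theta>0 n) k\<bar>)
                 + \<bar>mu (\<theta>hat n \<omega>) - mu (\<theta>0 n)\<bar>
                 + (\<Sum>k\<in>UNIV. \<bar>gamma (\<theta>hat n \<omega>) $ k - gamma (\<theta>0 n) $ k\<bar>))
            \<le> C * (real (s0 n + CARD('p) + 1) * (lambar n)\<^sup>2 / \<rho> n)}
          \<ge> 1 - exp (- t)"
proof -
  \<comment> \<open>The covariate bound enlarged to at least 1, as the model locales require; it is
    also the factor inside the rate a_n.\<close>
  define cc where "cc = max 1 c"
  have cc: "1 \<le> cc" "0 < cc" "c \<le> cc" by (auto simp: cc_def)
  define p where "p = real CARD('p)"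
  have p: "0 < p" by (simp add: p_def)
  obtain G where G: "\<And>g. g \<in> \<Gamma> \<Longrightarrow> norm g \<le> G"
    using compact_imp_bounded[OF Gamma(1)] unfolding bounded_iff by blast
  \<comment> \<open>Compactness of \<Gamma> bounds gamma in norm by G, hence in l1 by p G, uniformly
    in n.\<close>
  define K where "K = cc * (p * G)"
  define L where "L n = ln (2 * real (2 * n + CARD('p) + 1))" for n
  define a where "a = a_rate CARD('p) c"
  have model: "estimation_model (M n) n (A n) (Z n) (\<theta>0 n) cc (\<theta>hat n) (\<rho> n) (r n) (lam n) (lambar n) K cmin (a n) (L n)"
    if n: "2 \<le> n" for n
  proof -
    note links = link_bounds[OF n]
    interpret prob_space "M n" by (rule prob_space[OF n])
    interpret edge_model "M n" n "A n" "Z n" "\<theta>0 n" cc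
    proof unfold_locales
      show "A n i j \<omega> \<in> {0, 1}" if "(i, j) \<in> edge_pairs n" "\<omega> \<in> space (M n)" for i j \<omega>
        using adjacency[OF n _ _ that(2), of i j] that(1) by (simp add: edge_pairs_def)
      show "AE \<omega> in M n. \<bar>Z n i j \<omega> $ k\<bar> \<le> cc" if "(i, j) \<in> edge_pairs n" for i j k
        using Z_bounded[OF n that, of k] by eventually_elim (use cc in linarith)
    qed (fact n edges_cond_indep[OF n] edges_prob[OF n] Z_indep[OF n] Z_centered[OF n] cc)+
    have a_eq: "a n = sqrt (2 * L n / real (num_pairs n)) * cc"
      by (simp add: a_def a_rate_def L_def cc_def)
    have L0: "0 \<le> L n" unfolding L_def by (rule ln_ge_zero) simp
    have a0: "0 \<le> a n" using L0 cc by (simp add: a_eq)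
    show ?thesis
    proof unfold_locales
      show "0 < \<rho> n" "\<rho> n \<le> 1 / 2" using rho_range[OF n] by auto
      show "cmin \<le> 1" using cmin by simp
      show "cmin \<le> e" if "e \<in> Defs.eigenvalues (gram_matrix n (M n) (Z n))" for e
        using eigenvalues[OF n] that by auto
      \<comment> \<open>The leading term of the lower bound on the penalty is 8 * 8 a_n; the two
        terms with t are nonnegative.\<close>
      show "64 * a n \<le> lambar n"
      proof -
        have "0 \<le> sqrt (t / real (num_pairs n) *
            (11 * max 1 (c\<^sup>2 * real CARD('p)) + 16 * max 1 c * sqrt (real n) * a n))"
          using t_pos a0 by (intro real_sqrt_ge_zero mult_nonneg_nonneg add_nonneg_nonneg divide_nonneg_nonneg) auto
        moreover have "0 \<le> 4 * t * max 1 c * sqrt (real n) / (3 * real (num_pairs n))"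
          using t_pos by (intro divide_nonneg_nonneg mult_nonneg_nonneg) auto
        moreover have "64 * x \<le> y" if "0 \<le> q" "0 \<le> q'" "8 * (8 * x + 2 * q + q') \<le> y" for x y q q' :: real
        proof -
          have "0 \<le> 8 * (2 * q + q')" using that by simp
          moreover have "8 * (8 * x + 2 * q + q') = 64 * x + 8 * (2 * q + q')" by simp
          ultimately show ?thesis using that(3) by linarith
        qed
        ultimately show ?thesis using lambar_ge[OF n] unfolding a_def by blast
      qed
      show "cc * vec_l1 (gamma (\<theta>0 n)) \<le> K"
      proof -
        have "vec_l1 (gamma (\<theta>0 n)) \<le> p * norm (gamma (\<theta>0 n))"
          unfolding p_def by (rule vec_l1_le_norm)
        also have "\<dots> \<le> p * G" using G[OF gamma_in[OF n]] p by (intro mult_left_mono) auto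
        finally show ?thesis unfolding K_def using cc by (intro mult_left_mono) auto
      qed
      show "r n = - ln (\<rho> n / (1 - \<rho> n))" by (rule r)
      show "L n = ln (2 * real (2 * n + CARD('p) + 1))" by (rule L_def)
      show "a n = sqrt (2 * L n / real (num_pairs n)) * cc" by (rule a_eq)
    qed (fact links cmin true_param_local[OF n] estimator[OF n] estimator_measurable(1,2)[OF n]
        estimator_measurable(3,4)[OF n] lambar_eq)+
  qed
  define Goal where "Goal n C \<longleftrightarrow> 1 - exp (- t) \<le> measure (M n) {\<omega> \<in> space (M n).
            excess_risk n (M n) (A n) (Z n) (\<theta>0 n) (\<theta>hat n \<omega>)
              + lambar n *
                (1 / sqrt (real n) * (\<Sum>k=1..2 * n. \<bar>vartheta n (\<theta>hat n \<omega>) k - vartheta n (\<theta>0 n) k\<bar>)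
                 + \<bar>mu (\<theta>hat n \<omega>) - mu (\<theta>0 n)\<bar>
                 + (\<Sum>k\<in>UNIV. \<bar>gamma (\<theta>hat n \<omega>) $ k - gamma (\<theta>0 n) $ k\<bar>))
            \<le> C * (real (s0 n + CARD('p) + 1) * (lambar n)\<^sup>2 / \<rho> n)}" for n C
  have fixed_n: "\<exists>C0. \<forall>C\<ge>C0. Goal n C" if n: "2 \<le> n" for n
  proof -
    interpret E: estimation_model "M n" n "A n" "Z n" "\<theta>0 n" cc "\<theta>hat n" "\<rho> n" "r n" "lam n" "lambar n" K cmin "a n" "L n"
      by (rule model[OF n])
    define S where "S = real (s0 n + CARD('p) + 1) * (lambar n)\<^sup>2 / \<rho> n"
    have S: "0 < S" using E.u_bounds E.\<rho> by (simp add: S_def add_nonneg_pos)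
    obtain x where x: "\<forall>y\<ge>x. 1 - exp (- t) \<le> measure (M n) {\<omega> \<in> space (M n). E.error \<omega> \<le> y}"
      using E.error_tight[of "1 - exp (- t)"] by auto
    have "Goal n C" if "x / S \<le> C" for C
    proof -
      have "x \<le> C * S" using that S by (simp add: pos_divide_le_eq)
      then show ?thesis using x unfolding Goal_def E.error_eq[symmetric] S_def[symmetric] by blast
    qed
    then show ?thesis by blast
  qed
  define \<kappa>1 where "\<kappa>1 = exp (- 2 * K) * cmin / 24"
  \<comment> \<open>The threshold between the regimes: the largest value that satisfies all three
    smallness conditions of \<open>sparse_bound\<close>.\<close>
  define \<epsilon> where "\<epsilon> = min (\<kappa>1 / (12 * cc)) (min (exp (- K) * cmin / (8 * cc)) cmin)"
  define \<kappa>2 where "\<kappa>2 = cmin / (2 * (real CARD('p) + 1))"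
  define \<epsilon>2 where "\<epsilon>2 = \<epsilon> / (p + 1)"
  \<comment> \<open>Half of the allowed failure probability goes to Chebyshev, the other half to the
    Hoeffding events for large n.\<close>
  define \<delta> where "\<delta> = exp (- t) / 2"
  define B1 where "B1 = (1 + real CARD('p)) * cc\<^sup>2 * exp K / \<delta> * exp K / \<kappa>2"
  define B2 where "B2 = 64 * exp 4 * cc\<^sup>2 * (exp K)\<^sup>2 * B1 / \<kappa>2"
  define B3 where "B3 = 2 * (exp K)\<^sup>2 * B1 / \<kappa>2"
  define C1 where "C1 = (2 * exp K * (12 * exp K + 6) + 6) / \<kappa>1"
  define C2 where "C2 = B2 + 16 * B1 / \<epsilon>2 + 16 * B1 + 8 * (1 + B3) + 4 * cc / \<kappa>2 * (cc + 3) * (16 * cc\<^sup>2 * B3 + 1)"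
  have pos: "0 < \<kappa>1" "0 < \<epsilon>" "0 < \<kappa>2" "0 < \<epsilon>2" "0 < \<delta>"
    using cmin cc p by (auto simp: \<kappa>1_def \<epsilon>_def \<kappa>2_def \<epsilon>2_def \<delta>_def add_nonneg_pos)
  have B: "0 < B1" "0 < B2" "0 < B3"
  proof -
    show "0 < B1" unfolding B1_def using pos cc p
      by (intro divide_pos_pos mult_pos_pos) (auto simp: p_def add_pos_nonneg)
    then show "0 < B2" "0 < B3" unfolding B2_def B3_def using pos cc by auto
  qed
  have C1: "0 < C1" unfolding C1_def using pos by (auto intro!: divide_pos_pos add_pos_pos mult_pos_pos)
  have C2: "0 < C2" unfolding C2_def using pos B cc
    by (auto intro!: add_pos_pos divide_pos_pos mult_pos_pos)
  have large_n: "\<forall>\<^sub>F n in sequentially. 2 \<le> n \<and> (1 + p)\<^sup>2 * (1 / real n) \<le> \<delta> \<and> 2 * cc * (2 * a n) \<le> \<kappa>2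
      \<and> 3 * cc / sqrt (real n) \<le> \<kappa>2 / 2 \<and> sqrt (real n) * real (s0 n) * inverse (\<rho> n) * lambar n < \<epsilon> / (p + 2)"
  proof (intro eventually_conj)
    have "(\<lambda>n. (1 + p)\<^sup>2 * (1 / real n)) \<longlonglongrightarrow> (1 + p)\<^sup>2 * 0"
      by (intro tendsto_mult tendsto_const lim_1_over_n)
    then have "\<forall>\<^sub>F n in sequentially. (1 + p)\<^sup>2 * (1 / real n) < \<delta>" using pos by (intro order_tendstoD) auto
    then show "\<forall>\<^sub>F n in sequentially. (1 + p)\<^sup>2 * (1 / real n) \<le> \<delta>" by eventually_elim simp
    have "(\<lambda>n. 2 * cc * (2 * a n)) \<longlonglongrightarrow> 2 * cc * (2 * 0)"
      unfolding a_def by (intro tendsto_mult tendsto_const a_rate_tendsto_0)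
    then have "\<forall>\<^sub>F n in sequentially. 2 * cc * (2 * a n) < \<kappa>2" using pos by (intro order_tendstoD) auto
    then show "\<forall>\<^sub>F n in sequentially. 2 * cc * (2 * a n) \<le> \<kappa>2" by eventually_elim simp
    have "(\<lambda>n. 3 * cc / sqrt (real n)) \<longlonglongrightarrow> 0" by real_asymp
    then have "\<forall>\<^sub>F n in sequentially. 3 * cc / sqrt (real n) < \<kappa>2 / 2" using pos by (intro order_tendstoD) auto
    then show "\<forall>\<^sub>F n in sequentially. 3 * cc / sqrt (real n) \<le> \<kappa>2 / 2" by eventually_elim simp
    show "\<forall>\<^sub>F n in sequentially. sqrt (real n) * real (s0 n) * inverse (\<rho> n) * lambar n < \<epsilon> / (p + 2)"
      using pos p by (intro order_tendstoD(2)[OF rate]) auto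
  qed (rule eventually_ge_at_top)
  then obtain n0 where n0: "\<And>n. n0 \<le> n \<Longrightarrow> 2 \<le> n \<and> (1 + p)\<^sup>2 * (1 / real n) \<le> \<delta> \<and> 2 * cc * (2 * a n) \<le> \<kappa>2
      \<and> 3 * cc / sqrt (real n) \<le> \<kappa>2 / 2 \<and> sqrt (real n) * real (s0 n) * inverse (\<rho> n) * lambar n < \<epsilon> / (p + 2)"
    unfolding eventually_sequentially by blast
  have large: "Goal n C" if "n0 \<le> n" "C1 + C2 \<le> C" for n C
  proof -
    have n: "2 \<le> n" using n0[OF that(1)] by blast
    interpret E: estimation_model "M n" n "A n" "Z n" "\<theta>0 n" cc "\<theta>hat n" "\<rho> n" "r n" "lam n" "lambar n" K cmin "a n" "L n"
      by (rule model[OF n])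
    define S where "S = real (s0 n + CARD('p) + 1) * (lambar n)\<^sup>2 / \<rho> n"
    have s: "E.s = real (s0 n) + p + 1" by (simp add: E.s_eq s0 p_def)
    have S_eq: "S = E.s * (lambar n)\<^sup>2 / \<rho> n" by (simp add: S_def E.s_eq s0)
    have lr: "0 \<le> (lambar n)\<^sup>2 / \<rho> n" using E.\<rho> by simp
    have S0: "0 \<le> S" using E.\<rho> by (simp add: S_def)
    have "\<exists>D\<in>E.events. E.prob D \<le> (1 + p)\<^sup>2 * (1 / real n) + \<delta> \<and> (AE \<omega> in M n. \<omega> \<notin> D \<longrightarrow> E.error \<omega> \<le> C * S)"
    proof (cases "sqrt (real n) * E.s * lambar n / \<rho> n \<le> \<epsilon>")
      case True
      have "\<exists>D\<in>E.events. E.prob D \<le> (1 + real CARD('p))\<^sup>2 * (1 / real n) \<and>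
        (AE \<omega> in M n. \<omega> \<notin> D \<longrightarrow> E.error \<omega> \<le> (2 * exp K * (12 * exp K + 6) + 6) / \<kappa>1 * (E.s * (lambar n)\<^sup>2 / \<rho> n))"
        by (rule E.sparse_bound[OF \<kappa>1_def _ _ _ True]) (auto simp: \<epsilon>_def)
      then obtain D where D: "D \<in> E.events" "E.prob D \<le> (1 + p)\<^sup>2 * (1 / real n)"
        "AE \<omega> in M n. \<omega> \<notin> D \<longrightarrow> E.error \<omega> \<le> C1 * S"
        unfolding C1_def[symmetric] S_eq[symmetric] p_def[symmetric] by (elim bexE conjE)
      have le: "C1 * S \<le> C * S" using that(2) C2 S0 by (intro mult_right_mono) auto
      have "AE \<omega> in M n. \<omega> \<notin> D \<longrightarrow> E.error \<omega> \<le> C * S"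
        using D(3) by eventually_elim (use le in auto)
      moreover have "E.prob D \<le> (1 + p)\<^sup>2 * (1 / real n) + \<delta>" using D(2) pos by linarith
      ultimately show ?thesis using D(1) by (intro bexI[of _ D] conjI)
    next
      case False
      \<comment> \<open>For s0 \<ge> 1 the full sparsity s0 + p + 1 is at most (p + 2) s0, so the
        rate condition at threshold \<epsilon> / (p + 2) would have placed n in the sparse
        regime.\<close>
      have "s0 n = 0"
      proof (rule ccontr)
        assume "s0 n \<noteq> 0"
        then have "1 \<le> real (s0 n)" by simp
        then have "E.s \<le> (p + 2) * real (s0 n)" using p unfolding s
          using mult_left_mono[OF \<open>1 \<le> real (s0 n)\<close>, of "p + 1"] by (simp add: algebra_simps)
        then have "E.s * (sqrt (real n) * inverse (\<rho> n) * lambar n) \<le> (p + 2) * real (s0 n) * (sqrt (real n) * inverse (\<rho> n) * lambar n)"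
          using E.u_bounds E.\<rho> by (intro mult_right_mono) auto
        also have "\<dots> = (p + 2) * (sqrt (real n) * real (s0 n) * inverse (\<rho> n) * lambar n)" by simp
        also have "\<dots> \<le> (p + 2) * (\<epsilon> / (p + 2))"
          using n0[OF that(1)] p by (intro mult_left_mono) auto
        also have "\<dots> = \<epsilon>" using p by simp
        finally show False using False by (simp add: divide_inverse mult_ac)
      qed
      then have zero: "E.SA = {}" "E.SB = {}"
        using card_support[of n "\<theta>0 n"] s0[of n] unfolding E.SA_def E.SB_def by auto
      \<comment> \<open>With s0 = 0 the sparsity is p + 1, and dividing the violated smallness
        condition by it explains \<open>\<epsilon>2\<close>.\<close>
      have \<epsilon>2: "\<epsilon>2 \<le> sqrt (real n) * lambar n / \<rho> n"
      proof -
        have "\<epsilon> \<le> (p + 1) * (sqrt (real n) * lambar n / \<rho> n)"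
          using False \<open>s0 n = 0\<close> by (simp add: s mult_ac)
        then show ?thesis using p by (simp add: \<epsilon>2_def pos_divide_le_eq mult.commute)
      qed
      have large: "2 * cc * E.u \<le> \<kappa>2" "3 * cc / sqrt (real n) \<le> \<kappa>2 / 2"
        using n0[OF that(1)] by (auto simp: E.u_def)
      have "\<exists>D\<in>E.events. E.prob D \<le> (1 + real CARD('p))\<^sup>2 * (1 / real n) + \<delta> \<and>
        (AE \<omega> in M n. \<omega> \<notin> D \<longrightarrow> E.error \<omega> \<le> C2 * ((lambar n)\<^sup>2 / \<rho> n))"
        by (rule E.homogeneous_bound[OF zero \<kappa>2_def large pos(4) \<epsilon>2 pos(5) B1_def B2_def B3_def C2_def])
      then obtain D where D: "D \<in> E.events" "E.prob D \<le> (1 + p)\<^sup>2 * (1 / real n) + \<delta>"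
        "AE \<omega> in M n. \<omega> \<notin> D \<longrightarrow> E.error \<omega> \<le> C2 * ((lambar n)\<^sup>2 / \<rho> n)"
        unfolding p_def[symmetric] by (elim bexE conjE)
      have le: "C2 * ((lambar n)\<^sup>2 / \<rho> n) \<le> C * S"
      proof (rule mult_mono)
        have "1 * ((lambar n)\<^sup>2 / \<rho> n) \<le> E.s * ((lambar n)\<^sup>2 / \<rho> n)"
          using E.s_ge lr by (rule mult_right_mono)
        then show "(lambar n)\<^sup>2 / \<rho> n \<le> S" by (simp add: S_eq)
      qed (use that(2) C1 C2 lr in auto)
      have "AE \<omega> in M n. \<omega> \<notin> D \<longrightarrow> E.error \<omega> \<le> C * S"
        using D(3) by eventually_elim (use le in auto)
      then show ?thesis using D(1,2) by (intro bexI[of _ D] conjI)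
    qed
    then obtain D where D: "D \<in> E.events" "E.prob D \<le> (1 + p)\<^sup>2 * (1 / real n) + \<delta>"
      "AE \<omega> in M n. \<omega> \<notin> D \<longrightarrow> E.error \<omega> \<le> C * S"
      by (elim bexE conjE)
    have "E.prob D \<le> \<delta> + \<delta>" using D(2) n0[OF that(1)] by linarith
    then have "1 - exp (- t) \<le> 1 - E.prob D" by (simp add: \<delta>_def)
    also have "\<dots> \<le> E.prob {\<omega> \<in> space (M n). E.error \<omega> \<le> C * S}"
      by (rule E.prob_error_le_ge[OF D(1,3)])
    finally show ?thesis unfolding Goal_def E.error_eq[symmetric] S_def[symmetric] .
  qed
  from fixed_n obtain Cn where Cn: "\<And>n C. 2 \<le> n \<Longrightarrow> Cn n \<le> C \<Longrightarrow> Goal n C" by metis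
  \<comment> \<open>C1 and C2 depend only on \<open>cmin\<close>, \<open>cc\<close>, p, t and the
    bound on \<Gamma>; each n below the threshold contributes its own constant.\<close>
  define C where "C = C1 + C2 + (\<Sum>n<n0. \<bar>Cn n\<bar>)"
  have "C1 + C2 \<le> C" unfolding C_def by (simp add: sum_nonneg)
  moreover have "Cn n \<le> C" if "n < n0" for n
  proof -
    have "\<bar>Cn n\<bar> \<le> (\<Sum>n<n0. \<bar>Cn n\<bar>)" using that by (intro member_le_sum) auto
    then show ?thesis unfolding C_def using C1 C2 by linarith
  qed
  ultimately have "Goal n C" if "2 \<le> n" for n
    using large[of n C] Cn[OF that, of C] by (cases "n < n0") auto
  moreover have "0 < C" using \<open>C1 + C2 \<le> C\<close> C1 C2 by linarith
  ultimately show ?thesis unfolding Goal_def by blast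
qed

end
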